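(* Let $d\ge 1$ and consider the dimer-placement process on the nearest-neighbour graph $\mathbb{Z}^d$ with i.i.d. uniform $[0,1]$ edge times $(\tau_e)_e$. For $v\in\mathbb{Z}^d$ let $X_v\in\{0,1\}$ be the indicator of the event that $v$ does not belong to any edge of the final set $E(1)$. Let $\Lambda_n\subset\mathbb{Z}^d$ be the box of side-length $n$, $\Lambda_n=\{1,\dots,n\}^d$, and set $$S_n=\frac{1}{|\Lambda_n|}\sum_{v\in\Lambda_n}\bigl(X_v-\mathbb{E}X_v\bigr).$$ Then $\sum_{\rho\in\mathbb{Z}^d}|\mathrm{Cov}(X_0,X_\rho)|<\infty$, the number $\sigma^2=\sum_{\rho\in\mathbb{Z}^d}\mathrm{Cov}(X_0,X_\rho)$ is strictly positive, and $\sqrt{|\Lambda_n|}\,S_n/\sigma$ converges in distribution to the standard normal law $N(0,1)$ as $n\to\infty$.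
   Context: The graph $\mathbb{Z}^d$ has vertex set $\mathbb{Z}^d$ and an edge between each pair of vertices at Euclidean distance $1$. To each edge $e$ is associated an independent random variable $\tau_e$, uniform on $[0,1]$ (its "wakeup time"). The dimer-placement process is the family of edge sets $E(t)$, $t\in[0,1]$ (almost surely existing and unique), with $E(0)=\emptyset$ and $$E(t)=E(t_-)\cup\{e : \tau_e=t \text{ and } e\cap E(t_-)=\emptyset\},\qquad E(t_-)=\bigcup_{s<t}E(s),$$ where $e\cap E(t_-)=\emptyset$ means that $e$ shares no vertex with any edge of $E(t_-)$. That is, at time $\tau_e$ the edge $e$ is added (a dimer is placed on it) if and only if neither of its endpoints is already covered by a previously added edge. *)

theory Defs
  imports "HOL-Probability.Probability"
begin

definition real_point :: "int ^ 'd \<Rightarrow> real ^ 'd" where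
  "real_point x = (\<chi> i. real_of_int (x $ i))"

definition lattice_edges :: "(int ^ 'd) set set" where
  "lattice_edges = {e. \<exists>x y. e = {x, y} \<and> dist (real_point x) (real_point y) = 1}"

definition before :: "(real \<Rightarrow> 'v set set) \<Rightarrow> real \<Rightarrow> 'v set set" where
  "before E t = (\<Union>s\<in>{0..<t}. E s)"

text \<open>
  The third clause (right-continuity) says that no edge appears other than at its own
  wakeup time. The first two alone do not say this and so do not determine the
  process: for example, putting all edges into \<open>E t\<close> for every \<open>t > 0\<close> satisfies them,
  since then \<open>before E t\<close> already contains all edges.
\<close>

definition dimer_placement :: "((int ^ 'd) set \<Rightarrow> real) \<Rightarrow> (real \<Rightarrow> (int ^ 'd) set set) \<Rightarrow> bool" where
  "dimer_placement \<tau> E \<longleftrightarrow>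
     E 0 = {} \<and>
     (\<forall>t\<in>{0..1}. E t = before E t \<union>
        {e \<in> lattice_edges. \<tau> e = t \<and> (\<forall>f\<in>before E t. e \<inter> f = {})}) \<and>
     (\<forall>t\<in>{0..<1}. E t = (\<Inter>s\<in>{t<..1}. E s))"

definition iid_uniform_times :: "'w measure \<Rightarrow> ((int ^ 'd) set \<Rightarrow> 'w \<Rightarrow> real) \<Rightarrow> bool" where
  "iid_uniform_times M \<tau> \<longleftrightarrow>
     prob_space.indep_vars M (\<lambda>_. borel) \<tau> lattice_edges \<and>
     (\<forall>e\<in>lattice_edges. distr M borel (\<tau> e) = uniform_measure lborel {0..1})"

definition random_edge_set :: "'w measure \<Rightarrow> ('w \<Rightarrow> (int ^ 'd) set set) \<Rightarrow> bool" where
  "random_edge_set M A \<longleftrightarrow>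
     (\<forall>\<omega>\<in>space M. A \<omega> \<subseteq> lattice_edges) \<and>
     (\<forall>e\<in>lattice_edges. {\<omega> \<in> space M. e \<in> A \<omega>} \<in> sets M)"

text \<open>
  The process is determined by the wakeup times only up to a null set, so it is
  described as any family of random edge sets that almost surely satisfies the recursion.
\<close>

definition dimer_placement_process ::
  "'w measure \<Rightarrow> ((int ^ 'd) set \<Rightarrow> 'w \<Rightarrow> real) \<Rightarrow> (real \<Rightarrow> 'w \<Rightarrow> (int ^ 'd) set set) \<Rightarrow> bool" where
  "dimer_placement_process M \<tau> E \<longleftrightarrow>
     (\<forall>t\<in>{0..1}. random_edge_set M (E t)) \<and>
     (AE \<omega> in M. dimer_placement (\<lambda>e. \<tau> e \<omega>) (\<lambda>t. E t \<omega>))"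

definition uncovered :: "(real \<Rightarrow> 'w \<Rightarrow> 'v set set) \<Rightarrow> 'v \<Rightarrow> 'w \<Rightarrow> real" where
  "uncovered E v \<omega> = of_bool (v \<notin> \<Union>(E 1 \<omega>))"

definition lattice_box :: "nat \<Rightarrow> (int ^ 'd) set" where
  "lattice_box n = {v. \<forall>i. v $ i \<in> {1..int n}}"

definition covariance :: "'w measure \<Rightarrow> ('w \<Rightarrow> real) \<Rightarrow> ('w \<Rightarrow> real) \<Rightarrow> real" where
  "covariance M X Y =
     (\<integral>\<omega>. (X \<omega> - integral\<^sup>L M X) * (Y \<omega> - integral\<^sup>L M Y) \<partial>M)"

definition centred_average ::
  "'w measure \<Rightarrow> (real \<Rightarrow> 'w \<Rightarrow> (int ^ 'd) set set) \<Rightarrow> nat \<Rightarrow> 'w \<Rightarrow> real" where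
  "centred_average M E n \<omega> =
     1 / real (card (lattice_box n :: (int ^ 'd) set)) *
     (\<Sum>v\<in>lattice_box n. uncovered E v \<omega> - integral\<^sup>L M (uncovered E v))"

end

theory Submission
  imports Defs
begin

text \<open>
  The proof describes the final set without time: an edge is placed if and only if no
  conflicting edge with an earlier clock is placed (\<open>dimer_greedy\<close>). The fate of an edge is
  therefore decided along chains of adjacent edges with decreasing clocks. A given chain of \<open>k\<close>
  steps is decreasing with probability at most a constant times \<open>L ^ (- k)\<close> for any fixed \<open>L\<close>, while
  the number of chains grows only exponentially; so long descents are exponentially unlikely
  (\<open>descends_prob\<close>). Cutting the recursion off at depth \<open>k\<close> gives an approximation \<open>local_free\<close>
  of the indicator \<open>free\<close> of an uncovered site that depends only on clocks within distance
  \<open>k + 1\<close> and is wrong with probability of order \<open>2 ^ (- k)\<close>. Hence covariances decay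
  exponentially (\<open>cov_decay\<close>), and the variance of the number of uncovered sites in a box,
  divided by the number of sites, converges to the sum of the covariances
  (\<open>box_variance_tendsto\<close>).

  That sum is positive because the number of uncovered sites reacts to local randomness that
  the rest of the lattice cannot compensate. A finite configuration of early clocks isolates a
  path of four sites. Exchanging the clocks of two of its edges then changes the number of
  uncovered sites by two and affects no other site. The difference of the two indicators is a
  centred local function with nonnegative covariance with every site and positive covariance
  with at least one of them; only nearby translates of it are correlated, and the Cauchy-Schwarz
  inequality
  bounds the variance in a box from below by a multiple of its volume (\<open>limit_variance_pos\<close>).

  For the central limit theorem, the depth is chosen of the order of \<open>log n\<close>. The centred local
  approximations are then locally dependent with neighbourhoods of polylogarithmic size. For
  such sums Stein's identity shows that the characteristic function almost satisfies the
  differential equation \<open>\<phi>' = - v * t * \<phi>\<close> of the Gaussian one, with a quantitative error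
  (\<open>char_gaussian_bound\<close>). Levy's continuity theorem concludes.
\<close>

section \<open>Characteristic functions of locally dependent sums\<close>

lemma has_vector_derivative_if_quadratic:
  fixes f :: "real \<Rightarrow> complex"
  assumes "\<And>h. norm (f (t + h) - f t - h *\<^sub>R d) \<le> C * h\<^sup>2"
  shows "(f has_vector_derivative d) (at t)"
  unfolding has_vector_derivative_def
proof (rule has_derivativeI_sandwich[where e = 1 and H = "\<lambda>y. C * \<bar>y - t\<bar>"])
  show "bounded_linear (\<lambda>x. x *\<^sub>R d)" by (rule bounded_linear_scaleR_left)
  fix y :: real
  assume "y \<noteq> t"
  have "norm (f y - f t - (y - t) *\<^sub>R d) \<le> (C * \<bar>y - t\<bar>) * \<bar>y - t\<bar>"
    using assms[of "y - t"] by (simp add: power2_eq_square mult.assoc)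
  then show "norm (f y - f t - (y - t) *\<^sub>R d) / norm (y - t) \<le> C * \<bar>y - t\<bar>"
    using \<open>y \<noteq> t\<close> by (simp add: divide_le_eq)
next
  show "((\<lambda>y. C * \<bar>y - t\<bar>) \<longlongrightarrow> 0) (at t)"
    by (rule tendsto_eq_intros refl | simp)+
qed simp

lemma norm_iexp_minus_linear: "norm (iexp x - 1 - \<i> * of_real x) \<le> x\<^sup>2 / 2"
  using iexp_approx1[of x 1] by (simp add: algebra_simps power2_eq_square numeral_2_eq_2)

lemma (in prob_space) integrable_bounded:
  fixes f :: "'a \<Rightarrow> real"
  assumes "random_variable borel f" "\<And>x. \<bar>f x\<bar> \<le> C"
  shows "integrable M f"
  by (rule integrable_const_bound[where B = C]) (use assms in auto)

lemma (in prob_space) integrable_bounded_complex: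
  fixes f :: "'a \<Rightarrow> complex"
  assumes "random_variable borel f" "\<And>x. norm (f x) \<le> C"
  shows "integrable M f"
  by (rule integrable_const_bound[where B = C]) (use assms in auto)

lemma (in prob_space) char_has_vector_derivative:
  assumes [measurable]: "random_variable borel S" and bound: "\<And>\<omega>. \<bar>S \<omega>\<bar> \<le> C"
  shows "((\<lambda>t. expectation (\<lambda>\<omega>. iexp (t * S \<omega>))) has_vector_derivative
           \<i> * expectation (\<lambda>\<omega>. of_real (S \<omega>) * iexp (t * S \<omega>))) (at t)"
proof (rule has_vector_derivative_if_quadratic[where C = "C\<^sup>2"])
  fix h :: real
  have C0: "0 \<le> C" using bound[of undefined] by linarith
  have int: "integrable M (\<lambda>\<omega>. iexp (t * S \<omega>))" for t
    by (rule integrable_const_bound[where B = 1]) auto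
  have int2: "integrable M (\<lambda>\<omega>. of_real (S \<omega>) * iexp (t * S \<omega>))" for t
    by (rule integrable_const_bound[where B = C]) (auto simp: norm_mult bound)
  let ?g = "\<lambda>\<omega>. iexp (t * S \<omega>) * (iexp (h * S \<omega>) - 1 - \<i> * of_real (h * S \<omega>))"
  have g: "?g \<omega> = iexp ((t + h) * S \<omega>) - iexp (t * S \<omega>) -
     h *\<^sub>R (\<i> * (of_real (S \<omega>) * iexp (t * S \<omega>)))" for \<omega>
    by (simp add: algebra_simps exp_add[symmetric] scaleR_conv_of_real)
  have ng: "norm (?g \<omega>) \<le> C\<^sup>2 * h\<^sup>2" for \<omega>
  proof -
    have "norm (?g \<omega>) = norm (iexp (h * S \<omega>) - 1 - \<i> * of_real (h * S \<omega>))"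
      by (simp add: norm_mult del: of_real_mult)
    also have "\<dots> \<le> (h * S \<omega>)\<^sup>2 / 2" by (rule norm_iexp_minus_linear)
    also have "\<dots> \<le> (h * S \<omega>)\<^sup>2" by simp
    also have "\<dots> \<le> C\<^sup>2 * h\<^sup>2"
      using power_mono[OF bound[of \<omega>], of 2]
      by (simp add: power_mult_distrib mult.commute[of _ "h\<^sup>2"] mult_left_mono)
    finally show ?thesis .
  qed
  have intg: "integrable M ?g"
    by (rule integrable_const_bound[where B = "C\<^sup>2 * h\<^sup>2"]) (use ng in auto)
  have "expectation (\<lambda>\<omega>. iexp ((t + h) * S \<omega>)) - expectation (\<lambda>\<omega>. iexp (t * S \<omega>))
     - h *\<^sub>R (\<i> * expectation (\<lambda>\<omega>. of_real (S \<omega>) * iexp (t * S \<omega>))) = expectation ?g"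
    unfolding g using int int2 by (simp del: of_real_add)
  also have "norm \<dots> \<le> expectation (\<lambda>\<omega>. norm (?g \<omega>))" by (rule integral_norm_bound)
  also have "\<dots> \<le> C\<^sup>2 * h\<^sup>2"
    using integral_le_const[OF integrable_norm[OF intg], of "C\<^sup>2 * h\<^sup>2"] ng by simp
  finally show "norm (expectation (\<lambda>\<omega>. iexp ((t + h) * S \<omega>)) - expectation (\<lambda>\<omega>. iexp (t * S \<omega>))
     - h *\<^sub>R (\<i> * expectation (\<lambda>\<omega>. of_real (S \<omega>) * iexp (t * S \<omega>)))) \<le> C\<^sup>2 * h\<^sup>2" .
qed

text \<open>
  The factor \<open>exp (v * s\<^sup>2 / 2)\<close> solves the homogeneous equation \<open>\<phi>' + v * s * \<phi> = 0\<close>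
  exactly, so its product with \<open>\<phi>\<close> moves only at the rate of the error. As \<open>v \<ge> 0\<close>, the
  factor is largest at the end point, where it cancels against its own inverse.
\<close>

lemma gaussian_ode_bound:
  fixes \<phi> \<phi>' :: "real \<Rightarrow> complex" and v :: real
  assumes der: "\<And>s. (\<phi> has_vector_derivative \<phi>' s) (at s)"
    and zero: "\<phi> 0 = 1" and v: "0 \<le> v"
    and err: "\<And>s. \<bar>s\<bar> \<le> \<bar>t\<bar> \<Longrightarrow> norm (\<phi>' s + of_real (v * s) * \<phi> s) \<le> B"
  shows "norm (\<phi> t - of_real (exp (- v * t\<^sup>2 / 2))) \<le> \<bar>t\<bar> * B"
proof -
  let ?g = "\<lambda>s. of_real (exp (v * s\<^sup>2 / 2)) * \<phi> s"
  let ?d = "\<lambda>s. of_real (exp (v * s\<^sup>2 / 2)) * (\<phi>' s + of_real (v * s) * \<phi> s)"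
  let ?B = "exp (v * t\<^sup>2 / 2) * B"
  have dr: "((\<lambda>s. exp (v * s\<^sup>2 / 2)) has_real_derivative exp (v * s\<^sup>2 / 2) * (v * s)) (at s)" for s
    by (auto intro!: derivative_eq_intros)
  have "((\<lambda>s. exp (v * s\<^sup>2 / 2) *\<^sub>R \<phi> s) has_vector_derivative
      (exp (v * s\<^sup>2 / 2) *\<^sub>R \<phi>' s + (exp (v * s\<^sup>2 / 2) * (v * s)) *\<^sub>R \<phi> s)) (at s)" for s
    by (rule has_vector_derivative_scaleR[OF dr der])
  then have dg: "(?g has_vector_derivative ?d s) (at s)" for s
    by (simp add: scaleR_conv_of_real algebra_simps)
  have B: "0 \<le> B" using err[of t] by (smt (verit) norm_ge_zero)
  have "norm (?g t - ?g 0) \<le> ?B * norm (t - 0)"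
  proof (rule differentiable_bound[of "{- \<bar>t\<bar>..\<bar>t\<bar>}" ?g "\<lambda>s h. h *\<^sub>R ?d s"])
    fix s assume s: "s \<in> {- \<bar>t\<bar>..\<bar>t\<bar>}"
    show "(?g has_derivative (\<lambda>h. h *\<^sub>R ?d s)) (at s within {- \<bar>t\<bar>..\<bar>t\<bar>})"
      using dg[of s] unfolding has_vector_derivative_def
      by (rule has_derivative_at_withinI)
    show "onorm (\<lambda>h. h *\<^sub>R ?d s) \<le> ?B"
    proof (rule onorm_bound)
      show "0 \<le> ?B" using B by simp
      fix h :: real
      have "s\<^sup>2 \<le> t\<^sup>2" using s by (intro abs_le_square_iff[THEN iffD1]) auto
      then have "exp (v * s\<^sup>2 / 2) \<le> exp (v * t\<^sup>2 / 2)"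
        using v by (simp add: mult_left_mono)
      then have "norm (?d s) \<le> ?B"
        using err[of s] s B by (auto simp: norm_mult intro!: mult_mono)
      then show "norm (h *\<^sub>R ?d s) \<le> ?B * norm h"
        by (metis mult.commute mult_left_mono norm_ge_zero norm_scaleR real_norm_def)
    qed
  qed auto
  then have *: "norm (?g t - 1) \<le> exp (v * t\<^sup>2 / 2) * (\<bar>t\<bar> * B)"
    using zero by (simp add: mult_ac)
  have e: "exp (- v * t\<^sup>2 / 2) * exp (v * t\<^sup>2 / 2) = 1"
    by (simp add: exp_add[symmetric])
  have "\<phi> t - of_real (exp (- v * t\<^sup>2 / 2)) = of_real (exp (- v * t\<^sup>2 / 2)) * (?g t - 1)"
    using e by (simp add: algebra_simps of_real_mult[symmetric] mult.assoc[symmetric] del: of_real_mult)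
  then have "norm (\<phi> t - of_real (exp (- v * t\<^sup>2 / 2))) = exp (- v * t\<^sup>2 / 2) * norm (?g t - 1)"
    by (simp add: norm_mult)
  also have "\<dots> \<le> exp (- v * t\<^sup>2 / 2) * (exp (v * t\<^sup>2 / 2) * (\<bar>t\<bar> * B))"
    using * by (intro mult_left_mono) auto
  also have "\<dots> = \<bar>t\<bar> * B" using e by (simp add: mult.assoc[symmetric])
  finally show ?thesis .
qed

lemma (in prob_space) square_expectation_le:
  fixes X :: "'a \<Rightarrow> real"
  assumes [measurable]: "random_variable borel X" and b: "\<And>\<omega>. \<bar>X \<omega>\<bar> \<le> C"
  shows "expectation (\<lambda>\<omega>. \<bar>X \<omega>\<bar>) \<le> sqrt (expectation (\<lambda>\<omega>. (X \<omega>)\<^sup>2))"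
proof (rule real_le_rsqrt)
  have i1: "integrable M (\<lambda>\<omega>. \<bar>X \<omega>\<bar>)"
    by (rule integrable_const_bound[where B = C]) (use b in auto)
  have i2: "integrable M (\<lambda>\<omega>. \<bar>X \<omega>\<bar>\<^sup>2)"
    by (rule integrable_const_bound[where B = "C\<^sup>2"]) (use power_mono[OF b, of _ 2] in auto)
  show "(expectation (\<lambda>\<omega>. \<bar>X \<omega>\<bar>))\<^sup>2 \<le> expectation (\<lambda>\<omega>. (X \<omega>)\<^sup>2)"
    using variance_positive[of "\<lambda>\<omega>. \<bar>X \<omega>\<bar>"] variance_eq[OF i1 i2] by simp
qed

lemma sum_of_bool_mult:
  fixes g :: "'b \<Rightarrow> real"
  assumes "finite J" "A \<subseteq> J"
  shows "(\<Sum>k\<in>J. of_bool (k \<in> A) * g k) = (\<Sum>k\<in>A. g k)"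
  using assms by (intro sum.mono_neutral_cong_right) auto

text \<open>
  The assumptions \<open>far\<close>, \<open>far_pair\<close> and \<open>far_quadruple\<close> are the consequences of
  independence outside the neighbourhoods \<open>N i\<close> on which the Gaussian approximation rests.
  They are stated as identities between expectations, so that nothing needs to be known
  about the origin of the independence.
\<close>

locale dependency_neighbourhoods = prob_space M for M :: "'w measure" +
  fixes I :: "'i set" and N :: "'i \<Rightarrow> 'i set" and Y :: "'i \<Rightarrow> 'w \<Rightarrow> real" and D :: nat
  assumes finite_I: "finite I"
    and N_subset: "\<And>i. i \<in> I \<Longrightarrow> N i \<subseteq> I"
    and N_sym: "\<And>i j. i \<in> I \<Longrightarrow> j \<in> I \<Longrightarrow> j \<in> N i \<Longrightarrow> i \<in> N j"
    and card_N: "\<And>i. i \<in> I \<Longrightarrow> card (N i) \<le> D"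
    and Y_measurable [measurable]: "\<And>i. random_variable borel (Y i)"
    and Y_bound: "\<And>i \<omega>. \<bar>Y i \<omega>\<bar> \<le> 1"
    and far: "\<And>i t. i \<in> I \<Longrightarrow> expectation (\<lambda>\<omega>. of_real (Y i \<omega>) * iexp (t * (\<Sum>j\<in>I - N i. Y j \<omega>))) = 0"
    and far_pair: "\<And>i j. i \<in> I \<Longrightarrow> j \<in> I - N i \<Longrightarrow> expectation (\<lambda>\<omega>. Y i \<omega> * Y j \<omega>) = 0"
    and far_quadruple: "\<And>i j k l. i \<in> I \<Longrightarrow> j \<in> N i \<Longrightarrow> k \<in> I - (N i \<union> N j) \<Longrightarrow> l \<in> N k - (N i \<union> N j) \<Longrightarrow>
       expectation (\<lambda>\<omega>. (Y i \<omega> * Y j \<omega>) * (Y k \<omega> * Y l \<omega>)) =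
       expectation (\<lambda>\<omega>. Y i \<omega> * Y j \<omega>) * expectation (\<lambda>\<omega>. Y k \<omega> * Y l \<omega>)"
begin

definition S :: "'w \<Rightarrow> real" where "S \<omega> = (\<Sum>i\<in>I. Y i \<omega>)"

definition Z :: "'i \<Rightarrow> 'w \<Rightarrow> real" where "Z i \<omega> = Y i \<omega> * (\<Sum>j\<in>N i. Y j \<omega>)"

definition s2 :: real where "s2 = expectation (\<lambda>\<omega>. (S \<omega>)\<^sup>2)"

lemma finite_N: "i \<in> I \<Longrightarrow> finite (N i)"
  using finite_I N_subset finite_subset by blast

lemma S_measurable [measurable]: "random_variable borel S"
  unfolding S_def by measurable

lemma Z_measurable [measurable]: "random_variable borel (Z i)"
  unfolding Z_def by measurable

lemma sum_Y_bound: "\<bar>\<Sum>j\<in>A. Y j \<omega>\<bar> \<le> card A"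
  using sum_norm_bound[of A "\<lambda>j. Y j \<omega>" 1] Y_bound by auto

lemma S_bound: "\<bar>S \<omega>\<bar> \<le> card I"
  unfolding S_def by (rule sum_Y_bound)

lemma prod_Y_bound: "\<bar>Y i \<omega> * Y j \<omega>\<bar> \<le> 1"
  using Y_bound[of i \<omega>] Y_bound[of j \<omega>] by (simp add: abs_mult mult_le_one)

lemma integrable_YY: "integrable M (\<lambda>\<omega>. Y i \<omega> * Y j \<omega>)"
  by (rule integrable_bounded[where C = 1]) (use prod_Y_bound in auto)

lemma Z_bound: "i \<in> I \<Longrightarrow> \<bar>Z i \<omega>\<bar> \<le> D"
proof -
  assume i: "i \<in> I"
  have "\<bar>Z i \<omega>\<bar> \<le> 1 * real (card (N i))"
    unfolding Z_def abs_mult by (rule mult_mono[OF Y_bound sum_Y_bound]) auto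
  with card_N[OF i] show ?thesis by simp
qed

lemma s2_eq: "s2 = (\<Sum>i\<in>I. expectation (Z i))"
proof -
  have "s2 = expectation (\<lambda>\<omega>. \<Sum>i\<in>I. \<Sum>j\<in>I. Y i \<omega> * Y j \<omega>)"
    unfolding s2_def S_def by (simp add: power2_eq_square sum_product)
  also have "\<dots> = (\<Sum>i\<in>I. \<Sum>j\<in>I. expectation (\<lambda>\<omega>. Y i \<omega> * Y j \<omega>))"
    by (simp add: integrable_YY)
  also have "\<dots> = (\<Sum>i\<in>I. \<Sum>j\<in>N i. expectation (\<lambda>\<omega>. Y i \<omega> * Y j \<omega>))"
    by (intro sum.cong refl sum.mono_neutral_right) (use finite_I N_subset far_pair in auto)
  also have "\<dots> = (\<Sum>i\<in>I. expectation (Z i))"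
    unfolding Z_def sum_distrib_left by (simp add: integrable_YY)
  finally show ?thesis .
qed

lemma s2_nonneg: "0 \<le> s2"
  unfolding s2_def by simp

definition product_cov :: "'i \<Rightarrow> 'i \<Rightarrow> 'i \<Rightarrow> 'i \<Rightarrow> real" where
  "product_cov i j k l = expectation (\<lambda>\<omega>. (Y i \<omega> * Y j \<omega>) * (Y k \<omega> * Y l \<omega>)) -
       expectation (\<lambda>\<omega>. Y i \<omega> * Y j \<omega>) * expectation (\<lambda>\<omega>. Y k \<omega> * Y l \<omega>)"

lemma abs_expectation_le_1:
  fixes f :: "'w \<Rightarrow> real"
  assumes "random_variable borel f" "\<And>\<omega>. \<bar>f \<omega>\<bar> \<le> 1" shows "\<bar>expectation f\<bar> \<le> 1"
proof -
  have i: "integrable M f" by (rule integrable_bounded[OF assms])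
  have "\<bar>expectation f\<bar> \<le> expectation (\<lambda>\<omega>. \<bar>f \<omega>\<bar>)" by (rule integral_abs_bound)
  also have "\<dots> \<le> 1" by (rule integral_le_const) (use i assms in auto)
  finally show ?thesis .
qed

lemma prod_YY_bound: "\<bar>(Y i \<omega> * Y j \<omega>) * (Y k \<omega> * Y l \<omega>)\<bar> \<le> 1"
  using prod_Y_bound[of i \<omega> j] prod_Y_bound[of k \<omega> l] by (simp only: abs_mult[of "Y i \<omega> * Y j \<omega>"] mult_le_one abs_ge_zero)

lemma product_cov_bound: "\<bar>product_cov i j k l\<bar> \<le> 2"
proof -
  have 1: "\<bar>expectation (\<lambda>\<omega>. (Y i \<omega> * Y j \<omega>) * (Y k \<omega> * Y l \<omega>))\<bar> \<le> 1"
    by (rule abs_expectation_le_1) (use prod_YY_bound in auto)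
  have 2: "\<bar>expectation (\<lambda>\<omega>. Y i \<omega> * Y j \<omega>)\<bar> \<le> 1" for i j
    by (rule abs_expectation_le_1) (use prod_Y_bound in auto)
  have "\<bar>expectation (\<lambda>\<omega>. Y i \<omega> * Y j \<omega>) * expectation (\<lambda>\<omega>. Y k \<omega> * Y l \<omega>)\<bar> \<le> 1"
    using 2[of i j] 2[of k l] by (simp only: abs_mult mult_le_one abs_ge_zero)
  with 1 show ?thesis unfolding product_cov_def by linarith
qed

text \<open>
  A nonzero term needs \<open>k\<close> or \<open>l\<close> in \<open>N i \<union> N j\<close>, which has at most \<open>2 * D\<close> elements. The
  other index is then confined to a single neighbourhood: \<open>N k\<close> in the first case and, by
  symmetry of the neighbourhood relation, \<open>N l\<close> in the second.
\<close>

lemma product_cov_sum_bound: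
  assumes i: "i \<in> I" and j: "j \<in> N i"
  shows "(\<Sum>k\<in>I. \<Sum>l\<in>N k. product_cov i j k l) \<le> 8 * real D ^ 2"
proof -
  let ?A = "N i \<union> N j"
  have jI: "j \<in> I" using i j N_subset by auto
  have finA: "finite ?A" "?A \<subseteq> I" "card ?A \<le> 2 * D"
    using finite_N i jI N_subset card_N[OF i] card_N[OF jI] card_Un_le[of "N i" "N j"] by auto
  have zero: "product_cov i j k l = 0" if "k \<in> I - ?A" "l \<in> N k - ?A" for k l
    using far_quadruple[OF i j that] unfolding product_cov_def by simp
  have le: "product_cov i j k l \<le> 2 * of_bool (k \<in> ?A) + 2 * of_bool (l \<in> ?A)" if "k \<in> I" "l \<in> N k" for k l
    using product_cov_bound[of i j k l] zero[of k l] that by (auto simp: of_bool_def split: if_splits)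
  have "(\<Sum>k\<in>I. \<Sum>l\<in>N k. product_cov i j k l) \<le>
     (\<Sum>k\<in>I. \<Sum>l\<in>N k. 2 * of_bool (k \<in> ?A) + 2 * of_bool (l \<in> ?A))"
    by (intro sum_mono le)
  also have "\<dots> = 2 * (\<Sum>k\<in>I. \<Sum>l\<in>N k. of_bool (k \<in> ?A)) + 2 * (\<Sum>k\<in>I. \<Sum>l\<in>N k. of_bool (l \<in> ?A))"
    unfolding sum.distrib sum_distrib_left ..
  also have "(\<Sum>k\<in>I. \<Sum>l\<in>N k. of_bool (k \<in> ?A)) = (\<Sum>k\<in>I. of_bool (k \<in> ?A) * real (card (N k)))"
    by (simp add: mult.commute)
  also have "\<dots> = (\<Sum>k\<in>?A. real (card (N k)))"
    using sum_of_bool_mult[OF finite_I finA(2), of "\<lambda>k. real (card (N k))"] .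
  also have "\<dots> \<le> (\<Sum>k\<in>?A. real D)"
    by (intro sum_mono) (use card_N finA in auto)
  also have "\<dots> \<le> 2 * real D * real D"
    using finA(3) by (auto intro!: mult_right_mono)
  also have "(\<Sum>k\<in>I. \<Sum>l\<in>N k. of_bool (l \<in> ?A)) = (\<Sum>k\<in>I. \<Sum>l\<in>I. of_bool (l \<in> N k) * (of_bool (l \<in> ?A) :: real))"
    by (intro sum.cong refl sum_of_bool_mult[symmetric] finite_I N_subset)
  also have "\<dots> = (\<Sum>l\<in>I. \<Sum>k\<in>I. of_bool (l \<in> N k) * (of_bool (l \<in> ?A) :: real))"
    by (rule sum.swap)
  also have "\<dots> \<le> (\<Sum>l\<in>I. of_bool (l \<in> ?A) * real D)"
  proof (rule sum_mono)
    fix l assume l: "l \<in> I"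
    have "(\<Sum>k\<in>I. of_bool (l \<in> N k)) \<le> (\<Sum>k\<in>I. (of_bool (k \<in> N l) :: real))"
      by (intro sum_mono) (use N_sym l in auto)
    also have "\<dots> = card (N l)" using finite_I N_subset[OF l] by (simp add: of_bool_def sum.If_cases Int_absorb1)
    also have "\<dots> \<le> D" using card_N[OF l] by simp
    finally show "(\<Sum>k\<in>I. of_bool (l \<in> N k) * (of_bool (l \<in> ?A) :: real)) \<le> of_bool (l \<in> ?A) * real D"
      by (simp add: sum_distrib_right[symmetric])
  qed
  also have "\<dots> = card ?A * real D"
    using sum_of_bool_mult[OF finite_I finA(2), of "\<lambda>_. real D"] by simp
  also have "\<dots> \<le> 2 * real D * real D"
    using finA(3) by (auto intro!: mult_right_mono)
  finally show ?thesis by (simp add: power2_eq_square)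
qed

text \<open>
  The mean of \<open>\<Sum>i\<in>I. Z i\<close> is \<open>s2\<close>, which may be as large as \<open>card I\<close>, whereas its fluctuations
  for fixed \<open>D\<close> are only of the order of the square root of \<open>card I\<close>. Hence the random sum may be replaced
  by the number \<open>s2\<close>.
\<close>

lemma variance_sum_Z:
  "expectation (\<lambda>\<omega>. ((\<Sum>i\<in>I. Z i \<omega>) - s2)\<^sup>2) \<le> 8 * real (card I) * real D ^ 3"
proof -
  have i4: "integrable M (\<lambda>\<omega>. (Y i \<omega> * Y j \<omega>) * (Y k \<omega> * Y l \<omega>))" for i j k l
    by (rule integrable_bounded[where C = 1]) (use prod_YY_bound in auto)
  let ?Z = "\<lambda>\<omega>. \<Sum>i\<in>I. Z i \<omega>"
  have Zb: "\<bar>?Z \<omega>\<bar> \<le> card I * D" for \<omega>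
    using sum_norm_bound[of I "\<lambda>j. Z j \<omega>" D] Z_bound by auto
  have i1: "integrable M ?Z"
    by (rule integrable_bounded[where C = "card I * D"]) (use Zb in auto)
  have i2: "integrable M (\<lambda>\<omega>. (?Z \<omega>)\<^sup>2)"
    by (rule integrable_bounded[where C = "(card I * D)\<^sup>2"])
       (use Zb in \<open>auto simp: abs_le_square_iff[symmetric]\<close>)
  have EZ: "expectation (Z i) = (\<Sum>j\<in>N i. expectation (\<lambda>\<omega>. Y i \<omega> * Y j \<omega>))" for i
    unfolding Z_def sum_distrib_left by (simp add: integrable_YY)
  have E: "expectation ?Z = s2"
    unfolding s2_eq
    by (rule Bochner_Integration.integral_sum) (rule integrable_bounded[where C = D], use Z_bound in auto)
  have "expectation (\<lambda>\<omega>. (?Z \<omega> - s2)\<^sup>2) = expectation (\<lambda>\<omega>. (?Z \<omega>)\<^sup>2) - s2\<^sup>2"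
    using variance_eq[OF i1 i2] E by simp
  also have "expectation (\<lambda>\<omega>. (?Z \<omega>)\<^sup>2) =
     expectation (\<lambda>\<omega>. \<Sum>i\<in>I. \<Sum>k\<in>I. \<Sum>j\<in>N i. \<Sum>l\<in>N k. (Y i \<omega> * Y j \<omega>) * (Y k \<omega> * Y l \<omega>))"
  proof -
    have "Z i \<omega> * Z k \<omega> = (\<Sum>j\<in>N i. \<Sum>l\<in>N k. (Y i \<omega> * Y j \<omega>) * (Y k \<omega> * Y l \<omega>))" for i k \<omega>
      unfolding Z_def sum_distrib_left[of "Y i \<omega>"] sum_distrib_left[of "Y k \<omega>"] sum_product ..
    then show ?thesis by (simp only: power2_eq_square sum_product)
  qed
  also have "\<dots> = (\<Sum>i\<in>I. \<Sum>k\<in>I. \<Sum>j\<in>N i. \<Sum>l\<in>N k. expectation (\<lambda>\<omega>. (Y i \<omega> * Y j \<omega>) * (Y k \<omega> * Y l \<omega>)))"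
    by (simp add: i4)
  also have "s2\<^sup>2 = (\<Sum>i\<in>I. \<Sum>k\<in>I. \<Sum>j\<in>N i. \<Sum>l\<in>N k. expectation (\<lambda>\<omega>. Y i \<omega> * Y j \<omega>) * expectation (\<lambda>\<omega>. Y k \<omega> * Y l \<omega>))"
    unfolding s2_eq EZ power2_eq_square sum_product ..
  also have "(\<Sum>i\<in>I. \<Sum>k\<in>I. \<Sum>j\<in>N i. \<Sum>l\<in>N k. expectation (\<lambda>\<omega>. (Y i \<omega> * Y j \<omega>) * (Y k \<omega> * Y l \<omega>))) - \<dots>
     = (\<Sum>i\<in>I. \<Sum>k\<in>I. \<Sum>j\<in>N i. \<Sum>l\<in>N k. product_cov i j k l)"
    unfolding product_cov_def sum_subtractf ..
  also have "\<dots> = (\<Sum>i\<in>I. \<Sum>j\<in>N i. \<Sum>k\<in>I. \<Sum>l\<in>N k. product_cov i j k l)"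
    by (intro sum.cong refl sum.swap)
  also have "\<dots> \<le> (\<Sum>i\<in>I. \<Sum>j\<in>N i. 8 * real D ^ 2)"
    by (intro sum_mono product_cov_sum_bound)
  also have "\<dots> = (\<Sum>i\<in>I. card (N i) * (8 * real D ^ 2))" by simp
  also have "\<dots> \<le> (\<Sum>i\<in>I. D * (8 * real D ^ 2))"
    by (intro sum_mono mult_right_mono) (use card_N in auto)
  also have "\<dots> = 8 * real (card I) * real D ^ 3" by (simp add: power3_eq_cube power2_eq_square)
  finally show ?thesis .
qed

text \<open>
  Removing the neighbourhood of \<open>i\<close> from the exponent leaves a factor that does not see \<open>Y i\<close>,
  so the zeroth-order term vanishes by \<open>far\<close>. The first-order term produces \<open>Z i\<close>, whose sum
  concentrates at \<open>s2\<close>; the second-order remainder is bounded term by term. This is Stein's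
  identity in the form used by Tikhomirov and Bolthausen.
\<close>

lemma char_derivative_error:
  "norm (\<i> * expectation (\<lambda>\<omega>. of_real (S \<omega>) * iexp (t * S \<omega>)) + of_real (s2 * t) * expectation (\<lambda>\<omega>. iexp (t * S \<omega>)))
   \<le> real (card I) * real D ^ 2 * t\<^sup>2 + \<bar>t\<bar> * sqrt (8 * real (card I) * real D ^ 3)"
proof -
  let ?W = "\<lambda>i \<omega>. \<Sum>j\<in>N i. Y j \<omega>"
  let ?C = "\<lambda>i \<omega>. \<Sum>j\<in>I - N i. Y j \<omega>"
  let ?Z = "\<lambda>\<omega>. \<Sum>i\<in>I. Z i \<omega>"
  \<comment> \<open>\<open>R i\<close> is what is left of \<open>Y i * iexp (t * S)\<close> without its far term and its linear term.\<close>
  define R where "R i \<omega> = of_real (Y i \<omega>) * (iexp (t * S \<omega>) * (1 - \<i> * of_real (t * ?W i \<omega>)) - iexp (t * ?C i \<omega>))" for i \<omega>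
  have S: "S \<omega> = ?W i \<omega> + ?C i \<omega>" if "i \<in> I" for i \<omega>
    unfolding S_def using that finite_I N_subset by (subst sum.subset_diff[of "N i"]) auto
  have Rb: "norm (R i \<omega>) \<le> t\<^sup>2 * (real D)\<^sup>2" if i: "i \<in> I" for i \<omega>
  proof -
    have "iexp (t * ?C i \<omega>) = iexp (t * S \<omega>) * iexp (- (t * ?W i \<omega>))"
      unfolding S[OF i] by (simp add: exp_add[symmetric] algebra_simps)
    then have "R i \<omega> = - of_real (Y i \<omega>) * iexp (t * S \<omega>) * (iexp (- (t * ?W i \<omega>)) - 1 - \<i> * of_real (- (t * ?W i \<omega>)))"
      unfolding R_def by (simp add: algebra_simps)
    then have "norm (R i \<omega>) = \<bar>Y i \<omega>\<bar> * norm (iexp (- (t * ?W i \<omega>)) - 1 - \<i> * of_real (- (t * ?W i \<omega>)))"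
      by (simp add: norm_mult del: of_real_mult of_real_minus of_real_sum)
    also have "\<dots> \<le> 1 * ((- (t * ?W i \<omega>))\<^sup>2 / 2)"
      by (intro mult_mono Y_bound norm_iexp_minus_linear) auto
    also have "\<dots> \<le> t\<^sup>2 * (?W i \<omega>)\<^sup>2" by (simp add: power_mult_distrib)
    also have "\<dots> \<le> t\<^sup>2 * (real D)\<^sup>2"
      using sum_Y_bound[where A = "N i" and \<omega> = \<omega>] card_N[OF i]
      by (intro mult_left_mono abs_le_square_iff[THEN iffD1]) auto
    finally show ?thesis .
  qed
  have R_meas [measurable]: "random_variable borel (R i)" for i unfolding R_def by measurable
  have intR: "integrable M (R i)" if "i \<in> I" for i
    by (rule integrable_bounded_complex[OF _ Rb[OF that]]) simp
  let ?E = "\<lambda>\<omega>. iexp (t * S \<omega>)"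
  have intfar: "integrable M (\<lambda>\<omega>. of_real (Y i \<omega>) * iexp (t * ?C i \<omega>))" for i
    by (rule integrable_bounded_complex[where C = 1]) (auto simp: norm_mult Y_bound simp del: of_real_sum)
  have intZE: "integrable M (\<lambda>\<omega>. of_real (?Z \<omega> - s2) * ?E \<omega>)"
  proof (rule integrable_bounded_complex[where C = "card I * D + \<bar>s2\<bar>"])
    fix \<omega>
    have "\<bar>?Z \<omega>\<bar> \<le> card I * D"
      using sum_norm_bound[of I "\<lambda>j. Z j \<omega>" D] Z_bound by auto
    then show "norm (of_real (?Z \<omega> - s2) * ?E \<omega>) \<le> card I * D + \<bar>s2\<bar>"
      by (simp add: norm_mult del: of_real_diff of_real_sum)
  qed simp
  have intE: "integrable M ?E" by (rule integrable_bounded_complex[where C = 1]) auto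
  have id: "\<i> * (of_real (S \<omega>) * ?E \<omega>) + of_real (s2 * t) * ?E \<omega> =
     \<i> * (\<Sum>i\<in>I. R i \<omega> + of_real (Y i \<omega>) * iexp (t * ?C i \<omega>)) - of_real t * (of_real (?Z \<omega> - s2) * ?E \<omega>)" for \<omega>
  proof -
    have "(\<Sum>i\<in>I. R i \<omega> + of_real (Y i \<omega>) * iexp (t * ?C i \<omega>)) = (\<Sum>i\<in>I. of_real (Y i \<omega>) * ?E \<omega> - \<i> * of_real t * ?E \<omega> * of_real (Z i \<omega>))"
      unfolding R_def Z_def by (intro sum.cong refl) (simp add: algebra_simps)
    also have "\<dots> = of_real (S \<omega>) * ?E \<omega> - \<i> * of_real t * ?E \<omega> * of_real (?Z \<omega>)"
      unfolding S_def of_real_sum sum_subtractf sum_distrib_left sum_distrib_right ..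
    finally have eq: "(\<Sum>i\<in>I. R i \<omega> + of_real (Y i \<omega>) * iexp (t * ?C i \<omega>)) = \<dots>" .
    have alg: "\<i> * (a * e) + of_real (s2 * t) * e = \<i> * (a * e - \<i> * of_real t * e * of_real z) - of_real t * (of_real (z - s2) * e)"
      for a e :: complex and z :: real
      by (simp add: algebra_simps)
    show ?thesis unfolding eq by (rule alg)
  qed
  have intSE: "integrable M (\<lambda>\<omega>. of_real (S \<omega>) * ?E \<omega>)"
    by (rule integrable_bounded_complex[where C = "card I"]) (auto simp: norm_mult S_bound)
  have "norm (expectation (\<lambda>\<omega>. of_real (?Z \<omega> - s2) * ?E \<omega>)) \<le> expectation (\<lambda>\<omega>. \<bar>?Z \<omega> - s2\<bar>)"
    using integral_norm_bound[of M "\<lambda>\<omega>. of_real (?Z \<omega> - s2) * ?E \<omega>"]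
    by (simp add: norm_mult del: of_real_diff of_real_sum)
  also have "\<dots> \<le> sqrt (expectation (\<lambda>\<omega>. (?Z \<omega> - s2)\<^sup>2))"
  proof (rule square_expectation_le[where C = "card I * D + \<bar>s2\<bar>"])
    fix \<omega>
    have "\<bar>?Z \<omega>\<bar> \<le> card I * D"
      using sum_norm_bound[of I "\<lambda>j. Z j \<omega>" D] Z_bound by auto
    then show "\<bar>?Z \<omega> - s2\<bar> \<le> card I * D + \<bar>s2\<bar>" by linarith
  qed simp
  also have "\<dots> \<le> sqrt (8 * real (card I) * real D ^ 3)"
    by (intro real_sqrt_le_mono variance_sum_Z)
  finally have ZE: "norm (expectation (\<lambda>\<omega>. of_real (?Z \<omega> - s2) * ?E \<omega>)) \<le> sqrt (8 * real (card I) * real D ^ 3)" .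
  have "\<i> * expectation (\<lambda>\<omega>. of_real (S \<omega>) * ?E \<omega>) + of_real (s2 * t) * expectation ?E
     = expectation (\<lambda>\<omega>. \<i> * (of_real (S \<omega>) * ?E \<omega>) + of_real (s2 * t) * ?E \<omega>)"
    using intSE intE by simp
  also have "\<dots> = \<i> * (\<Sum>i\<in>I. expectation (R i)) - of_real t * expectation (\<lambda>\<omega>. of_real (?Z \<omega> - s2) * ?E \<omega>)"
    unfolding id using intR intfar intZE far by (simp del: of_real_diff of_real_sum)
  also have "norm \<dots> \<le> norm (\<Sum>i\<in>I. expectation (R i)) + \<bar>t\<bar> * norm (expectation (\<lambda>\<omega>. of_real (?Z \<omega> - s2) * ?E \<omega>))"
    by (rule order_trans[OF norm_triangle_ineq4]) (simp add: norm_mult del: of_real_diff of_real_sum)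
  also have "norm (\<Sum>i\<in>I. expectation (R i)) \<le> (\<Sum>i\<in>I. t\<^sup>2 * (real D)\<^sup>2)"
  proof (rule order_trans[OF norm_sum], rule sum_mono)
    fix i assume i: "i \<in> I"
    have "norm (expectation (R i)) \<le> expectation (\<lambda>\<omega>. norm (R i \<omega>))" by (rule integral_norm_bound)
    also have "\<dots> \<le> t\<^sup>2 * (real D)\<^sup>2"
      by (rule integral_le_const) (use intR[OF i] Rb[OF i] in auto)
    finally show "norm (expectation (R i)) \<le> t\<^sup>2 * (real D)\<^sup>2" .
  qed
  also have "\<bar>t\<bar> * norm (expectation (\<lambda>\<omega>. of_real (?Z \<omega> - s2) * ?E \<omega>)) \<le> \<bar>t\<bar> * sqrt (8 * real (card I) * real D ^ 3)"
    by (rule mult_left_mono[OF ZE]) simp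
  finally show ?thesis by (simp add: mult_ac)
qed

theorem char_gaussian_bound:
  "norm (expectation (\<lambda>\<omega>. iexp (t * S \<omega>)) - of_real (exp (- s2 * t\<^sup>2 / 2)))
   \<le> \<bar>t\<bar> * (real (card I) * real D ^ 2 * t\<^sup>2 + \<bar>t\<bar> * sqrt (8 * real (card I) * real D ^ 3))"
proof (rule gaussian_ode_bound[where \<phi> = "\<lambda>t. expectation (\<lambda>\<omega>. iexp (t * S \<omega>))" and
    \<phi>' = "\<lambda>t. \<i> * expectation (\<lambda>\<omega>. of_real (S \<omega>) * iexp (t * S \<omega>))"])
  show "((\<lambda>t. expectation (\<lambda>\<omega>. iexp (t * S \<omega>))) has_vector_derivative
           \<i> * expectation (\<lambda>\<omega>. of_real (S \<omega>) * iexp (s * S \<omega>))) (at s)" for s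
    by (rule char_has_vector_derivative[OF S_measurable S_bound])
  show "0 \<le> s2" by (rule s2_nonneg)
next
  fix s :: real assume s: "\<bar>s\<bar> \<le> \<bar>t\<bar>"
  have "real (card I) * real D ^ 2 * s\<^sup>2 + \<bar>s\<bar> * sqrt (8 * real (card I) * real D ^ 3)
     \<le> real (card I) * real D ^ 2 * t\<^sup>2 + \<bar>t\<bar> * sqrt (8 * real (card I) * real D ^ 3)"
    using s by (intro add_mono mult_left_mono mult_right_mono abs_le_square_iff[THEN iffD1]) auto
  then show "norm (\<i> * expectation (\<lambda>\<omega>. of_real (S \<omega>) * iexp (s * S \<omega>)) + of_real (s2 * s) * expectation (\<lambda>\<omega>. iexp (s * S \<omega>)))
    \<le> real (card I) * real D ^ 2 * t\<^sup>2 + \<bar>t\<bar> * sqrt (8 * real (card I) * real D ^ 3)"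
    using char_derivative_error[of s] by linarith
qed (simp add: prob_space)

end

section \<open>Greedy selection in a conflict graph\<close>

primrec descends :: "('e \<Rightarrow> 'e set) \<Rightarrow> nat \<Rightarrow> 'e \<Rightarrow> ('e \<Rightarrow> real) \<Rightarrow> bool" where
  "descends N 0 e x = True"
| "descends N (Suc k) e x = (\<exists>f\<in>N e. x f < x e \<and> descends N k f x)"

text \<open>
  The greedy rule evaluated to depth \<open>k\<close>. The value \<open>True\<close> at depth 0 is arbitrary; it is
  consulted only if \<open>k\<close> successively earlier conflicting clocks can be followed from \<open>e\<close>.
\<close>

primrec accepted :: "('e \<Rightarrow> 'e set) \<Rightarrow> nat \<Rightarrow> 'e \<Rightarrow> ('e \<Rightarrow> real) \<Rightarrow> bool" where
  "accepted N 0 e x = True"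
| "accepted N (Suc k) e x = (\<forall>f\<in>N e. x f < x e \<longrightarrow> \<not> accepted N k f x)"

primrec reach :: "('e \<Rightarrow> 'e set) \<Rightarrow> nat \<Rightarrow> 'e \<Rightarrow> 'e set" where
  "reach N 0 e = {e}"
| "reach N (Suc k) e = insert e (\<Union>f\<in>N e. reach N k f)"

text \<open>
  A path is listed backwards, its starting point last. A descent along it is then an
  increasing list, and the smallest clock, which is the one integrated out first, is the head.
\<close>

primrec paths :: "('e \<Rightarrow> 'e set) \<Rightarrow> nat \<Rightarrow> 'e \<Rightarrow> 'e list set" where
  "paths N 0 e = {[e]}"
| "paths N (Suc k) e = (\<Union>f\<in>N e. (\<lambda>p. p @ [e]) ` paths N k f)"

definition greedy :: "('e \<Rightarrow> 'e set) \<Rightarrow> 'e set \<Rightarrow> ('e \<Rightarrow> real) \<Rightarrow> 'e set \<Rightarrow> bool" where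
  "greedy N E x A \<longleftrightarrow> (\<forall>e\<in>E. e \<in> A \<longleftrightarrow> (\<forall>f\<in>N e. x f < x e \<longrightarrow> f \<notin> A))"

definition greedy_set :: "('e \<Rightarrow> 'e set) \<Rightarrow> ('e \<Rightarrow> real) \<Rightarrow> 'e set" where
  "greedy_set N x = {e. \<exists>k. \<not> descends N k e x \<and> accepted N k e x}"

lemma not_descends_mono:
  assumes "\<not> descends N k e x" "k \<le> l"
  shows "\<not> descends N l e x"
proof -
  have "descends N (Suc k) e x \<Longrightarrow> descends N k e x" for k e
    by (induction k arbitrary: e) auto
  then have step: "\<not> descends N k e x \<Longrightarrow> \<not> descends N (Suc k) e x" for k
    by blast
  from assms(2,1) show ?thesis by (induction l rule: dec_induct) (use step in blast)+
qed

lemma accepted_eq_if_not_descends: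
  assumes "\<not> descends N k e x" "k \<le> l"
  shows "accepted N l e x = accepted N k e x"
  using assms
proof (induction k arbitrary: e l)
  case (Suc k)
  from Suc.prems(2) obtain l' where l: "l = Suc l'" "k \<le> l'" by (cases l) auto
  have "accepted N l' f x = accepted N k f x" if "f \<in> N e" "x f < x e" for f
    using Suc.IH[OF _ l(2), of f] Suc.prems(1) that by auto
  then show ?case unfolding l by auto
qed simp

text \<open>
  The fate of \<open>e\<close> is decided along decreasing chains of clocks. If all of them stop within
  \<open>k\<close> steps, the arbitrary value at depth 0 never enters, and every solution of the greedy
  rule, however far it extends, agrees with the finite computation.
\<close>

lemma greedy_iff_accepted:
  assumes A: "greedy N E x A" and N: "\<And>e. e \<in> E \<Longrightarrow> N e \<subseteq> E"
    and "e \<in> E" "\<not> descends N k e x"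
  shows "e \<in> A \<longleftrightarrow> accepted N k e x"
  using assms(3,4)
proof (induction k arbitrary: e)
  case (Suc k)
  have "f \<in> A \<longleftrightarrow> accepted N k f x" if "f \<in> N e" "x f < x e" for f
    using Suc.IH[of f] Suc.prems that N by auto
  with A Suc.prems(1) show ?case unfolding greedy_def by auto
qed simp

lemma greedy_set_iff:
  assumes "\<not> descends N k e x"
  shows "e \<in> greedy_set N x \<longleftrightarrow> accepted N k e x"
proof -
  have "accepted N l e x \<longleftrightarrow> accepted N k e x" if "\<not> descends N l e x" for l
    using accepted_eq_if_not_descends[OF assms max.cobounded1] accepted_eq_if_not_descends[OF that max.cobounded2]
    by blast
  with assms show ?thesis unfolding greedy_set_def by blast
qed

lemma greedy_greedy_set:
  assumes "\<And>e. e \<in> E \<Longrightarrow> \<exists>k. \<not> descends N k e x"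
  shows "greedy N E x (greedy_set N x)"
  unfolding greedy_def
proof
  fix e assume "e \<in> E"
  then obtain k where "\<not> descends N k e x" using assms by blast
  then have k: "\<not> descends N (Suc k) e x" by (rule not_descends_mono) simp
  have "f \<in> greedy_set N x \<longleftrightarrow> accepted N k f x" if "f \<in> N e" "x f < x e" for f
    by (rule greedy_set_iff) (use k that in auto)
  then show "e \<in> greedy_set N x \<longleftrightarrow> (\<forall>f\<in>N e. x f < x e \<longrightarrow> f \<notin> greedy_set N x)"
    unfolding greedy_set_iff[OF k] by auto
qed

lemma greedy_unique:
  assumes "greedy N E x A" "\<And>e. e \<in> E \<Longrightarrow> N e \<subseteq> E" "\<And>e. e \<in> E \<Longrightarrow> \<exists>k. \<not> descends N k e x" "e \<in> E"
  shows "e \<in> A \<longleftrightarrow> e \<in> greedy_set N x"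
proof -
  obtain k where "\<not> descends N k e x" using assms by blast
  with greedy_iff_accepted[OF assms(1,2,4) this] greedy_set_iff[OF this] show ?thesis by simp
qed

lemma accepted_local:
  assumes "\<And>f. f \<in> reach N k e \<Longrightarrow> x f = y f"
  shows "accepted N k e x = accepted N k e y"
  using assms
proof (induction k arbitrary: e)
  case (Suc k)
  have "accepted N k f x = accepted N k f y" if "f \<in> N e" for f
    using Suc.IH[of f] Suc.prems that by auto
  moreover have "x f = y f" if "f \<in> N e" for f
    using Suc.prems[of f] that by (cases k) auto
  moreover have "x e = y e" using Suc.prems by simp
  ultimately show ?case by simp
qed simp

lemma rules_cong:
  assumes N: "\<And>e. e \<in> E \<Longrightarrow> N e \<subseteq> E" and xy: "\<forall>e\<in>E. x e = y e" and "e \<in> E"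
  shows "accepted N k e x = accepted N k e y \<and> descends N k e x = descends N k e y"
  using assms(3)
proof (induction k arbitrary: e)
  case (Suc k)
  have "accepted N k f x = accepted N k f y \<and> descends N k f x = descends N k f y \<and> x f = y f" if "f \<in> N e" for f
    using Suc.IH[of f] that N[OF Suc.prems] xy by auto
  with xy Suc.prems show ?case by auto
qed simp

lemma accepted_equivariant:
  assumes "\<And>e. N (\<pi> e) = \<pi> ` N e"
  shows "accepted N k e (x \<circ> \<pi>) = accepted N k (\<pi> e) x"
  by (induction k arbitrary: e) (auto simp: assms)

lemma descends_equivariant:
  assumes "\<And>e. N (\<pi> e) = \<pi> ` N e"
  shows "descends N k e (x \<circ> \<pi>) = descends N k (\<pi> e) x"
  by (induction k arbitrary: e) (auto simp: assms)

lemma finite_paths: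
  assumes "\<And>e. e \<in> E \<Longrightarrow> N e \<subseteq> E \<and> finite (N e) \<and> card (N e) \<le> D" "e \<in> E"
  shows "finite (paths N k e) \<and> card (paths N k e) \<le> D ^ k"
  using assms(2)
proof (induction k arbitrary: e)
  case (Suc k)
  have N: "N e \<subseteq> E" "finite (N e)" "card (N e) \<le> D" using assms(1)[OF Suc.prems] by auto
  have IH: "finite (paths N k f)" "card (paths N k f) \<le> D ^ k" if "f \<in> N e" for f
    using Suc.IH[of f] N(1) that by auto
  have "card (paths N (Suc k) e) \<le> (\<Sum>f\<in>N e. card ((\<lambda>p. p @ [e]) ` paths N k f))"
    unfolding paths.simps by (rule card_UN_le[OF N(2)])
  also have "\<dots> \<le> (\<Sum>f\<in>N e. D ^ k)"
    by (intro sum_mono order_trans[OF card_image_le] IH)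
  also have "\<dots> \<le> D ^ Suc k" using N(3) by simp
  finally show ?case using N(2) IH(1) by simp
qed simp

lemma paths_set:
  assumes "\<And>e. e \<in> E \<Longrightarrow> N e \<subseteq> E" "e \<in> E" "p \<in> paths N k e"
  shows "set p \<subseteq> E \<and> length p = Suc k"
  using assms(2,3)
proof (induction k arbitrary: e p)
  case (Suc k)
  then obtain f q where "f \<in> N e" "q \<in> paths N k f" "p = q @ [e]" by auto
  with Suc.IH[of f q] assms(1)[OF Suc.prems(1)] Suc.prems show ?case by auto
qed simp

lemma descends_path:
  assumes "descends N k e x"
  shows "\<exists>p\<in>paths N k e. sorted_wrt (\<lambda>f g. x f < x g) p \<and> (\<forall>f\<in>set p. x f \<le> x e)"
  using assms
proof (induction k arbitrary: e)
  case (Suc k)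
  then obtain f where f: "f \<in> N e" "x f < x e" "descends N k f x" by auto
  from Suc.IH[OF f(3)] obtain p where "p \<in> paths N k f" "sorted_wrt (\<lambda>f g. x f < x g) p" "\<forall>g\<in>set p. x g \<le> x f"
    by blast
  with f show ?case by (intro bexI[of _ "p @ [e]"]) (force simp: sorted_wrt_append)+
qed simp

abbreviation U01 :: "real measure" where "U01 \<equiv> uniform_measure lborel {0..1}"

abbreviation iidU :: "'e set \<Rightarrow> ('e \<Rightarrow> real) measure" where "iidU E \<equiv> PiM E (\<lambda>_. U01)"

lemma prob_space_U01: "prob_space U01"
  by (rule prob_space_uniform_measure) auto

lemma prob_space_iidU: "prob_space (iidU E)"
  by (rule prob_space_PiM) (rule prob_space_U01)

lemma U01_AE: "AE y in U01. 0 \<le> y \<and> y \<le> 1"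
  by (rule AE_uniform_measureI) auto

lemma measurable_iidU_component:
  "e \<in> E \<Longrightarrow> (\<lambda>x. x e) \<in> borel_measurable (iidU E)"
  using measurable_component_singleton[of e E "\<lambda>_. U01"] by simp

lemma accepted_measurable [measurable]:
  assumes N: "\<And>e. e \<in> E \<Longrightarrow> N e \<subseteq> E \<and> finite (N e)" and "e \<in> E"
  shows "Measurable.pred (iidU E) (accepted N k e)"
  using assms(2)
proof (induction k arbitrary: e)
  case 0
  have "accepted N 0 e = (\<lambda>_. True)" by (rule ext) simp
  then show ?case by simp
next
  case (Suc k)
  have [measurable]: "(\<lambda>x. x e) \<in> borel_measurable (iidU E)" using Suc.prems by (simp add: measurable_iidU_component)
  have "Measurable.pred (iidU E) (\<lambda>x. \<forall>f\<in>N e. x f < x e \<longrightarrow> \<not> accepted N k f x)"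
  proof (rule pred_intros_finite(3))
    fix f assume "f \<in> N e"
    then have "f \<in> E" using N Suc.prems by auto
    then have [measurable]: "(\<lambda>x. x f) \<in> borel_measurable (iidU E)" "Measurable.pred (iidU E) (accepted N k f)"
      using Suc.IH by (simp_all add: measurable_iidU_component)
    show "Measurable.pred (iidU E) (\<lambda>x. x f < x e \<longrightarrow> \<not> accepted N k f x)" by measurable
  qed (use N Suc.prems in simp)
  then show ?case by simp
qed

lemma descends_measurable [measurable]:
  assumes N: "\<And>e. e \<in> E \<Longrightarrow> N e \<subseteq> E \<and> finite (N e)" and "e \<in> E"
  shows "Measurable.pred (iidU E) (descends N k e)"
  using assms(2)
proof (induction k arbitrary: e)
  case 0
  have "descends N 0 e = (\<lambda>_. True)" by (rule ext) simp
  then show ?case by simp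
next
  case (Suc k)
  have [measurable]: "(\<lambda>x. x e) \<in> borel_measurable (iidU E)" using Suc.prems by (simp add: measurable_iidU_component)
  have "Measurable.pred (iidU E) (\<lambda>x. \<exists>f\<in>N e. x f < x e \<and> descends N k f x)"
  proof (rule pred_intros_finite(4))
    fix f assume "f \<in> N e"
    then have "f \<in> E" using N Suc.prems by auto
    then have [measurable]: "(\<lambda>x. x f) \<in> borel_measurable (iidU E)" "Measurable.pred (iidU E) (descends N k f)"
      using Suc.IH by (simp_all add: measurable_iidU_component)
    show "Measurable.pred (iidU E) (\<lambda>x. x f < x e \<and> descends N k f x)" by measurable
  qed (use N Suc.prems in simp)
  then show ?case by simp
qed

lemma iidU_split:
  assumes "f \<in> E" and F: "F \<in> borel_measurable (iidU E)"
  shows "(\<integral>\<^sup>+x. F x \<partial>iidU E) = (\<integral>\<^sup>+x. \<integral>\<^sup>+y. F (x(f := y)) \<partial>U01 \<partial>iidU (E - {f}))"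
proof -
  interpret U: prob_space U01 by (rule prob_space_U01)
  interpret J: prob_space "iidU (E - {f})" by (rule prob_space_iidU)
  interpret pair_sigma_finite U01 "iidU (E - {f})" ..
  have ins: "insert f (E - {f}) = E" using assms by auto
  have m: "(\<lambda>(y, x). x(f := y)) \<in> measurable (U01 \<Otimes>\<^sub>M iidU (E - {f})) (iidU E)"
    using measurable_fun_upd[of E "E - {f}" f "\<lambda>p. snd p" "U01 \<Otimes>\<^sub>M iidU (E - {f})" "\<lambda>_. U01" "\<lambda>p. fst p"] ins
    by (simp add: case_prod_beta')
  have "iidU E = distr (U01 \<Otimes>\<^sub>M iidU (E - {f})) (iidU E) (\<lambda>(y, x). x(f := y))"
    using distr_pair_PiM_eq_PiM[of "E - {f}" "\<lambda>_. U01" f] prob_space_U01 ins by simp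
  then have "(\<integral>\<^sup>+x. F x \<partial>iidU E) = (\<integral>\<^sup>+x. F x \<partial>distr (U01 \<Otimes>\<^sub>M iidU (E - {f})) (iidU E) (\<lambda>(y, x). x(f := y)))"
    by simp
  also have "\<dots> = (\<integral>\<^sup>+p. F ((snd p)(f := fst p)) \<partial>(U01 \<Otimes>\<^sub>M iidU (E - {f})))"
    by (subst nn_integral_distr[OF m]) (simp_all add: case_prod_beta' F)
  also have "\<dots> = (\<integral>\<^sup>+x. \<integral>\<^sup>+y. F (x(f := y)) \<partial>U01 \<partial>iidU (E - {f}))"
    using measurable_compose[OF m F]
    by (subst nn_integral_snd[symmetric]) (simp_all add: case_prod_beta')
  finally show ?thesis .
qed

text \<open>
  The exponential weight reproduces itself: integrating over a clock that must ring before
  \<open>c\<close> gives back the weight at \<open>c\<close>, at the price of a factor \<open>1 / L\<close>.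
\<close>

lemma exp_integral_below:
  assumes "0 < L"
  shows "(\<integral>\<^sup>+y. indicator {..<c} y * ennreal (exp (L * y)) \<partial>U01) \<le> ennreal (exp (L * c) / L)"
proof (cases "0 \<le> c")
  case True
  have "(\<integral>\<^sup>+y. indicator {..<c} y * ennreal (exp (L * y)) \<partial>U01)
     = (\<integral>\<^sup>+y. (indicator {..<c} y * ennreal (exp (L * y))) * indicator {0..1} y \<partial>lborel)"
    by (subst nn_integral_uniform_measure) (auto simp: divide_ennreal_def)
  also have "\<dots> \<le> (\<integral>\<^sup>+y. ennreal (exp (L * y)) * indicator {0..c} y \<partial>lborel)"
    by (intro nn_integral_mono) (auto simp: indicator_def)
  also have "\<dots> = ennreal (exp (L * c) / L - exp (L * 0) / L)"
    using assms True
    by (intro nn_integral_FTC_Icc) (auto intro!: derivative_eq_intros)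
  also have "\<dots> \<le> ennreal (exp (L * c) / L)" using assms by (intro ennreal_leI) simp
  finally show ?thesis .
next
  case False
  have "(\<integral>\<^sup>+y. indicator {..<c} y * ennreal (exp (L * y)) \<partial>U01) = (\<integral>\<^sup>+y. 0 \<partial>U01)"
    by (rule nn_integral_cong_AE) (use U01_AE False in \<open>auto simp: indicator_def elim!: eventually_mono\<close>)
  then show ?thesis by simp
qed

lemma sorted_path_measurable:
  "set p \<subseteq> E \<Longrightarrow> Measurable.pred (iidU E) (\<lambda>x. sorted_wrt (\<lambda>f g. x f < x g) p)"
proof (induction p)
  case (Cons f p)
  have [measurable]: "(\<lambda>x. x f) \<in> borel_measurable (iidU E)" using Cons.prems by (simp add: measurable_iidU_component)
  have [measurable]: "Measurable.pred (iidU E) (\<lambda>x. sorted_wrt (\<lambda>f g. x f < x g) p)" using Cons by simp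
  have "Measurable.pred (iidU E) (\<lambda>x. (\<forall>g\<in>set p. x f < x g))"
  proof (rule pred_intros_finite(3))
    fix g assume "g \<in> set p"
    then have [measurable]: "(\<lambda>x. x g) \<in> borel_measurable (iidU E)" using Cons.prems by (auto simp: measurable_iidU_component)
    show "Measurable.pred (iidU E) (\<lambda>x. x f < x g)" by measurable
  qed simp
  then show ?case by simp
qed simp

text \<open>
  Each clock is integrated out in turn, starting with the smallest. Since \<open>L\<close> is free, the
  resulting decay \<open>1 / L ^ k\<close> beats the growth of the number of paths in any graph of bounded
  degree.
\<close>

lemma sorted_path_weight:
  assumes L: "0 < L" and "distinct p" "p \<noteq> []" "set p \<subseteq> E"
  shows "(\<integral>\<^sup>+x. of_bool (sorted_wrt (\<lambda>f g. x f < x g) p) * ennreal (exp (L * x (hd p))) \<partial>iidU E)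
     \<le> ennreal (exp L / L ^ (length p - 1))"
  using assms(2-)
proof (induction p)
  case (Cons f p)
  let ?s = "\<lambda>p x. sorted_wrt (\<lambda>f g. x f < x g) p"
  have fE: "f \<in> E" using Cons.prems by simp
  note [measurable] = measurable_iidU_component[OF fE]
  show ?case
  proof (cases "p = []")
    case True
    interpret prob_space "iidU E" by (rule prob_space_iidU)
    have "AE x in iidU E. x f \<le> 1"
      by (rule AE_PiM_component[OF prob_space_U01 fE]) (use U01_AE in \<open>auto elim: eventually_mono\<close>)
    then have "(\<integral>\<^sup>+x. ennreal (exp (L * x f)) \<partial>iidU E) \<le> (\<integral>\<^sup>+x. ennreal (exp L) \<partial>iidU E)"
      by (intro nn_integral_mono_AE) (use L in \<open>auto intro!: ennreal_leI elim!: eventually_mono\<close>)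
    then show ?thesis using True by (simp add: emeasure_space_1)
  next
    case False
    have sub: "set (f # p) \<subseteq> E" "set p \<subseteq> E" "set p \<subseteq> E - {f}" and h: "hd p \<in> E" "hd p \<noteq> f"
      using Cons.prems False hd_in_set[OF False] by auto
    note [measurable] = measurable_iidU_component[OF h(1)] sorted_path_measurable[OF sub(1)]
      sorted_path_measurable[OF sub(2)]
    have agree: "?s p (x(f := y)) = ?s p x" for x :: "'a \<Rightarrow> real" and y
      using sub(3) by (auto elim!: sorted_wrt_mono_rel[rotated] simp: subset_eq)
    have split: "?s (f # p) x \<longleftrightarrow> x f < x (hd p) \<and> ?s p x" for x :: "'a \<Rightarrow> real"
      using False by (cases p) auto
    have eq: "of_bool ((x(f := y)) f < (x(f := y)) (hd p) \<and> ?s p (x(f := y))) * ennreal (exp (L * (x(f := y)) f))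
        = of_bool (?s p x) * (indicator {..<x (hd p)} y * ennreal (exp (L * y)))" for x :: "'a \<Rightarrow> real" and y
      unfolding agree by (simp add: h indicator_def)
    have "(\<integral>\<^sup>+x. of_bool (?s (f # p) x) * ennreal (exp (L * x (hd (f # p)))) \<partial>iidU E)
       = (\<integral>\<^sup>+x. of_bool (x f < x (hd p) \<and> ?s p x) * ennreal (exp (L * x f)) \<partial>iidU E)"
      unfolding split by simp
    also have "\<dots> = (\<integral>\<^sup>+x. \<integral>\<^sup>+y. of_bool ((x(f := y)) f < (x(f := y)) (hd p) \<and> ?s p (x(f := y))) * ennreal (exp (L * (x(f := y)) f)) \<partial>U01 \<partial>iidU (E - {f}))"
      by (rule iidU_split[OF fE]) measurable
    also have "\<dots> = (\<integral>\<^sup>+x. \<integral>\<^sup>+y. of_bool (?s p x) * (indicator {..<x (hd p)} y * ennreal (exp (L * y))) \<partial>U01 \<partial>iidU (E - {f}))"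
      unfolding eq ..
    also have "\<dots> = (\<integral>\<^sup>+x. of_bool (?s p x) * (\<integral>\<^sup>+y. (indicator {..<x (hd p)} y * ennreal (exp (L * y))) \<partial>U01) \<partial>iidU (E - {f}))"
      by (intro nn_integral_cong) (simp add: of_bool_def)
    also have "\<dots> \<le> (\<integral>\<^sup>+x. of_bool (?s p x) * ennreal (exp (L * x (hd p)) / L) \<partial>iidU (E - {f}))"
      by (intro nn_integral_mono mult_left_mono exp_integral_below L) simp
    also have "\<dots> = (\<integral>\<^sup>+x. \<integral>\<^sup>+y. of_bool (?s p (x(f := y))) * ennreal (exp (L * (x(f := y)) (hd p)) / L) \<partial>U01 \<partial>iidU (E - {f}))"
    proof -
      have "of_bool (?s p (x(f := y))) * ennreal (exp (L * (x(f := y)) (hd p)) / L)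
          = of_bool (?s p x) * ennreal (exp (L * x (hd p)) / L)" for x :: "'a \<Rightarrow> real" and y
        unfolding agree using h by simp
      then show ?thesis
        using prob_space.emeasure_space_1[OF prob_space_U01] by (simp only: nn_integral_const mult_1_right)
    qed
    also have "\<dots> = (\<integral>\<^sup>+x. of_bool (?s p x) * ennreal (exp (L * x (hd p)) / L) \<partial>iidU E)"
      by (rule iidU_split[OF fE, symmetric]) measurable
    also have "\<dots> = (\<integral>\<^sup>+x. ennreal (1 / L) * (of_bool (?s p x) * ennreal (exp (L * x (hd p)))) \<partial>iidU E)"
      using L by (intro nn_integral_cong) (auto simp: ennreal_mult'[symmetric])
    also have "\<dots> = ennreal (1 / L) * (\<integral>\<^sup>+x. of_bool (?s p x) * ennreal (exp (L * x (hd p))) \<partial>iidU E)"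
      by (rule nn_integral_cmult) measurable
    also have "\<dots> \<le> ennreal (1 / L) * ennreal (exp L / L ^ (length p - 1))"
      using Cons False by (intro mult_left_mono) auto
    also have "\<dots> = ennreal (exp L / L ^ (length (f # p) - 1))"
      using L False by (cases p) (auto simp: ennreal_mult'[symmetric])
    finally show ?thesis .
  qed
qed simp

lemma sorted_path_prob:
  assumes L: "0 < L" and "p \<noteq> []" "set p \<subseteq> E"
  shows "measure (iidU E) {x \<in> space (iidU E). sorted_wrt (\<lambda>f g. x f < x g) p} \<le> exp L / L ^ (length p - 1)"
proof (cases "distinct p")
  case True
  interpret prob_space "iidU E" by (rule prob_space_iidU)
  note [measurable] = sorted_path_measurable[OF assms(3)]
  have h: "hd p \<in> E" using assms by auto
  note [measurable] = measurable_iidU_component[OF h]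
  have AE: "AE x in iidU E. 0 \<le> x (hd p)"
    by (rule AE_PiM_component[OF prob_space_U01 h]) (use U01_AE in \<open>auto elim: eventually_mono\<close>)
  have "emeasure (iidU E) {x \<in> space (iidU E). sorted_wrt (\<lambda>f g. x f < x g) p}
     = (\<integral>\<^sup>+x. of_bool (sorted_wrt (\<lambda>f g. x f < x g) p) \<partial>iidU E)"
  proof -
    have "{x \<in> space (iidU E). sorted_wrt (\<lambda>f g. x f < x g) p} \<in> sets (iidU E)"
      using sorted_path_measurable[OF assms(3)] by simp
    from nn_integral_indicator[OF this, symmetric] show ?thesis
      by (auto intro!: nn_integral_cong simp: indicator_def)
  qed
  also have "\<dots> \<le> (\<integral>\<^sup>+x. of_bool (sorted_wrt (\<lambda>f g. x f < x g) p) * ennreal (exp (L * x (hd p))) \<partial>iidU E)"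
    using AE L by (intro nn_integral_mono_AE) (auto elim!: eventually_mono)
  also have "\<dots> \<le> ennreal (exp L / L ^ (length p - 1))"
    by (rule sorted_path_weight[OF L True assms(2,3)])
  finally show ?thesis using L by (simp add: emeasure_eq_measure)
next
  case False
  have "\<not> sorted_wrt (\<lambda>f g. x f < x g) p" for x :: "'a \<Rightarrow> real"
  proof
    assume "sorted_wrt (\<lambda>f g. x f < x g) p"
    then have "sorted_wrt (<) (map x p)" by (simp add: sorted_wrt_map)
    then have "distinct (map x p)" using strict_sorted_iff by blast
    with False show False by (simp add: distinct_map)
  qed
  then show ?thesis using L by simp
qed

lemma descends_prob:
  assumes N: "\<And>e. e \<in> E \<Longrightarrow> N e \<subseteq> E \<and> finite (N e) \<and> card (N e) \<le> D" and e: "e \<in> E" and L: "0 < L"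
  shows "measure (iidU E) {x \<in> space (iidU E). descends N k e x} \<le> exp L * (D / L) ^ k"
proof -
  interpret prob_space "iidU E" by (rule prob_space_iidU)
  let ?A = "\<lambda>p. {x \<in> space (iidU E). sorted_wrt (\<lambda>f g. x f < x g) p}"
  have p: "set p \<subseteq> E" "length p = Suc k" if "p \<in> paths N k e" for p
    using paths_set[of E N e p k] N e that by auto
  have fin: "finite (paths N k e)" "card (paths N k e) \<le> D ^ k"
    using finite_paths[of E N D e k] N e by auto
  have ev: "?A p \<in> events" if "p \<in> paths N k e" for p
    using sorted_path_measurable[OF p(1)[OF that]] by simp
  have "prob {x \<in> space (iidU E). descends N k e x} \<le> prob (\<Union>p\<in>paths N k e. ?A p)"
    using descends_path[of N k e] ev fin by (intro finite_measure_mono) blast+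
  also have "\<dots> \<le> (\<Sum>p\<in>paths N k e. prob (?A p))"
    using ev fin by (intro measure_UNION_le) auto
  also have "\<dots> \<le> (\<Sum>p\<in>paths N k e. exp L / L ^ k)"
  proof (rule sum_mono)
    fix q assume q: "q \<in> paths N k e"
    have "q \<noteq> []" using p(2)[OF q] by auto
    from sorted_path_prob[OF L this p(1)[OF q]] p(2)[OF q]
    show "prob (?A q) \<le> exp L / L ^ k" by simp
  qed
  also have "\<dots> = card (paths N k e) * (exp L / L ^ k)" by simp
  also have "\<dots> \<le> real (D ^ k) * (exp L / L ^ k)"
    using fin(2) L by (intro mult_right_mono) (auto simp del: of_nat_power)
  finally show ?thesis by (simp add: power_divide mult.commute)
qed

section \<open>Functions of independent clocks\<close>

definition depends_on :: "'e set \<Rightarrow> (('e \<Rightarrow> real) \<Rightarrow> 'b) \<Rightarrow> bool" where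
  "depends_on J F \<longleftrightarrow> (\<forall>x y. (\<forall>e\<in>J. x e = y e) \<longrightarrow> F x = F y)"

lemma depends_onD: "depends_on J F \<Longrightarrow> (\<And>e. e \<in> J \<Longrightarrow> x e = y e) \<Longrightarrow> F x = F y"
  unfolding depends_on_def by blast

lemma depends_on_mono: "depends_on J F \<Longrightarrow> J \<subseteq> K \<Longrightarrow> depends_on K F"
  unfolding depends_on_def by blast

lemma depends_on_compose: "depends_on J F \<Longrightarrow> depends_on J (\<lambda>x. h (F x))"
  unfolding depends_on_def by metis

lemma depends_on_compose2: "depends_on J F \<Longrightarrow> depends_on J G \<Longrightarrow> depends_on J (\<lambda>x. h (F x) (G x))"
  unfolding depends_on_def by metis

lemma depends_on_sum: "(\<And>i. i \<in> A \<Longrightarrow> depends_on J (F i)) \<Longrightarrow> depends_on J (\<lambda>x. \<Sum>i\<in>A. F i x)"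
  unfolding depends_on_def by (auto intro!: sum.cong)

lemma indep_coordinates:
  assumes "E \<noteq> {}"
  shows "prob_space.indep_vars (iidU E) (\<lambda>_. U01) (\<lambda>e x. x e) E"
proof -
  interpret prob_space "iidU E" by (rule prob_space_iidU)
  have 1: "distr (iidU E) (iidU E) (\<lambda>x. \<lambda>i\<in>E. x i) = iidU E"
  proof (rule distr_id2[THEN trans[rotated]])
    show "distr (iidU E) (iidU E) (\<lambda>x. \<lambda>i\<in>E. x i) = distr (iidU E) (iidU E) (\<lambda>x. x)"
      by (intro distr_cong) (auto simp: space_PiM)
  qed simp_all
  have 2: "(PiM E (\<lambda>i. distr (iidU E) U01 (\<lambda>x. x i))) = iidU E"
    by (intro PiM_cong refl distr_PiM_component) (auto intro: prob_space_U01)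
  show ?thesis
    by (subst indep_vars_iff_distr_eq_PiM'[OF assms]) (rule measurable_component_singleton, assumption, simp only: 1 2)
qed

lemma extend_measurable:
  assumes "J \<subseteq> E"
  shows "(\<lambda>z. \<lambda>e\<in>E. if e \<in> J then z e else 0) \<in> measurable (iidU J) (iidU E)"
proof (rule measurable_restrict)
  fix e assume "e \<in> E"
  show "(\<lambda>z. if e \<in> J then z e else 0) \<in> measurable (iidU J) U01"
    using measurable_component_singleton[of e J "\<lambda>_. U01"] by (cases "e \<in> J") simp_all
qed

lemma indep_expectation:
  fixes F G :: "('e \<Rightarrow> real) \<Rightarrow> 'b :: {real_normed_field, banach, second_countable_topology}"
  assumes E: "E \<noteq> {}" and JK: "J \<inter> K = {}" "J \<subseteq> E" "K \<subseteq> E"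
    and F: "integrable (iidU E) F" "depends_on J F" and G: "integrable (iidU E) G" "depends_on K G"
  shows "(\<integral>x. F x * G x \<partial>iidU E) = (\<integral>x. F x \<partial>iidU E) * (\<integral>x. G x \<partial>iidU E)"
proof -
  interpret prob_space "iidU E" by (rule prob_space_iidU)
  \<comment> \<open>Clocks outside \<open>J\<close> are set to 0, which makes \<open>F\<close> a function on the product over \<open>J\<close> alone.\<close>
  define ext where "ext J z = (\<lambda>e\<in>E. if e \<in> J then z e else (0::real))" for J :: "'e set" and z
  have mF: "(\<lambda>z. F (ext J z)) \<in> borel_measurable (iidU J)"
    unfolding ext_def
    by (rule measurable_compose[OF extend_measurable[OF JK(2)] borel_measurable_integrable[OF F(1)]])
  have mG: "(\<lambda>z. G (ext K z)) \<in> borel_measurable (iidU K)"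
    unfolding ext_def
    by (rule measurable_compose[OF extend_measurable[OF JK(3)] borel_measurable_integrable[OF G(1)]])
  have "indep_var borel ((\<lambda>z. F (ext J z)) \<circ> (\<lambda>x. restrict (\<lambda>i. x i) J)) borel ((\<lambda>z. G (ext K z)) \<circ> (\<lambda>x. restrict (\<lambda>i. x i) K))"
    by (rule indep_var_compose[OF indep_var_restrict[OF indep_coordinates[OF E] JK] mF mG])
  moreover have "(\<lambda>z. F (ext J z)) \<circ> (\<lambda>x. restrict (\<lambda>i. x i) J) = F"
    using JK(2) by (auto simp: fun_eq_iff ext_def intro!: depends_onD[OF F(2)])
  moreover have "(\<lambda>z. G (ext K z)) \<circ> (\<lambda>x. restrict (\<lambda>i. x i) K) = G"
    using JK(3) by (auto simp: fun_eq_iff ext_def intro!: depends_onD[OF G(2)])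
  ultimately have "indep_var borel F borel G" by simp
  from indep_var_lebesgue_integral[OF this F(1) G(1)] show ?thesis .
qed

lemma reindex_distr:
  assumes "bij_betw \<pi> E E"
  shows "distr (iidU E) (iidU E) (\<lambda>x. \<lambda>e\<in>E. x (\<pi> e)) = iidU E"
  using distr_PiM_reindex[of E "\<lambda>_. U01" \<pi> E] assms prob_space_U01
  by (auto simp: bij_betw_def)

lemma reindex_measurable:
  assumes "bij_betw \<pi> E E"
  shows "(\<lambda>x. \<lambda>e\<in>E. x (\<pi> e)) \<in> measurable (iidU E) (iidU E)"
  using assms by (intro measurable_restrict measurable_component_singleton) (auto simp: bij_betw_def)

lemma reindex_integral:
  fixes F :: "('e \<Rightarrow> real) \<Rightarrow> 'b :: {banach, second_countable_topology}"
  assumes \<pi>: "bij_betw \<pi> E E" and F: "F \<in> borel_measurable (iidU E)" "depends_on E F"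
  shows "(\<lambda>x. F (x \<circ> \<pi>)) \<in> borel_measurable (iidU E)" (is ?m)
    and "(\<integral>x. F (x \<circ> \<pi>) \<partial>iidU E) = (\<integral>x. F x \<partial>iidU E)" (is ?i)
proof -
  have eq: "F (x \<circ> \<pi>) = F (\<lambda>e\<in>E. x (\<pi> e))" for x
    by (rule depends_onD[OF F(2)]) simp
  show ?m unfolding eq by (rule measurable_compose[OF reindex_measurable[OF \<pi>] F(1)])
  have "(\<integral>x. F x \<partial>iidU E) = (\<integral>x. F x \<partial>distr (iidU E) (iidU E) (\<lambda>x. \<lambda>e\<in>E. x (\<pi> e)))"
    unfolding reindex_distr[OF \<pi>] ..
  also have "\<dots> = (\<integral>x. F (x \<circ> \<pi>) \<partial>iidU E)"
    unfolding eq by (rule integral_distr[OF reindex_measurable[OF \<pi>] F(1)])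
  finally show ?i ..
qed

lemma cylinder_prob:
  assumes "J \<subseteq> E" "finite J" "\<And>e. e \<in> J \<Longrightarrow> 0 \<le> a e \<and> a e < b e \<and> b e \<le> 1"
  shows "{x \<in> space (iidU E). \<forall>e\<in>J. x e \<in> {a e<..<b e}} \<in> sets (iidU E)" (is "?A \<in> _")
    and "0 < measure (iidU E) {x \<in> space (iidU E). \<forall>e\<in>J. x e \<in> {a e<..<b e}}"
proof -
  interpret product_prob_space "\<lambda>_. U01" E
    by (intro product_prob_spaceI prob_space_U01)
  have A: "?A = prod_emb E (\<lambda>_. U01) J (Pi\<^sub>E J (\<lambda>e. {a e<..<b e}))"
    using assms(1) by (auto simp: prod_emb_def space_PiM PiE_iff extensional_def)
  show "?A \<in> sets (iidU E)"
    unfolding A using assms by (intro sets_PiM_I) auto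
  have "measure (iidU E) ?A = (\<Prod>e\<in>J. measure U01 {a e<..<b e})"
    unfolding A using assms by (intro measure_PiM_emb) auto
  also have "\<dots> > 0"
  proof (rule prod_pos)
    fix e assume e: "e \<in> J"
    then have "{0..1} \<inter> {a e<..<b e} = {a e<..<b e}" using assms(3)[OF e] by auto
    then show "0 < measure U01 {a e<..<b e}"
      using assms(3)[OF e] by (subst measure_uniform_measure) auto
  qed
  finally show "0 < measure (iidU E) ?A" .
qed

section \<open>The lattice and its edges\<close>

type_synonym 'd clocks = "(int ^ 'd) set \<Rightarrow> real"

abbreviation unit :: "'d \<Rightarrow> int ^ 'd" where "unit i \<equiv> axis i 1"

lemma sum_squares_int_eq_1:
  fixes z :: "int ^ 'd"
  assumes "(\<Sum>i\<in>UNIV. (z $ i)\<^sup>2) = 1"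
  shows "\<exists>i. z = unit i \<or> z = - unit i"
proof -
  obtain i where i: "z $ i \<noteq> 0" using assms by (metis (mono_tags, lifting) power_zero_numeral sum.neutral zero_neq_one)
  have "(\<Sum>j\<in>UNIV. (z $ j)\<^sup>2) = (z $ i)\<^sup>2 + (\<Sum>j\<in>UNIV - {i}. (z $ j)\<^sup>2)"
    by (simp add: sum.remove)
  moreover have "1 \<le> (z $ i)\<^sup>2" using i by (simp add: int_one_le_iff_zero_less)
  moreover have nn: "0 \<le> (\<Sum>j\<in>UNIV - {i}. (z $ j)\<^sup>2)" by (intro sum_nonneg) simp
  ultimately have *: "(z $ i)\<^sup>2 = 1" "(\<Sum>j\<in>UNIV - {i}. (z $ j)\<^sup>2) = 0" using assms by linarith+
  from *(2) have "\<forall>j\<in>UNIV - {i}. (z $ j)\<^sup>2 = 0" by (subst (asm) sum_nonneg_eq_0_iff) auto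
  then have "z $ j = 0" if "j \<noteq> i" for j using that by simp
  moreover have "z $ i = 1 \<or> z $ i = -1" using *(1) by (simp add: power2_eq_1_iff)
  ultimately have "z = unit i \<or> z = - unit i" by (auto simp: vec_eq_iff axis_def)
  then show ?thesis ..
qed

lemma dist_real_point:
  "dist (real_point x) (real_point y) = 1 \<longleftrightarrow> (\<exists>i. y = x + unit i \<or> x = y + unit i)"
proof -
  have "dist (real_point x) (real_point y) = sqrt (of_int (\<Sum>i\<in>UNIV. ((y - x) $ i)\<^sup>2))"
    unfolding dist_vec_def L2_set_def real_point_def
    by (simp add: dist_real_def power2_commute)
  then have "dist (real_point x) (real_point y) = 1 \<longleftrightarrow> (\<Sum>i\<in>UNIV. ((y - x) $ i)\<^sup>2) = 1"
    by (metis of_int_eq_1_iff real_sqrt_eq_1_iff)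
  also have "\<dots> \<longleftrightarrow> (\<exists>i. y - x = unit i \<or> y - x = - unit i)"
  proof
    assume "\<exists>i. y - x = unit i \<or> y - x = - unit i"
    then obtain i where i: "y - x = unit i \<or> y - x = - unit i" by blast
    then have "((y - x) $ j)\<^sup>2 = (if j = i then 1 else 0)" for j
      by (auto simp: axis_def simp del: vector_minus_component)
    then show "(\<Sum>i\<in>UNIV. ((y - x) $ i)\<^sup>2) = 1"
      by simp
  qed (rule sum_squares_int_eq_1)
  also have "\<dots> \<longleftrightarrow> (\<exists>i. y = x + unit i \<or> x = y + unit i)"
    by (intro ex_cong1) (auto simp: algebra_simps)
  finally show ?thesis .
qed

lemma lattice_edges_eq: "lattice_edges = {{x, x + unit i} | x i. True}"
  unfolding lattice_edges_def dist_real_point by (auto simp: insert_commute)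

lemma lattice_edgeI [intro, simp]: "{x, x + unit i} \<in> lattice_edges"
  unfolding lattice_edges_eq by blast

lemma lattice_edgeE:
  assumes "e \<in> lattice_edges" obtains x i where "e = {x, x + unit i}"
  using assms unfolding lattice_edges_eq by blast

lemma lattice_edge_atE:
  assumes "e \<in> lattice_edges" "v \<in> e"
  obtains i where "e = {v, v + unit i}" | i where "e = {v, v - unit i}"
proof -
  from assms(1) obtain x i where e: "e = {x, x + unit i}" by (rule lattice_edgeE)
  with assms(2) have "e = {v, v + unit i} \<or> e = {v, v - unit i}" by auto
  then show ?thesis using that by blast
qed

definition edges_at :: "int ^ 'd \<Rightarrow> (int ^ 'd) set set" where
  "edges_at v = {e \<in> lattice_edges. v \<in> e}"

definition conflicts :: "(int ^ 'd) set \<Rightarrow> (int ^ 'd) set set" where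
  "conflicts e = {f \<in> lattice_edges. f \<noteq> e \<and> f \<inter> e \<noteq> {}}"

lemma conflicts_subset: "conflicts e \<subseteq> lattice_edges"
  unfolding conflicts_def by auto

lemma edges_at_bound: "finite (edges_at (v :: int ^ 'd)) \<and> card (edges_at v) \<le> 2 * CARD('d)"
proof -
  let ?A = "range (\<lambda>i. {v, v + unit i})" and ?B = "range (\<lambda>i. {v, v - unit i})"
  have sub: "edges_at v \<subseteq> ?A \<union> ?B"
    unfolding edges_at_def by (auto elim!: lattice_edge_atE)
  have "card (edges_at v) \<le> card (?A \<union> ?B)" by (rule card_mono[OF _ sub]) simp
  also have "\<dots> \<le> card ?A + card ?B" by (rule card_Un_le)
  also have "\<dots> \<le> CARD('d) + CARD('d)" by (intro add_mono card_image_le) simp_all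
  finally show ?thesis using finite_subset[OF sub] by simp
qed

lemma finite_edges_at [simp]: "finite (edges_at v)"
  using edges_at_bound by blast

lemma conflicts_bound:
  assumes "e \<in> lattice_edges"
  shows "finite (conflicts (e :: (int ^ 'd) set)) \<and> card (conflicts e) \<le> 4 * CARD('d)"
proof -
  from assms obtain x i where e: "e = {x, x + unit i}" by (rule lattice_edgeE)
  have sub: "conflicts e \<subseteq> edges_at x \<union> edges_at (x + unit i)"
    unfolding conflicts_def edges_at_def e by auto
  have "card (conflicts e) \<le> card (edges_at x \<union> edges_at (x + unit i))" by (rule card_mono[OF _ sub]) simp
  also have "\<dots> \<le> card (edges_at x) + card (edges_at (x + unit i))" by (rule card_Un_le)
  also have "\<dots> \<le> 2 * CARD('d) + 2 * CARD('d)" using edges_at_bound by (intro add_mono) auto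
  finally show ?thesis using finite_subset[OF sub] by simp
qed

definition shift :: "int ^ 'd \<Rightarrow> (int ^ 'd) set \<Rightarrow> (int ^ 'd) set" where
  "shift v e = (+) v ` e"

lemma shift_shift: "shift v (shift w e) = shift (v + w) e"
  unfolding shift_def by (simp add: image_image add.assoc)

lemma shift_0 [simp]: "shift 0 e = e"
  unfolding shift_def by simp

lemma shift_lattice_edges: "shift v e \<in> lattice_edges" if "e \<in> lattice_edges"
proof -
  from that obtain x i where "e = {x, x + unit i}" by (rule lattice_edgeE)
  then have "shift v e = {v + x, (v + x) + unit i}" unfolding shift_def by (simp add: add.assoc)
  then show ?thesis using lattice_edgeI by simp
qed

lemma inj_shift: "inj (shift v)"
  by (rule inj_on_inverseI[where g = "shift (- v)"]) (simp add: shift_shift)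

lemma bij_shift: "bij_betw (shift v) lattice_edges lattice_edges"
  by (rule bij_betw_byWitness[where f' = "shift (- v)"]) (auto simp: shift_shift shift_lattice_edges)

lemma mem_shift: "u \<in> shift v e \<longleftrightarrow> u - v \<in> e"
  unfolding shift_def by (force simp: image_iff algebra_simps)

lemma conflicts_shift: "conflicts (shift v e) = shift v ` conflicts e"
proof
  have shiftI: "shift v f \<in> conflicts (shift v e)" if f: "f \<in> conflicts e" for v f and e :: "(int ^ 'd) set"
  proof -
    have "shift v f \<inter> shift v e = shift v (f \<inter> e)" unfolding shift_def by (auto simp: image_Int)
    moreover have "shift v (f \<inter> e) \<noteq> {}" using f unfolding conflicts_def shift_def by blast
    moreover have "shift v f \<noteq> shift v e" using f inj_shift[of v] unfolding conflicts_def by (simp add: inj_eq)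
    ultimately show ?thesis
      using f unfolding conflicts_def by (simp add: shift_lattice_edges)
  qed
  then show "shift v ` conflicts e \<subseteq> conflicts (shift v e)" by blast
  show "conflicts (shift v e) \<subseteq> shift v ` conflicts e"
  proof
    fix f assume "f \<in> conflicts (shift v e)"
    from shiftI[OF this, of "- v"] show "f \<in> shift v ` conflicts e"
      by (intro image_eqI[of _ _ "shift (- v) f"]) (simp_all add: shift_shift)
  qed
qed

lemma edges_at_shift: "edges_at (v + w) = shift v ` edges_at w"
proof
  show "edges_at (v + w) \<subseteq> shift v ` edges_at w"
  proof
    fix f assume "f \<in> edges_at (v + w)"
    then have "shift (- v) f \<in> edges_at w"
      unfolding edges_at_def by (simp add: shift_lattice_edges mem_shift add.commute)
    then show "f \<in> shift v ` edges_at w"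
      by (intro image_eqI[of _ _ "shift (- v) f"]) (simp_all add: shift_shift)
  qed
qed (auto simp: edges_at_def shift_lattice_edges mem_shift)

lemma card_vec_box:
  fixes A :: "'d::finite \<Rightarrow> int set"
  assumes "\<And>i. finite (A i)"
  shows "finite {v :: int ^ 'd. \<forall>i. v $ i \<in> A i} \<and> card {v :: int ^ 'd. \<forall>i. v $ i \<in> A i} = (\<Prod>i\<in>UNIV. card (A i))"
proof -
  have b: "bij_betw vec_lambda (Pi\<^sub>E UNIV A) {v :: int ^ 'd. \<forall>i. v $ i \<in> A i}"
    by (rule bij_betw_byWitness[where f' = vec_nth]) (auto simp: PiE_iff)
  from bij_betw_same_card[OF b] bij_betw_finite[OF b] assms show ?thesis
    by (simp add: card_PiE finite_PiE)
qed

lemma lattice_box_card: "finite (lattice_box n :: (int ^ 'd) set) \<and> card (lattice_box n :: (int ^ 'd) set) = n ^ CARD('d)"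
  unfolding lattice_box_def using card_vec_box[of "\<lambda>_ :: 'd. {1..int n}"] by simp

definition cube :: "nat \<Rightarrow> int ^ 'd \<Rightarrow> (int ^ 'd) set" where
  "cube r v = {w. \<forall>i. \<bar>w $ i - v $ i\<bar> \<le> int r}"

lemma card_cube: "finite (cube r v) \<and> card (cube r (v :: int ^ 'd)) = (2 * r + 1) ^ CARD('d)"
proof -
  have "cube r v = {w. \<forall>i. w $ i \<in> {v $ i - int r..v $ i + int r}}"
    unfolding cube_def by auto (smt (verit))+
  moreover have "nat (2 * int r + 1) = 2 * r + 1" by simp
  ultimately show ?thesis using card_vec_box[of "\<lambda>i. {v $ i - int r..v $ i + int r}"] by (simp only: card_atLeastAtMost_int finite_atLeastAtMost_int prod_constant diff_add_eq add_diff_cancel_left') (simp add: algebra_simps)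
qed

lemma cube_sym: "w \<in> cube r v \<longleftrightarrow> v \<in> cube r w"
  unfolding cube_def by (simp add: abs_minus_commute)

lemma cube_trans: "u \<in> cube r v \<Longrightarrow> w \<in> cube s u \<Longrightarrow> w \<in> cube (r + s) v"
  unfolding cube_def
proof safe
  fix i assume "\<forall>i. \<bar>u $ i - v $ i\<bar> \<le> int r" "\<forall>i. \<bar>w $ i - u $ i\<bar> \<le> int s"
  then have "\<bar>u $ i - v $ i\<bar> \<le> int r" "\<bar>w $ i - u $ i\<bar> \<le> int s" by auto
  then show "\<bar>w $ i - v $ i\<bar> \<le> int (r + s)" by linarith
qed

lemma cube_mono: "r \<le> s \<Longrightarrow> cube r v \<subseteq> cube s v"
  unfolding cube_def by auto (meson of_nat_mono order_trans)

lemma in_some_cube: "\<exists>r. v \<in> cube r 0"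
proof -
  define r where "r = (\<Sum>i\<in>UNIV. nat \<bar>v $ i\<bar>)"
  have "nat \<bar>v $ i\<bar> \<le> r" for i
    unfolding r_def by (rule member_le_sum) auto
  then have "\<bar>v $ i\<bar> \<le> int r" for i by (metis nat_le_iff)
  then have "v \<in> cube r 0" unfolding cube_def by simp
  then show ?thesis ..
qed

definition edge_ball :: "nat \<Rightarrow> int ^ 'd \<Rightarrow> (int ^ 'd) set set" where
  "edge_ball r v = {e \<in> lattice_edges. e \<subseteq> cube r v}"

lemma edge_ball_subset: "edge_ball r v \<subseteq> lattice_edges"
  unfolding edge_ball_def by auto

lemma edge_ball_mono: "u \<in> cube r v \<Longrightarrow> edge_ball s u \<subseteq> edge_ball (r + s) v"
  unfolding edge_ball_def using cube_trans by blast

lemma edge_ball_disjoint: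
  assumes "w \<notin> cube (r + s) v"
  shows "edge_ball r v \<inter> edge_ball s w = {}"
proof (rule ccontr)
  assume "edge_ball r v \<inter> edge_ball s w \<noteq> {}"
  then obtain e where e: "e \<in> lattice_edges" "e \<subseteq> cube r v" "e \<subseteq> cube s w"
    unfolding edge_ball_def by auto
  from e(1) obtain u where "u \<in> e" by (auto elim: lattice_edgeE)
  with e have "u \<in> cube r v" "w \<in> cube s u" using cube_sym[of u s w] by auto
  with assms cube_trans show False by blast
qed

lemma edge_subset_cube: "e \<in> edges_at v \<Longrightarrow> e \<subseteq> cube 1 v"
  unfolding edges_at_def by (auto elim!: lattice_edge_atE simp: cube_def axis_def)

lemma reach_subset:
  assumes "e \<in> edges_at v"
  shows "reach conflicts k e \<subseteq> edge_ball (Suc k) v"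
  using assms
proof (induction k arbitrary: e v)
  case 0
  then show ?case using edge_subset_cube[of e v] unfolding edge_ball_def edges_at_def by auto
next
  case (Suc k)
  have "e \<in> edge_ball (Suc (Suc k)) v"
    using Suc.prems edge_subset_cube[of e v] cube_mono[of 1 "Suc (Suc k)" v] unfolding edge_ball_def edges_at_def by auto
  moreover have "reach conflicts k f \<subseteq> edge_ball (Suc (Suc k)) v" if "f \<in> conflicts e" for f
  proof -
    from that obtain u where u: "u \<in> e" "f \<in> edges_at u" unfolding conflicts_def edges_at_def by auto
    with edge_subset_cube[OF Suc.prems] have "u \<in> cube 1 v" by auto
    from Suc.IH[OF u(2)] edge_ball_mono[OF this, of "Suc k"] show ?thesis by auto
  qed
  ultimately show ?case by auto
qed

section \<open>Free sites and their local approximations\<close>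

abbreviation law :: "((int ^ 'd) set \<Rightarrow> real) measure" where
  "law \<equiv> iidU lattice_edges"

definition free :: "int ^ 'd \<Rightarrow> ((int ^ 'd) set \<Rightarrow> real) \<Rightarrow> real" where
  "free v x = of_bool (\<forall>e\<in>edges_at v. e \<notin> greedy_set conflicts x)"

definition local_free :: "nat \<Rightarrow> int ^ 'd \<Rightarrow> ((int ^ 'd) set \<Rightarrow> real) \<Rightarrow> real" where
  "local_free k v x = of_bool (\<forall>e\<in>edges_at v. \<not> accepted conflicts k e x)"

definition long_descent :: "nat \<Rightarrow> int ^ 'd \<Rightarrow> ((int ^ 'd) set \<Rightarrow> real) \<Rightarrow> bool" where
  "long_descent k v x \<longleftrightarrow> (\<exists>e\<in>edges_at v. descends conflicts k e x)"

lemma edges_at_lattice: "e \<in> edges_at v \<Longrightarrow> e \<in> lattice_edges"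
  unfolding edges_at_def by simp

lemma conflicts_closed: "e \<in> lattice_edges \<Longrightarrow> conflicts e \<subseteq> lattice_edges \<and> finite (conflicts e)"
  using conflicts_bound conflicts_subset by blast

lemma accepted_conflicts_measurable:
  "e \<in> edges_at v \<Longrightarrow> Measurable.pred law (accepted conflicts k e)"
  using accepted_measurable[of lattice_edges conflicts e k] conflicts_closed edges_at_lattice by blast

lemma descends_conflicts_measurable:
  "e \<in> edges_at v \<Longrightarrow> Measurable.pred law (descends conflicts k e)"
  using descends_measurable[of lattice_edges conflicts e k] conflicts_closed edges_at_lattice by blast

lemma local_free_measurable [measurable]: "local_free k v \<in> borel_measurable law"
proof -
  have "Measurable.pred law (\<lambda>x. \<forall>e\<in>edges_at v. \<not> accepted conflicts k e x)"
  proof (rule pred_intros_finite(3))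
    fix e assume "e \<in> edges_at v"
    then have [measurable]: "Measurable.pred law (accepted conflicts k e)"
      by (rule accepted_conflicts_measurable)
    show "Measurable.pred law (\<lambda>x. \<not> accepted conflicts k e x)" by measurable
  qed simp
  then show ?thesis unfolding local_free_def by measurable
qed

lemma long_descent_measurable [measurable]: "Measurable.pred law (long_descent k v)"
  unfolding long_descent_def
proof (rule pred_intros_finite(4))
  fix e assume "e \<in> edges_at v"
  then show "Measurable.pred law (descends conflicts k e)"
    by (rule descends_conflicts_measurable)
qed simp

lemma free_measurable [measurable]: "free v \<in> borel_measurable law"
proof -
  have "Measurable.pred law (\<lambda>x. \<forall>e\<in>edges_at v. \<not> (\<exists>k. \<not> descends conflicts k e x \<and> accepted conflicts k e x))"
  proof (rule pred_intros_finite(3))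
    fix e assume "e \<in> edges_at v"
    then have [measurable]: "Measurable.pred law (accepted conflicts k e)"
      "Measurable.pred law (descends conflicts k e)" for k
      by (auto intro: accepted_conflicts_measurable descends_conflicts_measurable)
    show "Measurable.pred law (\<lambda>x. \<not> (\<exists>k. \<not> descends conflicts k e x \<and> accepted conflicts k e x))" by measurable
  qed simp
  then show ?thesis unfolding free_def greedy_set_def mem_Collect_eq by measurable
qed

lemma free_bound: "0 \<le> free v x" "free v x \<le> 1"
  unfolding free_def by auto

lemma local_free_bound: "0 \<le> local_free k v x" "local_free k v x \<le> 1"
  unfolding local_free_def by auto

text \<open>
  This is the localisation on which everything else rests: up to an exponentially unlikely
  event, the state of a site is a function of the clocks near it.
\<close>

lemma free_eq_local: "\<not> long_descent k v x \<Longrightarrow> free v x = local_free k v x"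
proof -
  assume "\<not> long_descent k v x"
  then have "e \<in> greedy_set conflicts x \<longleftrightarrow> accepted conflicts k e x" if "e \<in> edges_at v" for e
    using that unfolding long_descent_def by (intro greedy_set_iff) blast
  then show ?thesis unfolding free_def local_free_def by simp
qed

lemma local_free_depends: "depends_on (edge_ball (Suc k) v) (local_free k v)"
  unfolding depends_on_def local_free_def
proof (intro allI impI)
  fix x y :: "'a clocks" assume *: "\<forall>e\<in>edge_ball (Suc k) v. x e = y e"
  have "accepted conflicts k e x = accepted conflicts k e y" if "e \<in> edges_at v" for e
    by (rule accepted_local) (use * reach_subset[OF that] in auto)
  then show "(of_bool (\<forall>e\<in>edges_at v. \<not> accepted conflicts k e x) :: real) = of_bool (\<forall>e\<in>edges_at v. \<not> accepted conflicts k e y)"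
    by simp
qed

lemma free_depends: "depends_on lattice_edges (free v)"
  unfolding depends_on_def
proof (intro allI impI)
  fix x y :: "'a clocks" assume xy: "\<forall>e\<in>lattice_edges. x e = y e"
  note rules_cong[OF conflicts_subset xy edges_at_lattice]
  then show "free v x = free v y" unfolding free_def greedy_set_def by simp
qed

lemma free_shift: "free v (x \<circ> shift w) = free (w + v) x"
  unfolding free_def greedy_set_def edges_at_shift
  by (simp add: accepted_equivariant[where N = conflicts and \<pi> = "shift w", OF conflicts_shift]
    descends_equivariant[where N = conflicts and \<pi> = "shift w", OF conflicts_shift])

text \<open>
  There are at most \<open>2 * d\<close> edges at a site and \<open>4 * d\<close> conflicts of an edge. The weight
  parameter \<open>8 * d\<close> turns every step of a descent into a factor \<open>1 / 2\<close>.
\<close>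

definition descent_const :: "'d itself \<Rightarrow> real" where
  "descent_const _ = 2 * CARD('d) * exp (8 * CARD('d))"

lemma long_descent_prob:
  "measure law {x \<in> space law. long_descent k (v :: int ^ 'd) x} \<le> descent_const TYPE('d) / 2 ^ k"
proof -
  interpret prob_space "law :: 'd clocks measure" by (rule prob_space_iidU)
  let ?A = "\<lambda>e. {x \<in> space law. descends conflicts k e x}"
  have ev: "?A e \<in> events" if "e \<in> edges_at v" for e
    using descends_conflicts_measurable[OF that] by simp
  have "{x \<in> space law. long_descent k v x} = (\<Union>e\<in>edges_at v. ?A e)"
    unfolding long_descent_def by auto
  then have "prob {x \<in> space law. long_descent k v x} \<le> (\<Sum>e\<in>edges_at v. prob (?A e))"
    using ev by (simp, intro measure_UNION_le) auto
  also have "\<dots> \<le> (\<Sum>e\<in>edges_at v. exp (8 * CARD('d)) / 2 ^ k)"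
  proof (rule sum_mono)
    fix e assume e: "e \<in> edges_at v"
    have "prob (?A e) \<le> exp (real (8 * CARD('d))) * (real (4 * CARD('d)) / real (8 * CARD('d))) ^ k"
      by (rule descends_prob) (use conflicts_closed conflicts_bound edges_at_lattice[OF e] in auto)
    also have "real (4 * CARD('d)) / real (8 * CARD('d)) = 1 / 2" by simp
    finally show "prob (?A e) \<le> exp (8 * CARD('d)) / 2 ^ k" by (simp add: power_divide)
  qed
  also have "\<dots> = card (edges_at v) * (exp (8 * CARD('d)) / 2 ^ k)" by simp
  also have "\<dots> \<le> (2 * CARD('d)) * (exp (8 * CARD('d)) / 2 ^ k)"
    using edges_at_bound[of v] by (intro mult_right_mono) (auto simp del: of_nat_mult)
  finally show ?thesis unfolding descent_const_def by simp
qed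

lemma descent_const_pos: "0 < descent_const TYPE('d::finite)"
  unfolding descent_const_def by simp

lemma (in prob_space) expectation_in_01:
  fixes f :: "'a \<Rightarrow> real"
  assumes "random_variable borel f" "\<And>x. 0 \<le> f x" "\<And>x. f x \<le> 1"
  shows "0 \<le> expectation f \<and> expectation f \<le> 1"
proof -
  have "integrable M f" by (rule integrable_bounded[where C = 1]) (use assms in auto)
  then show ?thesis using assms by (auto intro!: integral_le_const Bochner_Integration.integral_nonneg)
qed

lemma (in prob_space) covariance_eq:
  assumes [measurable]: "random_variable borel F" "random_variable borel G"
    and F: "\<And>x. 0 \<le> F x" "\<And>x. F x \<le> 1" and G: "\<And>x. 0 \<le> G x" "\<And>x. G x \<le> 1"
  shows "covariance M F G = expectation (\<lambda>x. F x * G x) - expectation F * expectation G"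
proof -
  have i: "integrable M F" "integrable M G" "integrable M (\<lambda>x. F x * G x)"
    using F G by (auto intro!: integrable_bounded[where C = 1] simp: abs_mult mult_le_one)
  have "covariance M F G = expectation (\<lambda>x. F x * G x - expectation F * G x - expectation G * F x + expectation F * expectation G)"
    unfolding covariance_def by (intro Bochner_Integration.integral_cong) (auto simp: algebra_simps)
  also have "\<dots> = expectation (\<lambda>x. F x * G x) - expectation F * expectation G"
    using i by (simp add: prob_space)
  finally show ?thesis .
qed

lemma (in prob_space) centred_bound:
  fixes F :: "'a \<Rightarrow> real"
  assumes "random_variable borel F" "\<And>x. 0 \<le> F x" "\<And>x. F x \<le> 1"
  shows "\<bar>F x - expectation F\<bar> \<le> 1"
  using expectation_in_01[OF assms] assms(2)[of x] assms(3)[of x] by linarith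

lemma (in prob_space) centred_sum_variance:
  fixes F :: "'i \<Rightarrow> 'a \<Rightarrow> real"
  assumes [measurable]: "\<And>v. random_variable borel (F v)"
    and F: "\<And>v x. 0 \<le> F v x" "\<And>v x. F v x \<le> 1"
  shows "expectation (\<lambda>x. (\<Sum>v\<in>I. F v x - expectation (F v))\<^sup>2) = (\<Sum>v\<in>I. \<Sum>w\<in>I. covariance M (F v) (F w))"
proof -
  let ?g = "\<lambda>v x. F v x - expectation (F v)"
  have "integrable M (\<lambda>x. ?g v x * ?g w x)" for v w
    using centred_bound[OF assms(1) F] by (intro integrable_bounded[where C = 1]) (auto simp: abs_mult mult_le_one)
  then show ?thesis
    unfolding covariance_def power2_eq_square sum_product by simp
qed

lemma (in prob_space) covariance_perturb:
  assumes [measurable]: "random_variable borel F" "random_variable borel G" "random_variable borel F'" "random_variable borel G'"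
    and F: "\<And>x. 0 \<le> F x" "\<And>x. F x \<le> 1" and G: "\<And>x. 0 \<le> G x" "\<And>x. G x \<le> 1"
    and F': "\<And>x. 0 \<le> F' x" "\<And>x. F' x \<le> 1" and G': "\<And>x. 0 \<le> G' x" "\<And>x. G' x \<le> 1"
    and FF: "expectation (\<lambda>x. \<bar>F x - F' x\<bar>) \<le> \<delta>" and GG: "expectation (\<lambda>x. \<bar>G x - G' x\<bar>) \<le> \<delta>"
  shows "\<bar>covariance M F G - covariance M F' G'\<bar> \<le> 4 * \<delta>"
proof -
  have i: "integrable M F" "integrable M G" "integrable M (\<lambda>x. F x * G x)"
    "integrable M F'" "integrable M G'" "integrable M (\<lambda>x. F' x * G' x)"
    using F G F' G' by (auto intro!: integrable_bounded[where C = 1] simp: abs_mult mult_le_one)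
  have j: "integrable M (\<lambda>x. \<bar>F x - F' x\<bar>)" "integrable M (\<lambda>x. \<bar>G x - G' x\<bar>)" using i by auto
  have pr: "\<bar>a * b - a' * b'\<bar> \<le> \<bar>a - a'\<bar> + \<bar>b - b'\<bar>"
    if "0 \<le> a" "a \<le> 1" "0 \<le> b'" "b' \<le> 1" for a b a' b' :: real
  proof -
    have "a * b - a' * b' = a * (b - b') + (a - a') * b'" by (simp add: algebra_simps)
    also have "\<bar>\<dots>\<bar> \<le> \<bar>a\<bar> * \<bar>b - b'\<bar> + \<bar>a - a'\<bar> * \<bar>b'\<bar>" by (metis abs_mult abs_triangle_ineq)
    also have "\<dots> \<le> 1 * \<bar>b - b'\<bar> + \<bar>a - a'\<bar> * 1" using that by (intro add_mono mult_mono) auto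
    finally show ?thesis by simp
  qed
  have "\<bar>expectation (\<lambda>x. F x * G x) - expectation (\<lambda>x. F' x * G' x)\<bar>
     = \<bar>expectation (\<lambda>x. F x * G x - F' x * G' x)\<bar>" using i by simp
  also have "\<dots> \<le> expectation (\<lambda>x. \<bar>F x * G x - F' x * G' x\<bar>)" by (rule integral_abs_bound)
  also have "\<dots> \<le> expectation (\<lambda>x. \<bar>F x - F' x\<bar> + \<bar>G x - G' x\<bar>)"
    using i j by (intro integral_mono pr F G') auto
  also have "\<dots> \<le> 2 * \<delta>" using j FF GG by simp
  finally have 1: "\<bar>expectation (\<lambda>x. F x * G x) - expectation (\<lambda>x. F' x * G' x)\<bar> \<le> 2 * \<delta>" .
  have d: "\<bar>expectation F - expectation F'\<bar> \<le> \<delta>" "\<bar>expectation G - expectation G'\<bar> \<le> \<delta>"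
    using integral_abs_bound[of M "\<lambda>x. F x - F' x"] integral_abs_bound[of M "\<lambda>x. G x - G' x"] i FF GG by auto
  have "\<bar>expectation F * expectation G - expectation F' * expectation G'\<bar>
     \<le> \<bar>expectation F - expectation F'\<bar> + \<bar>expectation G - expectation G'\<bar>"
    using expectation_in_01[of F] expectation_in_01[of G'] F G' by (intro pr) auto
  with d have 2: "\<bar>expectation F * expectation G - expectation F' * expectation G'\<bar> \<le> 2 * \<delta>" by linarith
  show ?thesis
    using 1 2 by (simp add: covariance_eq F G F' G')
qed

lemma expectation_free_minus_local:
  "(\<integral>x. \<bar>free (v :: int ^ 'd) x - local_free k v x\<bar> \<partial>law) \<le> descent_const TYPE('d) / 2 ^ k"
proof -
  interpret prob_space "law :: 'd clocks measure" by (rule prob_space_iidU)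
  let ?B = "{x \<in> space law. long_descent k v x}"
  have B: "?B \<in> events" by measurable
  have "expectation (\<lambda>x. \<bar>free v x - local_free k v x\<bar>) \<le> expectation (indicator ?B)"
  proof (rule integral_mono)
    show "integrable law (\<lambda>x. \<bar>free v x - local_free k v x\<bar>)"
    proof (rule integrable_bounded[where C = 1])
      show "\<bar>\<bar>free v x - local_free k v x\<bar>\<bar> \<le> 1" for x
        using free_bound[of v x] local_free_bound[of k v x] by linarith
    qed measurable
    show "integrable law (indicator ?B :: _ \<Rightarrow> real)"
      by (rule integrable_real_indicator[OF B]) (simp add: emeasure_eq_measure)
    fix x :: "'d clocks" assume "x \<in> space law"
    then show "\<bar>free v x - local_free k v x\<bar> \<le> indicator ?B x"
      using free_eq_local[of k v x] free_bound[of v x] local_free_bound[of k v x]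
      by (cases "long_descent k v x") (auto simp: indicator_def)
  qed
  also have "\<dots> = prob ?B" using B by simp
  also have "\<dots> \<le> descent_const TYPE('d) / 2 ^ k" by (rule long_descent_prob)
  finally show ?thesis .
qed

definition cov :: "int ^ 'd \<Rightarrow> real" where
  "cov \<rho> = covariance law (free 0) (free \<rho>)"

lemma free_mean: "integral\<^sup>L law (free (v :: int ^ 'd)) = integral\<^sup>L law (free (0 :: int ^ 'd))"
  using reindex_integral(2)[OF bij_shift[of v] free_measurable[of 0] free_depends[of 0]]
  by (simp add: free_shift)

lemma covariance_free: "covariance law (free (v :: int ^ 'd)) (free w) = cov (w - v)"
proof -
  define \<mu> where "\<mu> = integral\<^sup>L law (free (0 :: int ^ 'd))"
  have mean: "integral\<^sup>L law (free u) = \<mu>" for u :: "int ^ 'd"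
    unfolding \<mu>_def by (rule free_mean)
  let ?F = "\<lambda>x. (free 0 x - \<mu>) * (free (w - v) x - \<mu>)"
  have "(\<integral>x. ?F (x \<circ> shift v) \<partial>law) = (\<integral>x. ?F x \<partial>law)"
  proof (rule reindex_integral(2)[where F = ?F and \<pi> = "shift v", OF bij_shift])
    show "depends_on lattice_edges ?F"
      by (intro depends_on_compose2[where h = "\<lambda>a b. (a - \<mu>) * (b - \<mu>)"] free_depends)
  qed measurable
  then show ?thesis
    unfolding covariance_def cov_def mean by (simp add: free_shift)
qed

lemma lattice_edges_nonempty: "lattice_edges \<noteq> {}"
  using lattice_edgeI by blast

lemma local_free_cov:
  assumes "w \<notin> cube (2 * Suc k) v"
  shows "covariance law (local_free k v) (local_free k w) = 0"
proof -
  interpret prob_space "law :: 'a clocks measure" by (rule prob_space_iidU)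
  have i: "integrable law (local_free k v)" for v :: "int ^ 'a"
    by (intro integrable_bounded[where C = 1]) (auto simp: local_free_bound)
  have "(\<integral>x. local_free k v x * local_free k w x \<partial>law) = integral\<^sup>L law (local_free k v) * integral\<^sup>L law (local_free k w)"
  proof (rule indep_expectation[where J = "edge_ball (Suc k) v" and K = "edge_ball (Suc k) w"])
    show "edge_ball (Suc k) v \<inter> edge_ball (Suc k) w = {}"
      by (rule edge_ball_disjoint) (use assms in \<open>simp add: mult_2\<close>)
  qed (rule lattice_edges_nonempty edge_ball_subset i local_free_depends)+
  then show ?thesis
    by (simp add: covariance_eq local_free_bound)
qed

lemma cov_local_error:
  "\<bar>cov (w - v) - covariance law (local_free k v) (local_free k (w :: int ^ 'd))\<bar> \<le> 4 * (descent_const TYPE('d) / 2 ^ k)"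
proof -
  interpret prob_space "law :: 'd clocks measure" by (rule prob_space_iidU)
  show ?thesis
    unfolding covariance_free[symmetric]
    by (rule covariance_perturb) (use free_bound local_free_bound expectation_free_minus_local in auto)
qed

text \<open>
  The two local approximations of this depth do not share a clock and are uncorrelated, so
  only the approximation error is left.
\<close>

lemma cov_decay:
  assumes "\<rho> \<notin> cube (2 * Suc k) 0"
  shows "\<bar>cov (\<rho> :: int ^ 'd)\<bar> \<le> 4 * (descent_const TYPE('d) / 2 ^ k)"
  using cov_local_error[of \<rho> 0 k] local_free_cov[OF assms] by simp

section \<open>Summable covariances and the variance in a box\<close>

lemma summable_poly_geometric: "summable (\<lambda>k. (4 * real k + 9) ^ d / 2 ^ k)"
proof (rule summable_comparison_test')
  show "summable (\<lambda>k. (fact d * 16 ^ d * exp (9 / 16)) * (3 / 4 :: real) ^ k)"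
    by (intro summable_mult summable_geometric) simp
  fix k :: nat
  have e: "exp (1 / 4 :: real) \<le> 3 / 2"
  proof -
    have "exp (1 / 4 :: real) \<le> 1 + 1 / 4 + (1 / 4)\<^sup>2" by (rule exp_bound) auto
    also have "\<dots> \<le> 3 / 2" by (simp add: power2_eq_square)
    finally show ?thesis .
  qed
  \<comment> \<open>The scale 16 makes \<open>exp y\<close> grow by the factor \<open>exp (1 / 4) \<le> 3 / 2\<close> per step, slower than \<open>2 ^ k\<close>.\<close>
  define y where "y = (4 * real k + 9) / 16"
  have "y ^ d / fact d \<le> exp y"
  proof -
    have "y ^ d / fact d \<le> (\<Sum>i\<le>d. y ^ i / fact i)"
      by (rule member_le_sum[where f = "\<lambda>i. y ^ i / fact i"]) (auto simp: y_def)
    also have "\<dots> \<le> exp y"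
    proof -
      have "(\<lambda>i. y ^ i / fact i) sums exp y" using exp_converges[of y] by (simp add: divide_inverse mult.commute)
      then show ?thesis
        by (intro sum_le_suminf[of "\<lambda>i. y ^ i / fact i", THEN order_trans]) (auto simp: sums_iff y_def)
    qed
    finally show ?thesis .
  qed
  also have "exp y = exp (9 / 16) * exp (1 / 4) ^ k"
    unfolding y_def by (simp add: exp_of_nat_mult[symmetric] exp_add[symmetric] field_simps)
  also have "\<dots> \<le> exp (9 / 16) * (3 / 2) ^ k"
    by (intro mult_left_mono power_mono e) auto
  finally have "y ^ d \<le> fact d * exp (9 / 16) * (3 / 2) ^ k" by (simp add: divide_simps mult_ac)
  then have "(4 * real k + 9) ^ d \<le> 16 ^ d * (fact d * exp (9 / 16) * (3 / 2) ^ k)"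
    unfolding y_def by (simp add: power_divide divide_simps mult_ac)
  then have "(4 * real k + 9) ^ d / 2 ^ k \<le> 16 ^ d * (fact d * exp (9 / 16) * (3 / 2) ^ k) / 2 ^ k"
    by (intro divide_right_mono) auto
  also have "\<dots> = (fact d * 16 ^ d * exp (9 / 16)) * ((3 / 2) ^ k / 2 ^ k)" by simp
  also have "(3 / 2) ^ k / 2 ^ k = (3 / 4 :: real) ^ k" by (simp add: power_divide[symmetric])
  finally show "norm ((4 * real k + 9) ^ d / 2 ^ k) \<le> (fact d * 16 ^ d * exp (9 / 16)) * (3 / 4) ^ k" by simp
qed

text \<open>
  The shell between two successive cubes has polynomially many sites, and the covariances on
  it decay geometrically.
\<close>

lemma cov_summable: "(\<lambda>\<rho> :: int ^ 'd. \<bar>cov \<rho>\<bar>) summable_on UNIV"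
proof -
  define d where "d = CARD('d)"
  define A where "A k = cube (2 * Suc k) (0 :: int ^ 'd)" for k
  define C where "C = 4 * descent_const TYPE('d)"
  have C: "0 \<le> C" unfolding C_def using descent_const_pos[where 'd = 'd] by simp
  have fin: "finite (A k)" for k unfolding A_def using card_cube by blast
  have step: "(\<Sum>\<rho>\<in>A n. \<bar>cov \<rho>\<bar>) \<le> (\<Sum>\<rho>\<in>A 0. \<bar>cov \<rho>\<bar>) + C * (\<Sum>k<n. (4 * real k + 9) ^ d / 2 ^ k)" for n
  proof (induction n)
    case (Suc n)
    have sub: "A n \<subseteq> A (Suc n)" unfolding A_def by (rule cube_mono) simp
    have "(\<Sum>\<rho>\<in>A (Suc n) - A n. \<bar>cov \<rho>\<bar>) \<le> (\<Sum>\<rho>\<in>A (Suc n) - A n. C / 2 ^ n)"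
      using cov_decay[of _ n] by (intro sum_mono) (auto simp: A_def C_def)
    also have "\<dots> \<le> (\<Sum>\<rho>\<in>A (Suc n). C / 2 ^ n)"
      using C fin by (intro sum_mono2) auto
    also have "\<dots> = C * ((4 * real n + 9) ^ d / 2 ^ n)"
      using card_cube[of "2 * Suc (Suc n)" "0 :: int ^ 'd"] by (simp add: A_def d_def algebra_simps)
    finally have "(\<Sum>\<rho>\<in>A (Suc n) - A n. \<bar>cov \<rho>\<bar>) \<le> C * ((4 * real n + 9) ^ d / 2 ^ n)" .
    moreover have "(\<Sum>\<rho>\<in>A (Suc n). \<bar>cov \<rho>\<bar>) = (\<Sum>\<rho>\<in>A (Suc n) - A n. \<bar>cov \<rho>\<bar>) + (\<Sum>\<rho>\<in>A n. \<bar>cov \<rho>\<bar>)"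
      by (rule sum.subset_diff[OF sub fin])
    ultimately show ?case using Suc.IH by (simp add: distrib_left)
  qed simp
  define B where "B = (\<Sum>\<rho>\<in>A 0. \<bar>cov \<rho>\<bar>) + C * (\<Sum>k. (4 * real k + 9) ^ d / 2 ^ k)"
  have "(\<Sum>\<rho>\<in>F. \<bar>cov \<rho>\<bar>) \<le> B" if F: "finite F" for F :: "(int ^ 'd) set"
  proof -
    obtain r where r: "\<And>\<rho>. \<rho> \<in> cube (r \<rho>) (0 :: int ^ 'd)" using in_some_cube by metis
    define m where "m = (\<Sum>\<rho>\<in>F. r \<rho>)"
    have "F \<subseteq> A m"
    proof
      fix \<rho> assume "\<rho> \<in> F"
      then have "r \<rho> \<le> m" unfolding m_def using F by (intro member_le_sum) auto
      then show "\<rho> \<in> A m" unfolding A_def using r[of \<rho>] cube_mono[of "r \<rho>" "2 * Suc m" 0] by auto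
    qed
    then have "(\<Sum>\<rho>\<in>F. \<bar>cov \<rho>\<bar>) \<le> (\<Sum>\<rho>\<in>A m. \<bar>cov \<rho>\<bar>)"
      using fin by (intro sum_mono2) auto
    also have "\<dots> \<le> (\<Sum>\<rho>\<in>A 0. \<bar>cov \<rho>\<bar>) + C * (\<Sum>k<m. (4 * real k + 9) ^ d / 2 ^ k)" by (rule step)
    also have "\<dots> \<le> B"
      unfolding B_def using C summable_poly_geometric[of d]
      by (intro add_left_mono mult_left_mono sum_le_suminf) auto
    finally show ?thesis .
  qed
  then show ?thesis
    by (intro nonneg_bdd_above_summable_on bdd_aboveI[where M = B]) auto
qed

definition box_sum :: "nat \<Rightarrow> ((int ^ 'd) set \<Rightarrow> real) \<Rightarrow> real" where
  "box_sum n x = (\<Sum>v\<in>lattice_box n. free v x - integral\<^sup>L law (free v))"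

lemma box_sum_measurable [measurable]: "box_sum n \<in> borel_measurable law"
  unfolding box_sum_def by measurable

lemma box_variance:
  "(\<integral>x. (box_sum n x)\<^sup>2 \<partial>(law :: ((int ^ 'd) set \<Rightarrow> real) measure)) = (\<Sum>v\<in>lattice_box n. \<Sum>w\<in>lattice_box n. cov (w - v :: int ^ 'd))"
  unfolding box_sum_def covariance_free[symmetric]
  by (rule prob_space.centred_sum_variance[OF prob_space_iidU free_measurable free_bound])

definition limit_variance :: "'d::finite itself \<Rightarrow> real" where
  "limit_variance _ = (\<Sum>\<^sub>\<infinity>\<rho> :: int ^ 'd. cov \<rho>)"

lemma overlap_fraction_tendsto:
  "(\<lambda>n. real (card {v \<in> lattice_box n. v + \<rho> \<in> lattice_box n}) / real n ^ CARD('d)) \<longlonglongrightarrow> 1"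
  for \<rho> :: "int ^ 'd"
proof -
  have eq: "{v \<in> lattice_box n. v + \<rho> \<in> lattice_box n} = {v. \<forall>i. v $ i \<in> {max 1 (1 - \<rho> $ i)..min (int n) (int n - \<rho> $ i)}}" for n
    unfolding lattice_box_def by (auto simp: algebra_simps)
  have card: "card {v \<in> lattice_box n. v + \<rho> \<in> lattice_box n} = (\<Prod>i\<in>UNIV. nat (int n - \<bar>\<rho> $ i\<bar>))" for n
    unfolding eq using card_vec_box[of "\<lambda>i. {max 1 (1 - \<rho> $ i)..min (int n) (int n - \<rho> $ i)}"]
    by (auto intro!: prod.cong)
  have "(\<lambda>n. \<Prod>i\<in>UNIV. real (nat (int n - \<bar>\<rho> $ i\<bar>)) / real n) \<longlonglongrightarrow> (\<Prod>i\<in>(UNIV :: 'd set). 1)"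
  proof (rule tendsto_prod)
    fix i
    have "(\<lambda>n. 1 - real_of_int \<bar>\<rho> $ i\<bar> / real n) \<longlonglongrightarrow> 1 - 0"
      by (intro tendsto_diff tendsto_const lim_const_over_n)
    moreover have "\<forall>\<^sub>F n in sequentially. 1 - real_of_int \<bar>\<rho> $ i\<bar> / real n = real (nat (int n - \<bar>\<rho> $ i\<bar>)) / real n"
      using eventually_ge_at_top[of "Suc (nat \<bar>\<rho> $ i\<bar>)"]
    proof eventually_elim
      case (elim n)
      then have "real (nat (int n - \<bar>\<rho> $ i\<bar>)) = real n - real_of_int \<bar>\<rho> $ i\<bar>" "0 < n" by auto
      then show ?case by (simp add: diff_divide_distrib)
    qed
    ultimately show "(\<lambda>n. real (nat (int n - \<bar>\<rho> $ i\<bar>)) / real n) \<longlonglongrightarrow> 1"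
      by (simp add: tendsto_cong)
  qed
  then show ?thesis
    unfolding card by (simp add: prod_dividef)
qed

text \<open>
  A displacement \<open>\<rho>\<close> occurs in the double sum once for every site that stays in the box when
  moved by \<open>\<rho>\<close>. The fraction of such sites tends to 1, and the summable covariances dominate.
\<close>

lemma box_variance_tendsto:
  "(\<lambda>n. (\<integral>x. (box_sum n x)\<^sup>2 \<partial>(law :: ((int ^ 'd) set \<Rightarrow> real) measure)) / real n ^ CARD('d)) \<longlonglongrightarrow> limit_variance TYPE('d)"
proof -
  let ?U = "count_space (UNIV :: (int ^ 'd) set)"
  let ?a = "\<lambda>n (\<rho> :: int ^ 'd). real (card {v \<in> lattice_box n. v + \<rho> \<in> lattice_box n}) / real n ^ CARD('d)"
  have int: "integrable ?U (\<lambda>\<rho>. cov \<rho>)"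
    using cov_summable[where 'd = 'd] abs_summable_equivalent[of cov "UNIV :: (int ^ 'd) set"]
    by (simp add: Infinite_Set_Sum.abs_summable_on_def)
  have A: "(\<integral>x. (box_sum n x)\<^sup>2 \<partial>(law :: 'd clocks measure)) / real n ^ CARD('d) = (\<integral>\<rho>. cov \<rho> * ?a n \<rho> \<partial>?U)" for n
  proof -
    let ?L = "lattice_box n :: (int ^ 'd) set"
    have fin: "finite ?L" using lattice_box_card by blast
    have one: "(\<Sum>w\<in>?L. cov (w - v)) = (\<integral>\<rho>. cov \<rho> * of_bool (v + \<rho> \<in> ?L) \<partial>?U)" for v
    proof -
      have "(\<integral>\<rho>. cov \<rho> * of_bool (v + \<rho> \<in> ?L) \<partial>?U) = (\<Sum>\<rho>\<in>(\<lambda>w. w - v) ` ?L. cov \<rho> * of_bool (v + \<rho> \<in> ?L))"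
      proof (subst lebesgue_integral_count_space_finite_support)
        have sub: "{\<rho>. cov \<rho> * of_bool (v + \<rho> \<in> ?L) \<noteq> 0} \<subseteq> (\<lambda>w. w - v) ` ?L"
        proof
          fix \<rho> assume "\<rho> \<in> {\<rho>. cov \<rho> * of_bool (v + \<rho> \<in> ?L) \<noteq> 0}"
          then have "v + \<rho> \<in> ?L" by (auto split: if_splits)
          then show "\<rho> \<in> (\<lambda>w. w - v) ` ?L" by (intro image_eqI[of _ _ "v + \<rho>"]) auto
        qed
        show "finite {\<rho> \<in> UNIV. cov \<rho> * of_bool (v + \<rho> \<in> ?L) \<noteq> 0}"
          using finite_subset[OF sub] fin by simp
        show "(\<Sum>\<rho> | \<rho> \<in> UNIV \<and> cov \<rho> * of_bool (v + \<rho> \<in> ?L) \<noteq> 0. cov \<rho> * of_bool (v + \<rho> \<in> ?L))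
            = (\<Sum>\<rho>\<in>(\<lambda>w. w - v) ` ?L. cov \<rho> * of_bool (v + \<rho> \<in> ?L))"
          by (rule sum.mono_neutral_left) (use sub fin in auto)
      qed
      also have "\<dots> = (\<Sum>w\<in>?L. cov (w - v))"
        by (subst sum.reindex) (auto intro: inj_onI)
      finally show ?thesis ..
    qed
    have bi: "integrable ?U (\<lambda>\<rho>. cov \<rho> * of_bool (v + \<rho> \<in> ?L))" for v
      by (rule Bochner_Integration.integrable_bound[OF int]) auto
    have "(\<Sum>v\<in>?L. \<Sum>w\<in>?L. cov (w - v)) = (\<integral>\<rho>. (\<Sum>v\<in>?L. cov \<rho> * of_bool (v + \<rho> \<in> ?L)) \<partial>?U)"
      unfolding one by (rule Bochner_Integration.integral_sum[symmetric]) (rule bi)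
    also have "\<dots> = (\<integral>\<rho>. cov \<rho> * real (card {v \<in> ?L. v + \<rho> \<in> ?L}) \<partial>?U)"
      using fin by (simp add: sum_distrib_left[symmetric] of_bool_def sum.If_cases Int_def)
    finally show ?thesis unfolding box_variance by (simp add: mult.assoc[symmetric])
  qed
  have B: "(\<lambda>n. \<integral>\<rho>. cov \<rho> * ?a n \<rho> \<partial>?U) \<longlonglongrightarrow> (\<integral>\<rho>. cov \<rho> \<partial>?U)"
  proof (rule integral_dominated_convergence[where w = "\<lambda>\<rho>. \<bar>cov \<rho>\<bar>"])
    show "integrable ?U (\<lambda>\<rho>. \<bar>cov \<rho>\<bar>)" using int by simp
    show "AE \<rho> in ?U. (\<lambda>n. cov \<rho> * ?a n \<rho>) \<longlonglongrightarrow> cov \<rho>"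
      using tendsto_mult[OF tendsto_const overlap_fraction_tendsto] by auto
    fix n
    have "?a n \<rho> \<le> 1" for \<rho>
    proof -
      have "card {v \<in> lattice_box n. v + \<rho> \<in> lattice_box n} \<le> n ^ CARD('d)" for \<rho> :: "int ^ 'd"
        unfolding lattice_box_card[of n, where 'd = 'd, THEN conjunct2, symmetric]
        by (rule card_mono) (use lattice_box_card in auto)
      then have "real (card {v \<in> lattice_box n. v + \<rho> \<in> lattice_box n}) \<le> real n ^ CARD('d)"
        by (metis of_nat_mono of_nat_power)
      then show ?thesis by (auto intro: divide_le_eq_1_pos[THEN iffD2] simp: divide_le_eq_1)
    qed
    then have "norm (cov \<rho> * ?a n \<rho>) \<le> \<bar>cov \<rho>\<bar>" for \<rho>
      using mult_left_mono[of "?a n \<rho>" 1 "\<bar>cov \<rho>\<bar>"] by (simp add: abs_mult)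
    then show "AE \<rho> in ?U. norm (cov \<rho> * ?a n \<rho>) \<le> \<bar>cov \<rho>\<bar>" by (rule AE_I2)
  qed auto
  have C: "(\<integral>\<rho>. cov \<rho> \<partial>?U) = limit_variance TYPE('d)"
  proof -
    have "Infinite_Set_Sum.abs_summable_on cov (UNIV :: (int ^ 'd) set)"
      unfolding Infinite_Set_Sum.abs_summable_on_def by (rule int)
    from infsetsum_infsum[OF this] show ?thesis
      unfolding limit_variance_def infsetsum_def .
  qed
  show ?thesis unfolding A using B unfolding C .
qed

section \<open>Positivity of the limiting variance\<close>

definition well_founded_clocks :: "((int ^ 'd) set \<Rightarrow> real) \<Rightarrow> bool" where
  "well_founded_clocks x \<longleftrightarrow> (\<forall>e\<in>lattice_edges. \<exists>k. \<not> descends conflicts k e x)"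

lemma well_founded_depends: "depends_on lattice_edges well_founded_clocks"
  unfolding depends_on_def
proof (intro allI impI)
  fix x y :: "'a clocks" assume xy: "\<forall>e\<in>lattice_edges. x e = y e"
  note rules_cong[OF conflicts_subset xy]
  then show "well_founded_clocks x = well_founded_clocks y" unfolding well_founded_clocks_def by simp
qed

lemma countable_lattice: "countable (UNIV :: (int ^ 'd) set)"
proof -
  have "(UNIV :: (int ^ 'd) set) = (\<Union>n. cube n 0)" using in_some_cube by blast
  moreover have "countable (\<Union>n. cube n (0 :: int ^ 'd))"
    by (rule countable_UN) (auto intro: countable_finite card_cube[THEN conjunct1])
  ultimately show ?thesis by simp
qed

text \<open>
  Otherwise some edge starts descents of every length, the probability of which tends to 0;
  there are only countably many sites.
\<close>

lemma AE_well_founded: "AE x in (law :: ((int ^ 'd) set \<Rightarrow> real) measure). well_founded_clocks x"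
proof -
  interpret prob_space "law :: 'd clocks measure" by (rule prob_space_iidU)
  have "AE x in law. \<exists>k. \<not> long_descent k v x" for v :: "int ^ 'd"
  proof -
    let ?A = "{x \<in> space law. \<forall>k. long_descent k v x}"
    have A: "?A \<in> events" by measurable
    have "prob ?A \<le> 0"
    proof (rule tendsto_lowerbound[where f = "\<lambda>k. descent_const TYPE('d) / 2 ^ k"])
      show "(\<lambda>k. descent_const TYPE('d) / 2 ^ k) \<longlonglongrightarrow> 0"
        by (rule LIMSEQ_divide_realpow_zero) simp
      show "\<forall>\<^sub>F k in sequentially. prob ?A \<le> descent_const TYPE('d) / 2 ^ k"
      proof (rule always_eventually, rule allI)
        fix k
        have "prob ?A \<le> prob {x \<in> space law. long_descent k v x}"
          by (rule finite_measure_mono) auto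
        then show "prob ?A \<le> descent_const TYPE('d) / 2 ^ k" using long_descent_prob[of k v] by linarith
      qed
    qed simp
    then have "prob ?A = 0" using measure_nonneg[of law ?A] by linarith
    then show ?thesis
      using A by (intro AE_I[of _ _ ?A]) (auto simp: emeasure_eq_measure)
  qed
  then have "AE x in law. \<forall>v\<in>(UNIV :: (int ^ 'd) set). \<exists>k. \<not> long_descent k v x"
    by (subst AE_ball_countable[OF countable_lattice]) auto
  then show ?thesis
  proof (eventually_elim, unfold well_founded_clocks_def, intro ballI)
    fix x :: "'d clocks" and e :: "(int ^ 'd) set" assume *: "\<forall>v\<in>UNIV. \<exists>k. \<not> long_descent k v x" and e: "e \<in> lattice_edges"
    from e obtain v where "e \<in> edges_at v" unfolding edges_at_def by (auto elim: lattice_edgeE)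
    with * show "\<exists>k. \<not> descends conflicts k e x" unfolding long_descent_def by blast
  qed
qed

lemma AE_well_founded_reindex:
  fixes \<pi> :: "(int ^ 'd) set \<Rightarrow> (int ^ 'd) set"
  assumes "bij_betw \<pi> lattice_edges (lattice_edges :: (int ^ 'd) set set)"
  shows "AE x in (law :: ((int ^ 'd) set \<Rightarrow> real) measure). well_founded_clocks (x \<circ> \<pi>)"
proof -
  have "AE x in distr law (law :: 'd clocks measure) (\<lambda>x. \<lambda>e\<in>lattice_edges. x (\<pi> e)). well_founded_clocks x"
    unfolding reindex_distr[OF assms] by (rule AE_well_founded)
  from AE_distrD[OF reindex_measurable[OF assms] this]
  have "AE x in law. well_founded_clocks (\<lambda>e\<in>lattice_edges. x (\<pi> e) :: real)" .
  moreover have "well_founded_clocks (\<lambda>e\<in>lattice_edges. x (\<pi> e)) = well_founded_clocks (x \<circ> \<pi>)" for x :: "'d clocks"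
    by (rule depends_onD[OF well_founded_depends]) simp
  ultimately show ?thesis by simp
qed

lemma well_founded_greedy: "well_founded_clocks x \<Longrightarrow> greedy conflicts lattice_edges x (greedy_set conflicts x)"
  unfolding well_founded_clocks_def by (rule greedy_greedy_set) blast

text \<open>
  The variance is bounded below by a local configuration that can be switched without any
  effect elsewhere. Along the axis \<open>i0\<close>, the sites \<open>pt 0\<close>, \<open>pt 1\<close>, \<open>pt 2\<close>, \<open>pt 3\<close> form a path with
  edges \<open>ab\<close>, \<open>bc\<close>, \<open>cd\<close>. The shield is a set of disjoint edges that covers all neighbours of the
  path and avoids the path itself. If the shield edges ring first, they are all accepted, and
  all other edges that touch them, the border, are rejected; the path is then cut off from
  the rest of the lattice. If \<open>bc\<close> rings first among the path edges, the two end sites stay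
  free, but if \<open>ab\<close> rings first, the whole path is covered. Exchanging the clocks of \<open>ab\<close> and
  \<open>bc\<close> thus changes the number of free sites by 2 and leaves all other sites alone.
\<close>

context
  fixes i0 :: "'d :: finite"
begin

definition pt :: "int \<Rightarrow> int ^ 'd" where "pt j = axis i0 j"

definition ab :: "(int ^ 'd) set" where "ab = {pt 0, pt 1}"
definition bc :: "(int ^ 'd) set" where "bc = {pt 1, pt 2}"
definition cd :: "(int ^ 'd) set" where "cd = {pt 2, pt 3}"

definition path_vertices :: "(int ^ 'd) set" where "path_vertices = {pt 0, pt 1, pt 2, pt 3}"

text \<open>
  All shield edges point along \<open>i0\<close>. The edges at \<open>pt (-2)\<close> and \<open>pt 4\<close> close the path at its two
  ends; the others run alongside it, two for each of the remaining directions and signs.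
\<close>

definition shield_starts :: "(int ^ 'd) set" where
  "shield_starts = {pt (- 2), pt 4} \<union> (\<Union>i\<in>- {i0}. {pt 0 + unit i, pt 0 - unit i, pt 2 + unit i, pt 2 - unit i})"

definition shield :: "(int ^ 'd) set set" where
  "shield = (\<lambda>y. {y, y + unit i0}) ` shield_starts"

definition border :: "(int ^ 'd) set set" where
  "border = {e \<in> lattice_edges. e \<notin> shield \<and> e \<inter> \<Union>shield \<noteq> {}}"

lemma pt_component: "pt j $ i = (if i = i0 then j else 0)"
  unfolding pt_def axis_def by simp

lemma pt_add: "pt j + unit i0 = pt (j + 1)"
  by (simp add: vec_eq_iff pt_component axis_def)

lemma pt_eq_iff: "pt j = pt k \<longleftrightarrow> j = k"
  by (metis pt_component)

lemma edges_lattice: "ab \<in> lattice_edges" "bc \<in> lattice_edges" "cd \<in> lattice_edges"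
  unfolding ab_def bc_def cd_def
  using lattice_edgeI[of "pt 0" i0] lattice_edgeI[of "pt 1" i0] lattice_edgeI[of "pt 2" i0] by (simp_all add: pt_add)

lemma edges_distinct: "ab \<noteq> bc" "bc \<noteq> cd" "ab \<noteq> cd" "bc \<noteq> ab" "cd \<noteq> bc" "cd \<noteq> ab"
  unfolding ab_def bc_def cd_def by (auto simp: doubleton_eq_iff pt_eq_iff)

lemma unit_component: "i \<noteq> i0 \<Longrightarrow> unit i $ i0 = 0" "unit i0 $ i0 = (1 :: int)"
  by (simp_all add: axis_def)

lemma shield_starts_even: "y \<in> shield_starts \<Longrightarrow> even (y $ i0)"
proof -
  assume "y \<in> shield_starts"
  then consider "y = pt (- 2)" | "y = pt 4"
    | i k where "i \<noteq> i0" "k = 0 \<or> k = 2" "y = pt k + unit i \<or> y = pt k - unit i"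
    unfolding shield_starts_def by blast
  then show ?thesis by cases (auto simp: pt_component unit_component)
qed

text \<open>
  Every shield edge starts at an even coordinate and ends at an odd one, so two of them can
  share a site only if they start at the same site.
\<close>

lemma shield_disjoint:
  assumes "e \<in> shield" "f \<in> shield" "e \<inter> f \<noteq> {}"
  shows "e = f"
proof -
  obtain y z where y: "y \<in> shield_starts" "e = {y, y + unit i0}" and z: "z \<in> shield_starts" "f = {z, z + unit i0}"
    using assms(1,2) unfolding shield_def by auto
  from assms(3) y(2) z(2) consider "y = z" | "y = z + unit i0" | "z = y + unit i0" by auto
  then show ?thesis
  proof cases
    case 2 then have "y $ i0 = z $ i0 + 1" by (simp add: axis_def)
    with shield_starts_even[OF y(1)] shield_starts_even[OF z(1)] show ?thesis by simp
  next
    case 3 then have "z $ i0 = y $ i0 + 1" by (simp add: axis_def)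
    with shield_starts_even[OF y(1)] shield_starts_even[OF z(1)] show ?thesis by simp
  qed (simp add: y z)
qed

lemma shield_lattice: "shield \<subseteq> lattice_edges"
  unfolding shield_def by auto

lemma not_shield_start: "pt 0 \<notin> shield_starts" "pt 2 \<notin> shield_starts"
proof -
  have "pt j \<noteq> pt k + unit i" "pt j \<noteq> pt k - unit i" if "i \<noteq> i0" for i j k
  proof -
    have "(pt k + unit i) $ i = 1" "(pt k - unit i) $ i = - 1" "pt j $ i = 0"
      using that by (simp_all add: pt_component axis_def)
    then show "pt j \<noteq> pt k + unit i" "pt j \<noteq> pt k - unit i" by fastforce+
  qed
  then show "pt 0 \<notin> shield_starts" "pt 2 \<notin> shield_starts"
    unfolding shield_starts_def by (auto simp: pt_eq_iff)
qed

lemma path_shield_disjoint: "path_vertices \<inter> \<Union>shield = {}"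
proof -
  have "pt j \<noteq> y" "pt j \<noteq> y + unit i0" if "j \<in> {0, 1, 2, 3}" "y \<in> shield_starts" for j y
  proof -
    have ev: "even (y $ i0)" by (rule shield_starts_even[OF that(2)])
    show "pt j \<noteq> y"
      using that not_shield_start ev by (auto simp: pt_component)
    show "pt j \<noteq> y + unit i0"
    proof
      assume eq: "pt j = y + unit i0"
      then have "y = pt (j - 1)" using pt_add[of "j - 1"] by simp
      moreover from this ev have "even (j - 1)" by (simp add: pt_component)
      ultimately show False using that not_shield_start by auto
    qed
  qed
  then show ?thesis unfolding path_vertices_def shield_def by auto
qed

lemma touching_path:
  assumes e: "e \<in> lattice_edges" and meets: "e \<inter> path_vertices \<noteq> {}"
  shows "e \<in> {ab, bc, cd} \<or> e \<in> border"
proof (rule disjCI)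
  assume nb: "e \<notin> border"
  obtain j where j: "pt j \<in> e" "j \<in> {0, 1, 2, 3}" using meets unfolding path_vertices_def by auto
  then have "e \<notin> shield" using path_shield_disjoint unfolding path_vertices_def by auto
  with nb e have no: "e \<inter> \<Union>shield = {}" unfolding border_def by auto
  have V: "y \<in> shield_starts \<Longrightarrow> y \<notin> e \<and> y + unit i0 \<notin> e" for y using no unfolding shield_def by auto
  have out: "pt (- 1) \<notin> e" "pt 4 \<notin> e"
    using V[of "pt (- 2)"] V[of "pt 4"] pt_add[of "- 2"] unfolding shield_starts_def by auto
  have side: "pt j + unit i \<notin> e" "pt j - unit i \<notin> e" if "i \<noteq> i0" for i
  proof -
    have s: "pt 0 + unit i \<in> shield_starts" "pt 0 - unit i \<in> shield_starts" "pt 2 + unit i \<in> shield_starts" "pt 2 - unit i \<in> shield_starts"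
      using that unfolding shield_starts_def by auto
    have "pt 0 + unit i + unit i0 = pt 1 + unit i" "pt 0 - unit i + unit i0 = pt 1 - unit i"
       "pt 2 + unit i + unit i0 = pt 3 + unit i" "pt 2 - unit i + unit i0 = pt 3 - unit i"
      using pt_add[of 0] pt_add[of 2] by (simp_all add: algebra_simps)
    with V[OF s(1)] V[OF s(2)] V[OF s(3)] V[OF s(4)] j(2)
    show "pt j + unit i \<notin> e" "pt j - unit i \<notin> e" by auto
  qed
  have m: "pt j - unit i0 = pt (j - 1)" for j using pt_add[of "j - 1"] by (simp add: algebra_simps)
  from e j(1) show "e \<in> {ab, bc, cd}"
  proof (cases rule: lattice_edge_atE)
    case (1 i)
    with side have "i = i0" by blast
    with 1 have "e = {pt j, pt (j + 1)}" by (simp add: pt_add)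
    with j(2) out show ?thesis unfolding ab_def bc_def cd_def by auto
  next
    case (2 i)
    with side have "i = i0" by blast
    with 2 have "e = {pt (j - 1), pt j}" by (auto simp: m)
    with j(2) out show ?thesis unfolding ab_def bc_def cd_def by auto
  qed
qed

lemma path_edge_subset: "e \<in> {ab, bc, cd} \<Longrightarrow> e \<subseteq> path_vertices \<and> e \<noteq> {}"
  unfolding path_vertices_def ab_def bc_def cd_def by auto

lemma path_edges_disjoint: "{ab, bc, cd} \<inter> (shield \<union> border) = {}"
proof -
  have "e \<notin> shield \<union> border" if "e \<in> {ab, bc, cd}" for e
  proof
    have no: "e \<inter> \<Union>shield = {}" "e \<noteq> {}" using path_edge_subset[OF that] path_shield_disjoint by auto
    assume "e \<in> shield \<union> border"
    with no show False unfolding border_def by auto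
  qed
  then show ?thesis by blast
qed

definition pattern :: "(int ^ 'd) set \<Rightarrow> ((int ^ 'd) set \<Rightarrow> real) \<Rightarrow> bool" where
  "pattern f x \<longleftrightarrow> (\<forall>e\<in>shield. x e \<in> {0<..<1/3}) \<and> (\<forall>e\<in>border. x e \<in> {1/3<..<1}) \<and>
     x f \<in> {1/3<..<2/3} \<and> (\<forall>e\<in>{ab, bc, cd} - {f}. x e \<in> {2/3<..<1})"

lemma shield_accepted:
  assumes A: "greedy conflicts lattice_edges x A" and p: "pattern f x" and e: "e \<in> shield"
  shows "e \<in> A"
proof -
  have "\<not> x g < x e" if "g \<in> conflicts e" for g
  proof -
    have "g \<notin> shield" using shield_disjoint[OF _ e] that unfolding conflicts_def by auto
    then have "g \<in> border" using that e unfolding conflicts_def border_def by blast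
    with p e show ?thesis unfolding pattern_def by fastforce
  qed
  then show ?thesis using A e shield_lattice unfolding greedy_def by blast
qed

lemma border_rejected:
  assumes A: "greedy conflicts lattice_edges x A" and p: "pattern f x" and e: "e \<in> border"
  shows "e \<notin> A"
proof -
  obtain g where g: "g \<in> shield" "g \<inter> e \<noteq> {}" using e unfolding border_def by auto
  then have "g \<in> conflicts e" using e shield_lattice unfolding conflicts_def border_def by auto
  moreover have "x g < x e" using p g e unfolding pattern_def by fastforce
  moreover have "g \<in> A" by (rule shield_accepted[OF A p g(1)])
  ultimately show ?thesis using A e unfolding greedy_def border_def by blast
qed

text \<open>
  An edge that meets the path is a path edge or a border edge, and border edges are rejected;
  only the order of the three path clocks matters.
\<close>

lemma path_edge_iff:
  assumes A: "greedy conflicts lattice_edges x A" and p: "pattern f x" and e: "e \<in> {ab, bc, cd}"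
  shows "e \<in> A \<longleftrightarrow> (\<forall>g\<in>{ab, bc, cd}. g \<noteq> e \<and> g \<inter> e \<noteq> {} \<and> x g < x e \<longrightarrow> g \<notin> A)"
proof -
  have eL: "e \<in> lattice_edges" using e edges_lattice by auto
  have "g \<in> {ab, bc, cd} \<or> g \<notin> A" if "g \<in> conflicts e" for g
  proof -
    have "e \<subseteq> path_vertices" using path_edge_subset[OF e] by blast
    with that have "g \<in> lattice_edges" "g \<inter> path_vertices \<noteq> {}" unfolding conflicts_def by auto
    then show ?thesis using touching_path border_rejected[OF A p] by blast
  qed
  then have in_path: "g \<in> {ab, bc, cd}" if "g \<in> conflicts e" "g \<in> A" for g using that by blast
  have conf: "g \<in> conflicts e \<longleftrightarrow> g \<noteq> e \<and> g \<inter> e \<noteq> {}" if "g \<in> {ab, bc, cd}" for g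
    using that edges_lattice unfolding conflicts_def by auto
  have "e \<in> A \<longleftrightarrow> (\<forall>g\<in>conflicts e. x g < x e \<longrightarrow> g \<notin> A)"
    using A eL unfolding greedy_def by blast
  also have "\<dots> \<longleftrightarrow> (\<forall>g\<in>{ab, bc, cd}. g \<in> conflicts e \<and> x g < x e \<longrightarrow> g \<notin> A)"
    using in_path by blast
  also have "\<dots> \<longleftrightarrow> (\<forall>g\<in>{ab, bc, cd}. g \<noteq> e \<and> g \<inter> e \<noteq> {} \<and> x g < x e \<longrightarrow> g \<notin> A)"
    using conf by (intro ball_cong refl) simp
  finally show ?thesis .
qed

lemma pattern_less:
  assumes "pattern f x" "e \<in> {ab, bc, cd}" "e \<noteq> f"
  shows "x f < x e"
proof -
  have "x e \<in> {2/3<..<1}" "x f \<in> {1/3<..<2/3}" using assms unfolding pattern_def by blast+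
  then show ?thesis by auto
qed

lemma pattern_bc:
  assumes A: "greedy conflicts lattice_edges x A" and p: "pattern bc x"
  shows "ab \<notin> A"
proof -
  have lt: "x bc < x ab" "x bc < x cd"
    by (rule pattern_less[OF p]; simp add: edges_distinct)+
  have "bc \<in> A" using path_edge_iff[OF A p, of bc] lt by force
  moreover have "bc \<inter> ab \<noteq> {}" unfolding ab_def bc_def by auto
  ultimately show ?thesis using path_edge_iff[OF A p, of ab] lt edges_distinct by blast
qed

lemma pattern_ab:
  assumes A: "greedy conflicts lattice_edges x A" and p: "pattern ab x"
  shows "ab \<in> A" "cd \<in> A"
proof -
  have lt: "x ab < x bc" "x ab < x cd"
    by (rule pattern_less[OF p]; simp add: edges_distinct)+
  show ab: "ab \<in> A" using path_edge_iff[OF A p, of ab] lt by force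
  have "ab \<inter> bc \<noteq> {}" unfolding ab_def bc_def by auto
  with ab have "bc \<notin> A" using path_edge_iff[OF A p, of bc] lt edges_distinct by blast
  moreover have "ab \<inter> cd = {}" unfolding ab_def cd_def by (auto simp: pt_eq_iff)
  ultimately show "cd \<in> A" using path_edge_iff[OF A p, of cd] by blast
qed

definition swap :: "(int ^ 'd) set \<Rightarrow> (int ^ 'd) set" where
  "swap e = (if e = ab then bc else if e = bc then ab else e)"

lemma swap_bij: "bij_betw swap lattice_edges lattice_edges"
  by (rule bij_betw_byWitness[where f' = swap]) (simp_all add: swap_def edges_lattice edges_distinct subset_eq)

lemma pattern_swap: "pattern ab (x \<circ> swap) \<longleftrightarrow> pattern bc x"
proof -
  have fix_: "swap e = e" if "e \<in> shield \<union> border" for e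
    using that path_edges_disjoint unfolding swap_def by auto
  have sets: "{ab, bc, cd} - {ab} = {bc, cd}" "{ab, bc, cd} - {bc} = {ab, cd}"
    using edges_distinct by blast+
  have "swap ab = bc" "swap bc = ab" "swap cd = cd" using edges_distinct by (auto simp: swap_def)
  then show ?thesis unfolding pattern_def sets using fix_ by simp
qed

text \<open>
  An edge outside the path, the shield and the border does not meet the path, so all the
  clocks it consults are unchanged by the swap. Shield and border edges have the same
  fate in both configurations. Hence the two greedy sets agree by induction along descents.
\<close>

lemma swap_outside:
  assumes wf: "well_founded_clocks x" and wf': "well_founded_clocks (x \<circ> swap)" and p: "pattern bc x"
    and e: "e \<in> lattice_edges" "e \<notin> {ab, bc, cd}"
  shows "e \<in> greedy_set conflicts x \<longleftrightarrow> e \<in> greedy_set conflicts (x \<circ> swap)"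
proof -
  let ?A = "greedy_set conflicts x" and ?B = "greedy_set conflicts (x \<circ> swap)"
  note A = well_founded_greedy[OF wf] and B = well_founded_greedy[OF wf']
  have p': "pattern ab (x \<circ> swap)" using p by (simp add: pattern_swap)
  have "e \<in> ?A \<longleftrightarrow> e \<in> ?B" if "e \<in> lattice_edges" "e \<notin> {ab, bc, cd}" "\<not> descends conflicts k e x" for k e
    using that
  proof (induction k arbitrary: e)
    case (Suc k)
    consider "e \<in> shield" | "e \<in> border" | "e \<notin> border" "e \<notin> shield" by blast
    then show ?case
    proof cases
      case 1 then show ?thesis using shield_accepted[OF A p] shield_accepted[OF B p'] by blast
    next
      case 2 then show ?thesis using border_rejected[OF A p] border_rejected[OF B p'] by blast
    next
      case 3
      have nK: "e \<inter> path_vertices = {}" using touching_path[of e] 3 Suc.prems by blast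
      have f: "f \<notin> {ab, bc, cd}" if "f \<in> conflicts e" for f
      proof
        assume "f \<in> {ab, bc, cd}"
        then have "f \<subseteq> path_vertices" using path_edge_subset[of f] by blast
        with nK that show False unfolding conflicts_def by auto
      qed
      have s: "(x \<circ> swap) f = x f" if "f \<notin> {ab, bc, cd}" for f using that by (simp add: swap_def)
      have IH: "f \<in> ?A \<longleftrightarrow> f \<in> ?B" if "f \<in> conflicts e" "x f < x e" for f
      proof (rule Suc.IH)
        show "f \<in> lattice_edges" using conflicts_subset that(1) by blast
        show "f \<notin> {ab, bc, cd}" by (rule f[OF that(1)])
        show "\<not> descends conflicts k f x" using Suc.prems(3) that by auto
      qed
      have "e \<in> ?A \<longleftrightarrow> (\<forall>f\<in>conflicts e. x f < x e \<longrightarrow> f \<notin> ?A)" using A Suc.prems(1) unfolding greedy_def by blast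
      also have "\<dots> \<longleftrightarrow> (\<forall>f\<in>conflicts e. (x \<circ> swap) f < (x \<circ> swap) e \<longrightarrow> f \<notin> ?B)"
        using IH s f Suc.prems(2) by (metis (no_types))
      also have "\<dots> \<longleftrightarrow> e \<in> ?B" using B Suc.prems(1) unfolding greedy_def by blast
      finally show ?thesis .
    qed
  qed simp
  with wf e show ?thesis unfolding well_founded_clocks_def by blast
qed

lemma free_swap:
  assumes "well_founded_clocks x" "well_founded_clocks (x \<circ> swap)" "pattern bc x" "w \<notin> path_vertices"
  shows "free w x = free w (x \<circ> swap)"
proof -
  have "e \<notin> {ab, bc, cd}" if "e \<in> edges_at w" for e
    using that assms(4) path_edge_subset[of e] unfolding edges_at_def by blast
  then show ?thesis
    using swap_outside[OF assms(1-3)] unfolding free_def by (auto simp: edges_at_lattice)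
qed

lemma free_origin:
  assumes "well_founded_clocks x" "pattern bc x"
  shows "free 0 x = 1"
proof -
  note A = well_founded_greedy[OF assms(1)]
  have z: "0 = pt 0" by (simp add: vec_eq_iff pt_component)
  have "e \<notin> greedy_set conflicts x" if "e \<in> edges_at 0" for e
  proof -
    have "e \<in> lattice_edges" "pt 0 \<in> e" using that z unfolding edges_at_def by auto
    then have "e \<in> {ab, bc, cd} \<or> e \<in> border" using touching_path[of e] unfolding path_vertices_def by auto
    moreover have "pt 0 \<notin> bc" "pt 0 \<notin> cd" unfolding bc_def cd_def by (auto simp: pt_eq_iff)
    ultimately show ?thesis using \<open>pt 0 \<in> e\<close> pattern_bc[OF A assms(2)] border_rejected[OF A assms(2)] by auto
  qed
  then show ?thesis unfolding free_def by simp
qed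

lemma free_path:
  assumes "well_founded_clocks x" "pattern ab x" "w \<in> path_vertices"
  shows "free w x = 0"
proof -
  note A = well_founded_greedy[OF assms(1)]
  have "w \<in> ab \<or> w \<in> cd" using assms(3) unfolding path_vertices_def ab_def cd_def by auto
  then show ?thesis
    using pattern_ab[OF A assms(2)] edges_lattice unfolding free_def edges_at_def by auto
qed

lemma finite_shield: "finite shield"
  unfolding shield_def shield_starts_def by simp

lemma finite_border: "finite border"
proof -
  have "finite (\<Union>shield)"
    using finite_shield unfolding shield_def by auto
  then have "finite (\<Union>v\<in>\<Union>shield. edges_at v)" by (rule finite_UN_I) simp
  moreover have "border \<subseteq> (\<Union>v\<in>\<Union>shield. edges_at v)"
    unfolding border_def edges_at_def by blast
  ultimately show ?thesis by (rule rev_finite_subset)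
qed

definition region :: "(int ^ 'd) set set" where "region = shield \<union> border \<union> {ab, bc, cd}"

lemma region_lattice: "region \<subseteq> lattice_edges"
  using shield_lattice edges_lattice unfolding region_def border_def by auto

lemma finite_region: "finite region"
  using finite_shield finite_border unfolding region_def by simp

lemma pattern_depends:
  assumes "f \<in> {ab, bc, cd}" shows "depends_on region (pattern f)"
  unfolding depends_on_def
proof (intro allI impI)
  fix x y :: "'d clocks" assume *: "\<forall>e\<in>region. x e = y e"
  have "x e = y e" if "e \<in> shield \<or> e \<in> border \<or> e \<in> {ab, bc, cd}" for e
    using * that unfolding region_def by blast
  with assms show "pattern f x = pattern f y"
    unfolding pattern_def by (intro conj_cong ball_cong refl) simp_all
qed

text \<open>
  Rewriting the pattern as a product of open intervals gives its measurability and the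
  positivity of its probability at once.
\<close>

definition lower :: "(int ^ 'd) set \<Rightarrow> (int ^ 'd) set \<Rightarrow> real" where
  "lower f e = (if e \<in> shield then 0 else if e \<in> border then 1/3 else if e = f then 1/3 else 2/3)"

definition upper :: "(int ^ 'd) set \<Rightarrow> (int ^ 'd) set \<Rightarrow> real" where
  "upper f e = (if e \<in> shield then 1/3 else if e \<in> border then 1 else if e = f then 2/3 else 1)"

lemma pattern_iff_intervals:
  assumes "f \<in> {ab, bc, cd}"
  shows "pattern f x \<longleftrightarrow> (\<forall>e\<in>region. x e \<in> {lower f e<..<upper f e})"
proof -
  have nb: "e \<notin> shield" if "e \<in> border" for e using that unfolding border_def by auto
  have np: "e \<notin> shield" "e \<notin> border" if "e \<in> {ab, bc, cd}" for e
    using that path_edges_disjoint by blast+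
  have s: "lower f e = 0" "upper f e = 1/3" if "e \<in> shield" for e using that unfolding lower_def upper_def by auto
  have b: "lower f e = 1/3" "upper f e = 1" if "e \<in> border" for e using that nb unfolding lower_def upper_def by auto
  have m: "lower f f = 1/3" "upper f f = 2/3" using np[OF assms] unfolding lower_def upper_def by auto
  have o: "lower f e = 2/3" "upper f e = 1" if "e \<in> {ab, bc, cd} - {f}" for e
    using np that unfolding lower_def upper_def by auto
  have R: "region = shield \<union> border \<union> {f} \<union> ({ab, bc, cd} - {f})" using assms unfolding region_def by blast
  have "(\<forall>e\<in>shield. x e \<in> {0<..<1/3}) \<longleftrightarrow> (\<forall>e\<in>shield. x e \<in> {lower f e<..<upper f e})"
    by (rule ball_cong[OF refl]) (simp only: s)
  moreover have "(\<forall>e\<in>border. x e \<in> {1/3<..<1}) \<longleftrightarrow> (\<forall>e\<in>border. x e \<in> {lower f e<..<upper f e})"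
    by (rule ball_cong[OF refl]) (simp only: b)
  moreover have "x f \<in> {1/3<..<2/3} \<longleftrightarrow> (\<forall>e\<in>{f}. x e \<in> {lower f e<..<upper f e})"
    by (simp add: m)
  moreover have "(\<forall>e\<in>{ab, bc, cd} - {f}. x e \<in> {2/3<..<1}) \<longleftrightarrow> (\<forall>e\<in>{ab, bc, cd} - {f}. x e \<in> {lower f e<..<upper f e})"
    by (rule ball_cong[OF refl]) (simp only: o)
  ultimately show ?thesis unfolding pattern_def R ball_Un by (simp only: conj_assoc)
qed

lemma pattern_measurable [measurable]:
  assumes "f \<in> {ab, bc, cd}" shows "Measurable.pred law (pattern f)"
  using cylinder_prob(1)[OF region_lattice finite_region, of "lower f" "upper f"]
  unfolding pattern_iff_intervals[OF assms] pred_def by (auto simp: lower_def upper_def)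

lemma pattern_prob_pos:
  assumes "f \<in> {ab, bc, cd}"
  shows "0 < measure law {x \<in> space law. pattern f x}"
  unfolding pattern_iff_intervals[OF assms]
  by (rule cylinder_prob(2)[OF region_lattice finite_region]) (auto simp: lower_def upper_def)

text \<open>
  The swap exchanges the two patterns, so \<open>toggle\<close> is odd under a symmetry of the law. It is
  therefore centred, and orthogonal to the state of every site that the swap does not affect.
\<close>

definition toggle :: "((int ^ 'd) set \<Rightarrow> real) \<Rightarrow> real" where
  "toggle x = of_bool (pattern bc x) - of_bool (pattern ab x)"

lemma toggle_measurable [measurable]: "toggle \<in> borel_measurable law"
  unfolding toggle_def by measurable

lemma toggle_bound: "\<bar>toggle x\<bar> \<le> 1"
  unfolding toggle_def by auto

lemma toggle_depends: "depends_on region toggle"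
  unfolding toggle_def
  by (rule depends_on_compose2[where h = "\<lambda>a b. of_bool a - of_bool b"]) (auto intro: pattern_depends)

definition pattern_prob :: real where
  "pattern_prob = measure law {x \<in> space law. pattern bc x}"

lemma pattern_integral:
  "f \<in> {ab, bc, cd} \<Longrightarrow> integrable law (\<lambda>x. of_bool (pattern f x) :: real)"
  "(\<integral>x. of_bool (pattern bc x) \<partial>law) = pattern_prob"
proof -
  interpret prob_space "law :: 'd clocks measure" by (rule prob_space_iidU)
  show "integrable law (\<lambda>x. of_bool (pattern f x) :: real)" if f: "f \<in> {ab, bc, cd}"
    using pattern_measurable[OF f] by (intro integrable_bounded[where C = 1]) auto
  have "(\<integral>x. of_bool (pattern bc x) \<partial>law) = (\<integral>x. indicator {x \<in> space law. pattern bc x} x \<partial>law)"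
    by (intro Bochner_Integration.integral_cong refl) (simp add: indicator_def)
  also have "\<dots> = pattern_prob"
    unfolding pattern_prob_def using pattern_measurable[of bc] by simp
  finally show "(\<integral>x. of_bool (pattern bc x) \<partial>law) = pattern_prob" .
qed

lemma toggle_mean: "(\<integral>x. toggle x \<partial>law) = 0"
proof -
  have "(\<integral>x. of_bool (pattern bc x) \<partial>law) = (\<integral>x. (of_bool (pattern ab (x \<circ> swap)) :: real) \<partial>law)"
    by (simp add: pattern_swap)
  also have "\<dots> = (\<integral>x. of_bool (pattern ab x) \<partial>law)"
  proof (rule reindex_integral(2)[OF swap_bij])
    show "(\<lambda>x. of_bool (pattern ab x) :: real) \<in> borel_measurable law"
      using pattern_measurable[of ab] by measurable
    show "depends_on lattice_edges (\<lambda>x. of_bool (pattern ab x) :: real)"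
      by (rule depends_on_compose[OF depends_on_mono[OF pattern_depends region_lattice]]) simp
  qed
  finally show ?thesis unfolding toggle_def using pattern_integral(1) by simp
qed

text \<open>
  Off the path the two patterns contribute equally and cancel. On the path, the pattern with
  \<open>ab\<close> first leaves no site free, so only the nonnegative contribution of the other one remains.
\<close>

lemma free_toggle:
  shows "0 \<le> (\<integral>x. free w x * toggle x \<partial>law)"
    and "(\<integral>x. free 0 x * toggle x \<partial>law) = pattern_prob"
proof -
  interpret prob_space "law :: 'd clocks measure" by (rule prob_space_iidU)
  note [measurable] = pattern_measurable[of ab, simplified] pattern_measurable[of bc, simplified]
  have int: "integrable law (\<lambda>x. free w x * of_bool (pattern f x))" if "f \<in> {ab, bc, cd}" for w f
    using that pattern_measurable[of f] by (intro integrable_bounded[where C = 1]) (auto simp: free_bound abs_of_nonneg)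
  have split: "(\<integral>x. free w x * toggle x \<partial>law) =
     (\<integral>x. free w x * of_bool (pattern bc x) \<partial>law) - (\<integral>x. free w x * of_bool (pattern ab x) \<partial>law)" for w
    unfolding toggle_def right_diff_distrib using int by (intro Bochner_Integration.integral_diff) auto
  have path: "(\<integral>x. free w x * of_bool (pattern ab x) \<partial>law) = 0" if "w \<in> path_vertices" for w
  proof -
    have "(\<integral>x. free w x * of_bool (pattern ab x) \<partial>law) = (\<integral>x. 0 \<partial>(law :: 'd clocks measure))"
    proof (rule integral_cong_AE)
      show "AE x in law. free w x * of_bool (pattern ab x) = 0"
        using AE_well_founded by eventually_elim (use free_path that in \<open>auto simp: of_bool_def\<close>)
    qed measurable
    then show ?thesis by simp
  qed
  have off: "(\<integral>x. free w x * of_bool (pattern ab x) \<partial>law) = (\<integral>x. free w x * of_bool (pattern bc x) \<partial>law)"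
    if "w \<notin> path_vertices" for w
  proof -
    let ?F = "\<lambda>x. free w x * of_bool (pattern ab x)"
    have F: "?F \<in> borel_measurable law" by measurable
    have dep: "depends_on lattice_edges ?F"
      by (intro depends_on_compose2[where h = "\<lambda>a b. a * of_bool b"] free_depends
          depends_on_mono[OF pattern_depends region_lattice]) simp
    have "(\<integral>x. ?F x \<partial>law) = (\<integral>x. ?F (x \<circ> swap) \<partial>law)"
      by (rule reindex_integral(2)[OF swap_bij F dep, symmetric])
    also have "\<dots> = (\<integral>x. free w x * of_bool (pattern bc x) \<partial>law)"
    proof (rule integral_cong_AE)
      show "(\<lambda>x. ?F (x \<circ> swap)) \<in> borel_measurable law" by (rule reindex_integral(1)[OF swap_bij F dep])
      show "AE x in law. ?F (x \<circ> swap) = free w x * of_bool (pattern bc x)"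
        using AE_well_founded AE_well_founded_reindex[OF swap_bij]
        by eventually_elim (use free_swap that in \<open>auto simp: pattern_swap of_bool_def\<close>)
    qed measurable
    finally show ?thesis .
  qed
  have "0 \<le> (\<integral>x. free w x * of_bool (pattern bc x) \<partial>law)"
    by (intro Bochner_Integration.integral_nonneg) (simp add: free_bound)
  then show "0 \<le> (\<integral>x. free w x * toggle x \<partial>law)"
    unfolding split using path[of w] off[of w] by (cases "w \<in> path_vertices") auto
  have "0 = pt 0" by (simp add: vec_eq_iff pt_component)
  then have "0 \<in> path_vertices" unfolding path_vertices_def by simp
  moreover have "(\<integral>x. free 0 x * of_bool (pattern bc x) \<partial>law) = (\<integral>x. of_bool (pattern bc x) \<partial>law)"
  proof (rule integral_cong_AE)
    show "AE x in law. free 0 x * of_bool (pattern bc x) = of_bool (pattern bc x)"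
      using AE_well_founded by eventually_elim (use free_origin in \<open>auto simp: of_bool_def\<close>)
  qed measurable
  ultimately show "(\<integral>x. free 0 x * toggle x \<partial>law) = pattern_prob"
    unfolding split using path[of 0] pattern_integral(2) by simp
qed

lemma shifted_toggle_properties:
  fixes v w :: "int ^ 'd"
  shows "(\<lambda>x. toggle (x \<circ> shift v)) \<in> borel_measurable law"
    and "(\<integral>x. toggle (x \<circ> shift v) \<partial>law) = 0"
    and "0 \<le> (\<integral>x. free w x * toggle (x \<circ> shift v) \<partial>law)"
    and "(\<integral>x. free v x * toggle (x \<circ> shift v) \<partial>law) = pattern_prob"
proof -
  have dep: "depends_on lattice_edges toggle" by (rule depends_on_mono[OF toggle_depends region_lattice])
  show "(\<lambda>x. toggle (x \<circ> shift v)) \<in> borel_measurable law"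
    by (rule reindex_integral(1)[OF bij_shift toggle_measurable dep])
  show "(\<integral>x. toggle (x \<circ> shift v) \<partial>law) = 0"
    using reindex_integral(2)[OF bij_shift toggle_measurable dep] toggle_mean by simp
  have eq: "(\<integral>x. free w x * toggle (x \<circ> shift v) \<partial>law) = (\<integral>x. free (w - v) x * toggle x \<partial>law)" for w
  proof -
    let ?F = "\<lambda>x. free (w - v) x * toggle x"
    have "(\<integral>x. ?F (x \<circ> shift v) \<partial>law) = (\<integral>x. ?F x \<partial>law)"
      by (rule reindex_integral(2)[OF bij_shift]) (measurable, intro depends_on_compose2[where h = "(*)"] free_depends dep)
    then show ?thesis by (simp add: free_shift)
  qed
  show "0 \<le> (\<integral>x. free w x * toggle (x \<circ> shift v) \<partial>law)" unfolding eq by (rule free_toggle)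
  show "(\<integral>x. free v x * toggle (x \<circ> shift v) \<partial>law) = pattern_prob" unfolding eq using free_toggle(2) by simp
qed

lemma region_in_ball: "\<exists>r. region \<subseteq> edge_ball r 0"
proof -
  have "\<exists>r. e \<in> edge_ball r 0" if e: "e \<in> region" for e
  proof -
    have eL: "e \<in> lattice_edges" using e region_lattice by auto
    then obtain v i where "e = {v, v + unit i}" by (rule lattice_edgeE)
    then have "e \<in> edges_at v" using eL unfolding edges_at_def by simp
    then have "e \<in> edge_ball 1 v" using edge_subset_cube eL unfolding edge_ball_def by auto
    moreover obtain n where "v \<in> cube n 0" using in_some_cube by blast
    ultimately show ?thesis using edge_ball_mono by blast
  qed
  then obtain r where r: "\<And>e. e \<in> region \<Longrightarrow> e \<in> edge_ball (r e) 0" by metis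
  have "edge_ball (r e) 0 \<subseteq> edge_ball (\<Sum>e\<in>region. r e) (0 :: int ^ 'd)" if "e \<in> region" for e
    unfolding edge_ball_def using cube_mono[of "r e" "\<Sum>e\<in>region. r e" "0 :: int ^ 'd"] member_le_sum[OF that _ finite_region, of r] by auto
  then show ?thesis using r by blast
qed

text \<open>
  Translates of \<open>toggle\<close> by distant vectors depend on disjoint sets of clocks, so each
  translate is correlated with boundedly many others.
\<close>

lemma toggle_sum_second_moment:
  obtains Q :: real where "0 < Q"
    "\<And>n. (\<integral>x. (\<Sum>v\<in>lattice_box n. toggle (x \<circ> shift v))\<^sup>2 \<partial>law) \<le> Q * real n ^ CARD('d)"
proof -
  interpret prob_space "law :: 'd clocks measure" by (rule prob_space_iidU)
  obtain r where r: "region \<subseteq> edge_ball r 0" using region_in_ball by blast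
  let ?T = "\<lambda>v x. toggle (x \<circ> shift v)"
  note [measurable] = shifted_toggle_properties(1)
  have int: "integrable law (?T v)" for v
    by (rule integrable_bounded[where C = 1]) (auto simp: toggle_bound)
  have int2: "integrable law (\<lambda>x. ?T v x * ?T w x)" for v w
    by (rule integrable_bounded[where C = 1]) (auto simp: toggle_bound abs_mult mult_le_one)
  have dep: "depends_on (edge_ball r v) (?T v)" for v
    unfolding depends_on_def
  proof (intro allI impI depends_onD[OF toggle_depends])
    fix x y :: "'d clocks" and e assume xy: "\<forall>e\<in>edge_ball r v. x e = y e" and e: "e \<in> region"
    have "shift v e \<in> edge_ball r v"
    proof -
      have "e \<in> lattice_edges" "e \<subseteq> cube r 0" using e r unfolding edge_ball_def by auto
      moreover have "u \<in> cube r v" if "u - v \<in> cube r 0" for u using that unfolding cube_def by simp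
      ultimately show ?thesis unfolding edge_ball_def by (auto simp: shift_lattice_edges mem_shift)
    qed
    then show "(x \<circ> shift v) e = (y \<circ> shift v) e" using xy by simp
  qed
  have le: "(\<integral>x. ?T v x * ?T w x \<partial>law) \<le> of_bool (w \<in> cube (r + r) v)" for v w
  proof (cases "w \<in> cube (r + r) v")
    case True
    have "?T v x * ?T w x \<le> 1" for x
    proof -
      have "\<bar>?T v x * ?T w x\<bar> \<le> 1"
        unfolding abs_mult by (intro mult_le_one toggle_bound) auto
      then show ?thesis by linarith
    qed
    then show ?thesis using True int2 by (auto intro!: integral_le_const)
  next
    case False
    have "(\<integral>x. ?T v x * ?T w x \<partial>law) = (\<integral>x. ?T v x \<partial>law) * (\<integral>x. ?T w x \<partial>law)"
      by (rule indep_expectation[OF lattice_edges_nonempty edge_ball_disjoint[OF False] edge_ball_subset edge_ball_subset int dep int dep])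
    then show ?thesis using False by (simp add: shifted_toggle_properties)
  qed
  define Q where "Q = real ((2 * (r + r) + 1) ^ CARD('d))"
  show thesis
  proof (rule that[of Q])
    show "0 < Q" unfolding Q_def by simp
    fix n
    let ?L = "lattice_box n :: (int ^ 'd) set"
    have fin: "finite ?L" "card ?L = n ^ CARD('d)" using lattice_box_card by blast+
    have "(\<integral>x. (\<Sum>v\<in>?L. ?T v x)\<^sup>2 \<partial>law) = (\<integral>x. (\<Sum>v\<in>?L. \<Sum>w\<in>?L. ?T v x * ?T w x) \<partial>law)"
      unfolding power2_eq_square sum_product ..
    also have "\<dots> = (\<Sum>v\<in>?L. \<Sum>w\<in>?L. \<integral>x. ?T v x * ?T w x \<partial>law)" by (simp add: int2)
    also have "\<dots> \<le> (\<Sum>v\<in>?L. \<Sum>w\<in>?L. of_bool (w \<in> cube (r + r) v))"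
      by (intro sum_mono le)
    also have "\<dots> \<le> (\<Sum>v\<in>?L. Q)"
    proof (rule sum_mono)
      fix v
      have "(\<Sum>w\<in>?L. of_bool (w \<in> cube (r + r) v)) = real (card (?L \<inter> cube (r + r) v))"
        using fin by (simp add: of_bool_def sum.If_cases Int_def)
      also have "\<dots> \<le> real (card (cube (r + r) v))"
        using card_cube by (intro of_nat_mono card_mono) auto
      finally show "(\<Sum>w\<in>?L. of_bool (w \<in> cube (r + r) v)) \<le> Q" unfolding Q_def using card_cube[of "r + r" v] by simp
    qed
    also have "\<dots> = Q * real n ^ CARD('d)" using fin by simp
    finally show "(\<integral>x. (\<Sum>v\<in>?L. ?T v x)\<^sup>2 \<partial>law) \<le> Q * real n ^ CARD('d)" .
  qed
qed

text \<open>
  No correlation between a site and a translate is negative, and the site at which the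
  translate is anchored contributes \<open>pattern_prob\<close>. Translates that reach across the boundary
  of the box therefore do no harm.
\<close>

lemma box_sum_toggle:
  "pattern_prob * real n ^ CARD('d) \<le> (\<integral>x. box_sum n x * (\<Sum>v\<in>lattice_box n. toggle (x \<circ> shift v)) \<partial>law)"
proof -
  interpret prob_space "law :: 'd clocks measure" by (rule prob_space_iidU)
  let ?L = "lattice_box n :: (int ^ 'd) set"
  let ?T = "\<lambda>v x. toggle (x \<circ> shift v)"
  define m where "m w = integral\<^sup>L law (free w)" for w :: "int ^ 'd"
  have fin: "finite ?L" "card ?L = n ^ CARD('d)" using lattice_box_card by blast+
  note [measurable] = shifted_toggle_properties(1)
  have int: "integrable law (?T v)" for v
    by (rule integrable_bounded[where C = 1]) (auto simp: toggle_bound)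
  have int2: "integrable law (\<lambda>x. free w x * ?T v x)" for v w
    by (rule integrable_bounded[where C = 1]) (auto simp: toggle_bound abs_mult free_bound intro!: mult_le_one)
  have one: "(\<integral>x. (free w x - m w) * ?T v x \<partial>law) = (\<integral>x. free w x * ?T v x \<partial>law)" for v w
    unfolding left_diff_distrib using int int2 by (simp add: shifted_toggle_properties)
  have int3: "integrable law (\<lambda>x. (free w x - m w) * ?T v x)" for v w
    unfolding left_diff_distrib using int int2 by simp
  have "pattern_prob * real n ^ CARD('d) = (\<Sum>v\<in>?L. \<integral>x. free v x * ?T v x \<partial>law)"
    using fin by (simp add: shifted_toggle_properties)
  also have "\<dots> \<le> (\<Sum>v\<in>?L. \<Sum>w\<in>?L. \<integral>x. free w x * ?T v x \<partial>law)"
    using fin by (intro sum_mono member_le_sum shifted_toggle_properties) auto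
  also have "\<dots> = (\<Sum>w\<in>?L. \<Sum>v\<in>?L. \<integral>x. (free w x - m w) * ?T v x \<partial>law)"
    unfolding one by (rule sum.swap)
  also have "\<dots> = (\<integral>x. (\<Sum>w\<in>?L. \<Sum>v\<in>?L. (free w x - m w) * ?T v x) \<partial>law)"
    using int3 by simp
  also have "\<dots> = (\<integral>x. box_sum n x * (\<Sum>v\<in>?L. ?T v x) \<partial>law)"
    unfolding box_sum_def m_def sum_product ..
  finally show ?thesis .
qed

end

lemma box_sum_bound: "\<bar>box_sum n x\<bar> \<le> real (card (lattice_box n :: (int ^ 'd) set))" for x :: "(int ^ 'd) set \<Rightarrow> real"
proof -
  interpret prob_space "law :: 'd clocks measure" by (rule prob_space_iidU)
  have "\<bar>free v x - integral\<^sup>L law (free v)\<bar> \<le> 1" for v :: "int ^ 'd"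
    by (rule centred_bound[OF free_measurable free_bound])
  then show ?thesis
    unfolding box_sum_def using sum_norm_bound[of "lattice_box n" "\<lambda>v. free v x - integral\<^sup>L law (free v)" 1] by simp
qed

text \<open>
  By the inequality of Cauchy and Schwarz, a variable that has correlation of order \<open>n ^ d\<close> with
  a variable of second moment of order \<open>n ^ d\<close> has itself second moment of at least that order.
\<close>

theorem limit_variance_pos: "0 < limit_variance TYPE('d :: finite)"
proof -
  interpret prob_space "law :: 'd clocks measure" by (rule prob_space_iidU)
  fix i0 :: 'd
  define p where "p = pattern_prob i0"
  have p: "0 < p" unfolding p_def pattern_prob_def by (rule pattern_prob_pos) simp
  obtain Q where Q: "0 < Q" and G2: "\<And>n. (\<integral>x. (\<Sum>v\<in>lattice_box n. toggle i0 (x \<circ> shift v))\<^sup>2 \<partial>law) \<le> Q * real n ^ CARD('d)"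
    using toggle_sum_second_moment by blast
  note [measurable] = shifted_toggle_properties(1)
  have bound: "p\<^sup>2 / Q \<le> (\<integral>x. (box_sum n x)\<^sup>2 \<partial>(law :: 'd clocks measure)) / real n ^ CARD('d)" if n: "0 < n" for n
  proof -
    let ?N = "real n ^ CARD('d)"
    define G where "G x = (\<Sum>v\<in>lattice_box n. toggle i0 (x \<circ> shift v))" for x
    \<comment> \<open>The multiple of \<open>G\<close> for which the lower bound from \<open>(box_sum - c * G)\<^sup>2 \<ge> 0\<close> is best.\<close>
    define c where "c = p / Q"
    have [measurable]: "G \<in> borel_measurable law" unfolding G_def by measurable
    define K where "K = real (card (lattice_box n :: (int ^ 'd) set))"
    have Gb: "\<bar>G x\<bar> \<le> K" for x
      unfolding G_def K_def using sum_norm_bound[of "lattice_box n" "\<lambda>v. toggle i0 (x \<circ> shift v)" 1] by (simp add: toggle_bound)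
    have Sb: "\<bar>box_sum n x\<bar> \<le> K" for x :: "'d clocks" unfolding K_def by (rule box_sum_bound)
    have K0: "0 \<le> K" unfolding K_def by simp
    have bounded: "integrable law (\<lambda>x. f x * g x)"
      if "f \<in> borel_measurable law" "g \<in> borel_measurable law" "\<And>x. \<bar>f x\<bar> \<le> K" "\<And>x. \<bar>g x\<bar> \<le> K"
      for f g :: "'d clocks \<Rightarrow> real"
    proof (rule integrable_bounded[where C = "K * K"])
      show "(\<lambda>x. f x * g x) \<in> borel_measurable law" using that by measurable
      show "\<bar>f x * g x\<bar> \<le> K * K" for x
        unfolding abs_mult using that K0 by (intro mult_mono) auto
    qed
    have i: "integrable law (\<lambda>x :: 'd clocks. (box_sum n x)\<^sup>2)" "integrable law (\<lambda>x. box_sum n x * G x)" "integrable law (\<lambda>x. (G x)\<^sup>2)"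
      unfolding power2_eq_square by (intro bounded Gb Sb; measurable)+
    have "0 \<le> (\<integral>x. (box_sum n x - c * G x)\<^sup>2 \<partial>law)" by simp
    also have "\<dots> = (\<integral>x. (box_sum n x)\<^sup>2 - 2 * c * (box_sum n x * G x) + c\<^sup>2 * (G x)\<^sup>2 \<partial>law)"
      by (intro Bochner_Integration.integral_cong refl) (simp add: power2_eq_square algebra_simps)
    also have "\<dots> = (\<integral>x. (box_sum n x)\<^sup>2 \<partial>(law :: 'd clocks measure)) - 2 * c * (\<integral>x. box_sum n x * G x \<partial>law) + c\<^sup>2 * (\<integral>x. (G x)\<^sup>2 \<partial>law)"
      using i by simp
    finally have "2 * c * (\<integral>x. box_sum n x * G x \<partial>law) - c\<^sup>2 * (\<integral>x. (G x)\<^sup>2 \<partial>law) \<le> (\<integral>x. (box_sum n x)\<^sup>2 \<partial>(law :: 'd clocks measure))"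
      by linarith
    moreover have "2 * c * (p * ?N) \<le> 2 * c * (\<integral>x. box_sum n x * G x \<partial>law)"
      unfolding p_def G_def by (intro mult_left_mono box_sum_toggle) (use p Q in \<open>simp add: c_def\<close>)
    moreover have "c\<^sup>2 * (\<integral>x. (G x)\<^sup>2 \<partial>law) \<le> c\<^sup>2 * (Q * ?N)"
      unfolding G_def by (intro mult_left_mono G2) simp
    moreover have "2 * c * (p * ?N) - c\<^sup>2 * (Q * ?N) = p\<^sup>2 / Q * ?N"
      unfolding c_def using Q by (simp add: power2_eq_square field_simps)
    ultimately have "p\<^sup>2 / Q * ?N \<le> (\<integral>x. (box_sum n x)\<^sup>2 \<partial>(law :: 'd clocks measure))" by linarith
    then show ?thesis using n by (simp add: pos_le_divide_eq)
  qed
  have "p\<^sup>2 / Q \<le> limit_variance TYPE('d)"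
    by (rule tendsto_lowerbound[OF box_variance_tendsto])
       (auto intro!: eventually_mono[OF eventually_gt_at_top[of 0]] bound)
  moreover have "0 < p\<^sup>2 / Q" using p Q by simp
  ultimately show ?thesis by linarith
qed

section \<open>The central limit theorem for free sites\<close>

definition local_sum :: "nat \<Rightarrow> nat \<Rightarrow> ((int ^ 'd) set \<Rightarrow> real) \<Rightarrow> real" where
  "local_sum k n x = (\<Sum>v\<in>lattice_box n. local_free k v x - integral\<^sup>L law (local_free k v))"

text \<open>
  Two local approximations of depth \<open>k\<close> share clocks only if their sites are within distance
  \<open>2 * (k + 1)\<close> in every coordinate.
\<close>

lemma local_dependency:
  "dependency_neighbourhoods (law :: ((int ^ 'd) set \<Rightarrow> real) measure) (lattice_box n)
     (\<lambda>v. lattice_box n \<inter> cube (2 * Suc k) v)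
     (\<lambda>v x. local_free k v x - integral\<^sup>L law (local_free k v)) ((4 * k + 5) ^ CARD('d))"
proof -
  interpret prob_space "law :: 'd clocks measure" by (rule prob_space_iidU)
  define Y where "Y v x = local_free k v x - integral\<^sup>L law (local_free k v)" for v :: "int ^ 'd" and x
  let ?I = "lattice_box n :: (int ^ 'd) set"
  let ?N = "\<lambda>v :: int ^ 'd. lattice_box n \<inter> cube (2 * Suc k) v"
  let ?B = "edge_ball (Suc k) :: int ^ 'd \<Rightarrow> _"
  have Ym [measurable]: "Y v \<in> borel_measurable law" for v unfolding Y_def by measurable
  have Yb: "\<bar>Y v x\<bar> \<le> 1" for v x
    unfolding Y_def by (rule centred_bound[OF local_free_measurable local_free_bound])
  have Yi: "integrable law (Y v)" for v by (rule integrable_bounded[where C = 1]) (auto simp: Yb)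
  have YYb: "\<bar>Y v x * Y w x\<bar> \<le> 1" for v w x unfolding abs_mult by (intro mult_le_one Yb) auto
  have YYi: "integrable law (\<lambda>x. Y v x * Y w x)" for v w by (rule integrable_bounded[where C = 1]) (auto simp: YYb)
  have Y0: "(\<integral>x. Y v x \<partial>law) = 0" for v
  proof -
    have "integrable law (local_free k v)"
      by (rule integrable_bounded[where C = 1]) (auto simp: local_free_bound)
    then show ?thesis unfolding Y_def by (simp add: prob_space)
  qed
  have Yd: "depends_on (?B v) (Y v)" for v
    unfolding Y_def by (rule depends_on_compose[OF local_free_depends])
  have disj: "?B v \<inter> ?B w = {}" if "w \<notin> cube (2 * Suc k) v" for v w
    by (rule edge_ball_disjoint) (use that in \<open>simp add: mult_2\<close>)
  have "dependency_neighbourhoods law ?I ?N Y ((4 * k + 5) ^ CARD('d))"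
  proof (unfold_locales)
    show "finite ?I" using lattice_box_card by blast
    show "?N i \<subseteq> ?I" for i by simp
    show "i \<in> ?N j" if "i \<in> ?I" "j \<in> ?N i" for i j using that cube_sym[of i _ j] by simp
    show "card (?N i) \<le> (4 * k + 5) ^ CARD('d)" for i
    proof -
      have eq: "2 * (2 * Suc k) + 1 = 4 * k + 5" by simp
      have "card (?N i) \<le> card (cube (2 * Suc k) i)" by (rule card_mono) (use card_cube in auto)
      also have "\<dots> = (4 * k + 5) ^ CARD('d)"
        using card_cube[of "2 * Suc k" i] unfolding eq by (rule conjunct2)
      finally show ?thesis .
    qed
    show "Y i \<in> borel_measurable law" for i by (rule Ym)
    show "\<bar>Y i x\<bar> \<le> 1" for i x by (rule Yb)
  next
    fix i t assume "i \<in> ?I"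
    let ?K = "\<Union>j\<in>?I - ?N i. ?B j"
    let ?G = "\<lambda>x. iexp (t * (\<Sum>j\<in>?I - ?N i. Y j x))"
    have "(\<integral>x. complex_of_real (Y i x) * ?G x \<partial>law) = (\<integral>x. complex_of_real (Y i x) \<partial>law) * (\<integral>x. ?G x \<partial>law)"
    proof (rule indep_expectation[where J = "?B i" and K = ?K])
      show "?B i \<inter> ?K = {}" using disj[of _ i] by auto
      show "?K \<subseteq> lattice_edges" using edge_ball_subset by blast
      show "integrable law (\<lambda>x. complex_of_real (Y i x))" using Yi by simp
      show "integrable law ?G" by (rule integrable_const_bound[where B = 1]) auto
      show "depends_on (?B i) (\<lambda>x. complex_of_real (Y i x))" by (rule depends_on_compose[OF Yd])
      have "depends_on ?K (\<lambda>x. \<Sum>j\<in>?I - ?N i. Y j x)"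
        by (intro depends_on_sum depends_on_mono[OF Yd]) auto
      then show "depends_on ?K ?G" by (rule depends_on_compose)
    qed (rule lattice_edges_nonempty edge_ball_subset)+
    then show "(\<integral>x. complex_of_real (Y i x) * ?G x \<partial>law) = 0" using Y0[of i] by simp
  next
    fix i j assume "i \<in> ?I" "j \<in> ?I - ?N i"
    then have "?B i \<inter> ?B j = {}" by (intro disj) auto
    then have "(\<integral>x. Y i x * Y j x \<partial>law) = (\<integral>x. Y i x \<partial>law) * (\<integral>x. Y j x \<partial>law)"
      by (intro indep_expectation[OF lattice_edges_nonempty _ edge_ball_subset edge_ball_subset Yi Yd Yi Yd])
    then show "(\<integral>x. Y i x * Y j x \<partial>law) = 0" using Y0 by simp
  next
    fix i j k' l assume *: "i \<in> ?I" "j \<in> ?N i" "k' \<in> ?I - (?N i \<union> ?N j)" "l \<in> ?N k' - (?N i \<union> ?N j)"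
    have dd: "depends_on (?B v \<union> ?B w) (\<lambda>x. Y v x * Y w x)" for v w
      by (rule depends_on_compose2[OF depends_on_mono[OF Yd] depends_on_mono[OF Yd]]) auto
    show "(\<integral>x. (Y i x * Y j x) * (Y k' x * Y l x) \<partial>law) = (\<integral>x. Y i x * Y j x \<partial>law) * (\<integral>x. Y k' x * Y l x \<partial>law)"
    proof (rule indep_expectation[where J = "?B i \<union> ?B j" and K = "?B k' \<union> ?B l"])
      show "(?B i \<union> ?B j) \<inter> (?B k' \<union> ?B l) = {}"
        using * disj[of k' i] disj[of k' j] disj[of l i] disj[of l j] by auto
    qed (use edge_ball_subset lattice_edges_nonempty YYi dd in auto)
  qed
  then show ?thesis unfolding Y_def .
qed

lemma local_sum_gaussian:
  fixes n k :: nat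
  defines "D \<equiv> real ((4 * k + 5) ^ CARD('d))" and "N \<equiv> real (n ^ CARD('d))"
  shows "norm ((\<integral>x. iexp (t * local_sum k n x) \<partial>(law :: ((int ^ 'd) set \<Rightarrow> real) measure))
      - of_real (exp (- (\<integral>x. (local_sum k n x)\<^sup>2 \<partial>(law :: ((int ^ 'd) set \<Rightarrow> real) measure)) * t\<^sup>2 / 2)))
     \<le> \<bar>t\<bar> * (N * D ^ 2 * t\<^sup>2 + \<bar>t\<bar> * sqrt (8 * N * D ^ 3))"
proof -
  interpret dependency_neighbourhoods "law :: 'd clocks measure" "lattice_box n"
     "\<lambda>v. lattice_box n \<inter> cube (2 * Suc k) v"
     "\<lambda>v x. local_free k v x - integral\<^sup>L law (local_free k v)" "(4 * k + 5) ^ CARD('d)"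
    by (rule local_dependency)
  have S: "S = local_sum k n" unfolding S_def local_sum_def by (rule refl)
  have N: "real (card (lattice_box n :: (int ^ 'd) set)) = N"
    unfolding N_def using lattice_box_card[of n, where 'd = 'd] by simp
  show ?thesis using char_gaussian_bound[of t] unfolding s2_def S N D_def .
qed

lemma local_sum_measurable [measurable]: "local_sum k n \<in> borel_measurable law"
  unfolding local_sum_def by measurable

lemma local_variance:
  "(\<integral>x. (local_sum k n x)\<^sup>2 \<partial>(law :: ((int ^ 'd) set \<Rightarrow> real) measure)) =
   (\<Sum>v\<in>lattice_box n. \<Sum>w\<in>lattice_box n. covariance law (local_free k v) (local_free k (w :: int ^ 'd)))"
  unfolding local_sum_def
  by (rule prob_space.centred_sum_variance[OF prob_space_iidU local_free_measurable local_free_bound])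

lemma local_variance_error:
  "\<bar>(\<integral>x. (box_sum n x)\<^sup>2 \<partial>(law :: ((int ^ 'd) set \<Rightarrow> real) measure)) - (\<integral>x. (local_sum k n x)\<^sup>2 \<partial>(law :: ((int ^ 'd) set \<Rightarrow> real) measure))\<bar>
   \<le> real (n ^ CARD('d)) ^ 2 * (4 * (descent_const TYPE('d) / 2 ^ k))"
proof -
  let ?L = "lattice_box n :: (int ^ 'd) set"
  have c: "real (card ?L) = real (n ^ CARD('d))" using lattice_box_card[of n, where 'd = 'd] by simp
  have "\<bar>(\<Sum>v\<in>?L. \<Sum>w\<in>?L. cov (w - v)) - (\<Sum>v\<in>?L. \<Sum>w\<in>?L. covariance law (local_free k v) (local_free k w))\<bar>
     = \<bar>\<Sum>v\<in>?L. \<Sum>w\<in>?L. (cov (w - v) - covariance law (local_free k v) (local_free k w))\<bar>"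
    by (simp add: sum_subtractf)
  also have "\<dots> \<le> (\<Sum>v\<in>?L. \<Sum>w\<in>?L. \<bar>cov (w - v) - covariance law (local_free k v) (local_free k w)\<bar>)"
    by (rule order_trans[OF sum_abs sum_mono[OF sum_abs]])
  also have "\<dots> \<le> (\<Sum>v\<in>?L. \<Sum>w\<in>?L. 4 * (descent_const TYPE('d) / 2 ^ k))"
    by (intro sum_mono cov_local_error)
  also have "\<dots> = real (n ^ CARD('d)) ^ 2 * (4 * (descent_const TYPE('d) / 2 ^ k))"
    by (simp add: c power2_eq_square del: of_nat_power)
  finally show ?thesis unfolding box_variance local_variance .
qed

lemma local_sum_error:
  "(\<integral>x. \<bar>box_sum n x - local_sum k n x\<bar> \<partial>(law :: ((int ^ 'd) set \<Rightarrow> real) measure))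
   \<le> real (n ^ CARD('d)) * (2 * (descent_const TYPE('d) / 2 ^ k))"
proof -
  interpret prob_space "law :: 'd clocks measure" by (rule prob_space_iidU)
  let ?L = "lattice_box n :: (int ^ 'd) set"
  let ?e = "descent_const TYPE('d) / 2 ^ k"
  define h where "h v x = free v x - local_free k v x" for v :: "int ^ 'd" and x
  have [measurable]: "h v \<in> borel_measurable law" for v unfolding h_def by measurable
  have hb: "\<bar>h v x\<bar> \<le> 1" for v x
    using free_bound[of v x] local_free_bound[of k v x] unfolding h_def by linarith
  have hi: "integrable law (h v)" for v by (rule integrable_bounded[where C = 1]) (auto simp: hb)
  have fi: "integrable law (free v)" "integrable law (local_free k v)" for v :: "int ^ 'd"
    by (rule integrable_bounded[where C = 1]; auto simp: free_bound local_free_bound)+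
  have he: "expectation (\<lambda>x. \<bar>h v x\<bar>) \<le> ?e" for v unfolding h_def by (rule expectation_free_minus_local)
  have hm: "\<bar>expectation (h v)\<bar> \<le> ?e" for v
    using integral_abs_bound[of law "h v"] he[of v] by linarith
  have one: "expectation (\<lambda>x. \<bar>h v x - expectation (h v)\<bar>) \<le> 2 * ?e" for v
  proof -
    have "expectation (\<lambda>x. \<bar>h v x - expectation (h v)\<bar>) \<le> expectation (\<lambda>x. \<bar>h v x\<bar> + \<bar>expectation (h v)\<bar>)"
      using hi by (intro integral_mono) auto
    also have "\<dots> = expectation (\<lambda>x. \<bar>h v x\<bar>) + \<bar>expectation (h v)\<bar>" using hi by (simp add: prob_space)
    finally show ?thesis using he[of v] hm[of v] by linarith
  qed
  have diff: "box_sum n x - local_sum k n x = (\<Sum>v\<in>?L. h v x - expectation (h v))" for x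
    unfolding box_sum_def local_sum_def h_def using fi by (simp add: sum_subtractf)
  have "expectation (\<lambda>x. \<bar>box_sum n x - local_sum k n x\<bar>) \<le> expectation (\<lambda>x. \<Sum>v\<in>?L. \<bar>h v x - expectation (h v)\<bar>)"
    unfolding diff using hi by (intro integral_mono) auto
  also have "\<dots> = (\<Sum>v\<in>?L. expectation (\<lambda>x. \<bar>h v x - expectation (h v)\<bar>))"
    using hi by simp
  also have "\<dots> \<le> (\<Sum>v\<in>?L. 2 * ?e)" by (intro sum_mono one)
  also have "\<dots> = real (n ^ CARD('d)) * (2 * ?e)"
    using lattice_box_card[of n, where 'd = 'd] by simp
  finally show ?thesis .
qed

lemma box_sum_char_error:
  "norm ((\<integral>x. iexp (t * box_sum n x) \<partial>(law :: ((int ^ 'd) set \<Rightarrow> real) measure)) - (\<integral>x. iexp (t * local_sum k n x) \<partial>(law :: ((int ^ 'd) set \<Rightarrow> real) measure)))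
   \<le> \<bar>t\<bar> * (real (n ^ CARD('d)) * (2 * (descent_const TYPE('d) / 2 ^ k)))"
proof -
  interpret prob_space "law :: 'd clocks measure" by (rule prob_space_iidU)
  have lip: "norm (iexp a - iexp b) \<le> \<bar>a - b\<bar>" for a b :: real
  proof -
    have "iexp a - iexp b = iexp b * (iexp (a - b) - 1)" by (simp add: algebra_simps exp_add[symmetric])
    then have "norm (iexp a - iexp b) = norm (iexp (a - b) - 1)" by (simp add: norm_mult del: of_real_diff)
    also have "\<dots> \<le> \<bar>a - b\<bar>" using iexp_approx1[of "a - b" 0] by simp
    finally show ?thesis .
  qed
  have i: "integrable law (\<lambda>x :: 'd clocks. iexp (t * box_sum n x))" "integrable law (\<lambda>x :: 'd clocks. iexp (t * local_sum k n x))"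
    by (rule integrable_const_bound[where B = 1]; simp)+
  have fi: "integrable law (free v)" "integrable law (local_free k v)" for v :: "int ^ 'd"
    by (rule integrable_bounded[where C = 1]; auto simp: free_bound local_free_bound)+
  have ib: "integrable law (\<lambda>x :: 'd clocks. \<bar>t\<bar> * \<bar>box_sum n x - local_sum k n x\<bar>)"
    unfolding box_sum_def local_sum_def using fi by auto
  have "norm ((\<integral>x. iexp (t * box_sum n x) \<partial>(law :: 'd clocks measure)) - (\<integral>x. iexp (t * local_sum k n x) \<partial>(law :: 'd clocks measure)))
      = norm (\<integral>x. iexp (t * box_sum n x) - iexp (t * local_sum k n x) \<partial>(law :: 'd clocks measure))"
    using i by simp
  also have "\<dots> \<le> (\<integral>x. norm (iexp (t * box_sum n x) - iexp (t * local_sum k n x)) \<partial>(law :: 'd clocks measure))"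
    by (rule integral_norm_bound)
  also have "\<dots> \<le> (\<integral>x. \<bar>t\<bar> * \<bar>box_sum n x - local_sum k n x\<bar> \<partial>(law :: 'd clocks measure))"
  proof (rule integral_mono)
    show "integrable law (\<lambda>x :: 'd clocks. norm (iexp (t * box_sum n x) - iexp (t * local_sum k n x)))"
      using i by (intro integrable_norm Bochner_Integration.integrable_diff)
    show "norm (iexp (t * box_sum n x) - iexp (t * local_sum k n x)) \<le> \<bar>t\<bar> * \<bar>box_sum n x - local_sum k n x\<bar>" for x :: "'d clocks"
      using lip[of "t * box_sum n x" "t * local_sum k n x"] by (simp add: abs_mult[symmetric] right_diff_distrib)
  qed (rule ib)
  also have "\<dots> = \<bar>t\<bar> * (\<integral>x. \<bar>box_sum n x - local_sum k n x\<bar> \<partial>(law :: 'd clocks measure))" by simp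
  also have "\<dots> \<le> \<bar>t\<bar> * (real (n ^ CARD('d)) * (2 * (descent_const TYPE('d) / 2 ^ k)))"
    by (intro mult_left_mono local_sum_error) simp
  finally show ?thesis .
qed

text \<open>
  The depth grows logarithmically in \<open>n\<close>: fast enough for \<open>2 ^ k\<close> to reach the square of the
  number of sites, so that approximation errors remain bounded even when summed over all pairs
  of sites, and slowly enough for the dependency neighbourhoods to be negligible against every
  power of \<open>n\<close>.
\<close>

definition radius :: "'d itself \<Rightarrow> nat \<Rightarrow> nat" where
  "radius _ n = 2 * CARD('d) * nat \<lceil>log 2 (real n)\<rceil>"

lemma radius_large:
  assumes "0 < n"
  shows "real (n ^ CARD('d)) ^ 2 \<le> 2 ^ radius TYPE('d) n"
proof -
  have "real n = 2 powr (log 2 (real n))" using assms by simp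
  also have "\<dots> \<le> 2 powr (real (nat \<lceil>log 2 (real n)\<rceil>))"
    by (intro powr_mono) (auto simp: real_nat_ceiling_ge)
  also have "\<dots> = 2 ^ nat \<lceil>log 2 (real n)\<rceil>" by (simp add: powr_realpow)
  finally have "real n ^ (2 * CARD('d)) \<le> (2 ^ nat \<lceil>log 2 (real n)\<rceil>) ^ (2 * CARD('d))"
    by (intro power_mono) auto
  then show ?thesis unfolding radius_def by (simp add: power_mult[symmetric] mult_ac)
qed

lemma radius_small: "(\<lambda>n. (4 * real (radius TYPE('d) n) + 5) ^ 4 / real n) \<longlonglongrightarrow> 0"
proof -
  define a where "a = 8 * real CARD('d) / ln 2"
  define b where "b = 8 * real CARD('d) + 5"
  have lim: "(\<lambda>n. (a * (ln (real n) / real n powr (1/4)) + b * (1 / real n powr (1/4))) ^ 4) \<longlonglongrightarrow> (a * 0 + b * 0) ^ 4"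
  proof (intro tendsto_intros)
    show "(\<lambda>n. ln (real n) / real n powr (1/4)) \<longlonglongrightarrow> 0" by (rule lim_ln_over_power) simp
    have "(\<lambda>n. real n powr (- (1/4))) \<longlonglongrightarrow> 0"
      by (rule tendsto_neg_powr) (auto intro: filterlim_real_sequentially)
    then show "(\<lambda>n. 1 / real n powr (1/4)) \<longlonglongrightarrow> 0" by (simp add: powr_minus_divide)
  qed
  show ?thesis
  proof (rule tendsto_sandwich[OF _ _ tendsto_const])
    show "\<forall>\<^sub>F n in sequentially. 0 \<le> (4 * real (radius TYPE('d) n) + 5) ^ 4 / real n" by simp
    show "(\<lambda>n. (a * (ln (real n) / real n powr (1/4)) + b * (1 / real n powr (1/4))) ^ 4) \<longlonglongrightarrow> 0"
      using lim by simp
    show "\<forall>\<^sub>F n in sequentially. (4 * real (radius TYPE('d) n) + 5) ^ 4 / real n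
        \<le> (a * (ln (real n) / real n powr (1/4)) + b * (1 / real n powr (1/4))) ^ 4"
      using eventually_ge_at_top[of 1]
    proof eventually_elim
      case (elim n)
      have n: "0 < real n" using elim by simp
      \<comment> \<open>Rounding up costs at most 1, which \<open>b\<close> absorbs.\<close>
      have "0 \<le> log 2 (real n)" using elim by simp
      then have "real (nat \<lceil>log 2 (real n)\<rceil>) \<le> log 2 (real n) + 1" by linarith
      then have "4 * real (radius TYPE('d) n) + 5 \<le> a * ln (real n) + b"
        unfolding radius_def a_def b_def log_def
        using mult_left_mono[of "real (nat \<lceil>log 2 (real n)\<rceil>)" "log 2 (real n) + 1" "8 * real CARD('d)"]
        by (simp add: log_def algebra_simps)
      then have "(4 * real (radius TYPE('d) n) + 5) ^ 4 \<le> (a * ln (real n) + b) ^ 4"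
        by (intro power_mono) auto
      then have "(4 * real (radius TYPE('d) n) + 5) ^ 4 / real n \<le> (a * ln (real n) + b) ^ 4 / real n"
        using n by (intro divide_right_mono) auto
      also have "\<dots> = ((a * ln (real n) + b) / real n powr (1/4)) ^ 4"
        using n by (simp add: power_divide powr_power)
      also have "(a * ln (real n) + b) / real n powr (1/4) = a * (ln (real n) / real n powr (1/4)) + b * (1 / real n powr (1/4))"
        by (simp add: add_divide_distrib)
      finally show ?case .
    qed
  qed
qed

text \<open>
  The characteristic function at \<open>t\<close> is evaluated at the rescaled argument \<open>s n\<close>. Three errors
  have to vanish: the local approximation (\<open>e1\<close>), the Gaussian approximation of the local sum
  (\<open>e2\<close>), and the difference between the variance of the local sum and its limit (\<open>lim3\<close>).
\<close>

theorem box_sum_clt: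
  "weak_conv_m (\<lambda>n. distr law borel (\<lambda>x :: (int ^ 'd) set \<Rightarrow> real. box_sum n x / sqrt (real n ^ CARD('d) * limit_variance TYPE('d))))
     std_normal_distribution"
proof (rule levy_continuity)
  interpret prob_space "law :: 'd clocks measure" by (rule prob_space_iidU)
  show "real_distribution (distr law borel (\<lambda>x :: 'd clocks. box_sum n x / sqrt (real n ^ CARD('d) * limit_variance TYPE('d))))" for n
    by (rule real_distribution_distr) simp
  show "real_distribution std_normal_distribution" by (rule real_dist_normal_dist)
  fix t :: real
  define \<sigma>2 where "\<sigma>2 = limit_variance TYPE('d)"
  have \<sigma>: "0 < \<sigma>2" unfolding \<sigma>2_def by (rule limit_variance_pos)
  define L where "L = CARD('d)"
  have L: "0 < L" unfolding L_def by simp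
  define C where "C = descent_const TYPE('d)"
  have C: "0 < C" unfolding C_def by (rule descent_const_pos)
  define N where "N n = real n ^ L" for n
  define s where "s n = t / sqrt (N n * \<sigma>2)" for n
  define k where "k n = radius TYPE('d) n" for n
  define D where "D n = (4 * real (k n) + 5) ^ L" for n
  define r where "r n = sqrt (((4 * real (k n) + 5) ^ 4 / real n) ^ L)" for n
  define V where "V n = (\<integral>x. (local_sum (k n) n x)\<^sup>2 \<partial>(law :: 'd clocks measure))" for n
  define W where "W n = (\<integral>x. (box_sum n x)\<^sup>2 \<partial>(law :: 'd clocks measure))" for n
  define ch where "ch n = (\<integral>x. iexp (s n * box_sum n x) \<partial>(law :: 'd clocks measure))" for n
  define cl where "cl n = (\<integral>x. iexp (s n * local_sum (k n) n x) \<partial>(law :: 'd clocks measure))" for n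
  have N1: "1 \<le> N n" if "0 < n" for n unfolding N_def using that by (intro one_le_power) auto
  have Ntop: "filterlim N at_top sequentially"
    unfolding N_def by (rule filterlim_pow_at_top[OF L filterlim_real_sequentially])
  have s2: "(s n)\<^sup>2 = t\<^sup>2 / (N n * \<sigma>2)" if "0 < n" for n
    unfolding s_def using \<sigma> N1[OF that] by (simp add: power_divide)
  have s0: "s \<longlonglongrightarrow> 0"
    unfolding s_def
    by (intro tendsto_divide_0[OF tendsto_const] filterlim_at_top_imp_at_infinity
        filterlim_compose[OF sqrt_at_top] filterlim_at_top_mult_tendsto_pos[OF tendsto_const \<sigma> Ntop, unfolded mult.commute[of \<sigma>2]])
  have r0: "r \<longlonglongrightarrow> 0"
  proof -
    have "(\<lambda>n. sqrt (((4 * real (k n) + 5) ^ 4 / real n) ^ L)) \<longlonglongrightarrow> sqrt (0 ^ L)"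
      unfolding k_def by (intro tendsto_real_sqrt tendsto_power radius_small)
    moreover have "sqrt (0 ^ L) = 0" using L by (simp add: zero_power)
    ultimately show ?thesis unfolding r_def by simp
  qed
  have k2: "N n ^ 2 \<le> 2 ^ k n" if "0 < n" for n
    using radius_large[OF that, where 'd = 'd] unfolding N_def k_def L_def by simp
  have N2: "N n * (1 / 2 ^ k n) \<le> 1 / N n" if "0 < n" for n
    using k2[OF that] N1[OF that] by (simp add: divide_simps power2_eq_square)
  have e1: "norm (ch n - cl n) \<le> \<bar>s n\<bar> * (2 * C)" if "0 < n" for n
  proof -
    have "N n * (2 * (C / 2 ^ k n)) = 2 * C * (N n * (1 / 2 ^ k n))" by simp
    also have "\<dots> \<le> 2 * C * (1 / N n)" using C N2[OF that] by (intro mult_left_mono) auto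
    also have "\<dots> \<le> 2 * C * 1" using C N1[OF that] by (intro mult_left_mono) auto
    finally have "\<bar>s n\<bar> * (N n * (2 * (C / 2 ^ k n))) \<le> \<bar>s n\<bar> * (2 * C)" by (intro mult_left_mono) auto
    then show ?thesis
      using box_sum_char_error[of "s n" n "k n", where 'd = 'd] unfolding ch_def cl_def C_def N_def L_def by simp
  qed
  have e2: "norm (cl n - of_real (exp (- V n * (s n)\<^sup>2 / 2))) \<le> (\<bar>t\<bar> ^ 3 / (\<sigma>2 * sqrt \<sigma>2) + t\<^sup>2 / \<sigma>2 * sqrt 8) * r n" if n: "0 < n" for n
  proof -
    have D1: "1 \<le> D n" unfolding D_def by (intro one_le_power) simp
    have Np: "0 < N n" using N1[OF n] by simp
    have rr: "r n = D n ^ 2 / sqrt (N n)"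
    proof -
      have "((4 * real (k n) + 5) ^ 4 / real n) ^ L = (D n ^ 2) ^ 2 / N n"
        unfolding D_def N_def by (simp add: power_divide power_mult[symmetric] mult_ac)
      then show ?thesis unfolding r_def by (simp only: real_sqrt_divide real_sqrt_abs abs_power2)
    qed
    have "norm (cl n - of_real (exp (- V n * (s n)\<^sup>2 / 2))) \<le> \<bar>s n\<bar> * (N n * D n ^ 2 * (s n)\<^sup>2 + \<bar>s n\<bar> * sqrt (8 * N n * D n ^ 3))"
      using local_sum_gaussian[of "s n" "k n" n, where 'd = 'd] unfolding cl_def V_def N_def D_def L_def by simp
    also have "\<dots> = \<bar>s n\<bar> * (s n)\<^sup>2 * N n * D n ^ 2 + (s n)\<^sup>2 * sqrt (8 * N n * D n ^ 3)"
      by (simp add: algebra_simps power2_eq_square)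
    also have "\<bar>s n\<bar> * (s n)\<^sup>2 * N n * D n ^ 2 = \<bar>t\<bar> ^ 3 / (\<sigma>2 * sqrt \<sigma>2) * r n"
      unfolding s2[OF n] rr using \<sigma> Np
      by (simp add: s_def real_sqrt_mult abs_mult field_simps power3_eq_cube power2_eq_square)
    also have "(s n)\<^sup>2 * sqrt (8 * N n * D n ^ 3) \<le> (s n)\<^sup>2 * sqrt (8 * N n * (D n ^ 2) ^ 2)"
      using Np D1 by (intro mult_left_mono real_sqrt_le_mono) (auto simp: power_mult[symmetric] intro!: power_increasing)
    also have "\<dots> = t\<^sup>2 / (N n * \<sigma>2) * (sqrt 8 * sqrt (N n) * D n ^ 2)"
      unfolding s2[OF n] by (simp only: real_sqrt_mult real_sqrt_abs abs_power2)
    also have "\<dots> = t\<^sup>2 / \<sigma>2 * sqrt 8 * D n ^ 2 * (sqrt (N n) / N n)" by (simp add: mult_ac)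
    also have "\<dots> = t\<^sup>2 / \<sigma>2 * sqrt 8 * r n"
      using sqrt_divide_self_eq[of "N n"] Np by (simp only: rr divide_inverse mult.assoc)
    finally show ?thesis by (simp add: distrib_right)
  qed
  have lim3: "(\<lambda>n. exp (- V n * (s n)\<^sup>2 / 2)) \<longlonglongrightarrow> exp (- (t\<^sup>2) / 2)"
  proof -
    have "(\<lambda>n. V n / N n - W n / N n) \<longlonglongrightarrow> 0"
    proof (rule Lim_null_comparison)
      show "(\<lambda>n. 4 * C / N n) \<longlonglongrightarrow> 0"
        by (intro tendsto_divide_0[OF tendsto_const] filterlim_at_top_imp_at_infinity Ntop)
      show "\<forall>\<^sub>F n in sequentially. norm (V n / N n - W n / N n) \<le> 4 * C / N n"
        using eventually_gt_at_top[of 0]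
      proof eventually_elim
        case (elim n)
        have "\<bar>W n - V n\<bar> \<le> N n ^ 2 * (4 * (C / 2 ^ k n))"
          using local_variance_error[of n "k n", where 'd = 'd] unfolding V_def W_def C_def N_def L_def by simp
        also have "\<dots> = 4 * C * (N n ^ 2 / 2 ^ k n)" by simp
        also have "\<dots> \<le> 4 * C * 1" using k2[OF elim] C by (intro mult_left_mono) auto
        finally have "\<bar>V n - W n\<bar> / N n \<le> 4 * C / N n" using N1[OF elim] by (intro divide_right_mono) auto
        then show ?case using N1[OF elim] by (simp add: diff_divide_distrib[symmetric])
      qed
    qed
    moreover have "(\<lambda>n. W n / N n) \<longlonglongrightarrow> \<sigma>2"
      using box_variance_tendsto[where 'd = 'd] unfolding W_def N_def L_def \<sigma>2_def .
    ultimately have "(\<lambda>n. (V n / N n - W n / N n) + W n / N n) \<longlonglongrightarrow> 0 + \<sigma>2" by (rule tendsto_add)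
    then have "(\<lambda>n. V n / N n) \<longlonglongrightarrow> \<sigma>2" by simp
    then have lim: "(\<lambda>n. exp (- (V n / N n) * (t\<^sup>2 / \<sigma>2) / 2)) \<longlonglongrightarrow> exp (- \<sigma>2 * (t\<^sup>2 / \<sigma>2) / 2)"
      by (intro tendsto_intros) auto
    have ev: "\<forall>\<^sub>F n in sequentially. exp (- (V n / N n) * (t\<^sup>2 / \<sigma>2) / 2) = exp (- V n * (s n)\<^sup>2 / 2)"
      using eventually_gt_at_top[of 0] by eventually_elim (simp add: s2)
    have "- \<sigma>2 * (t\<^sup>2 / \<sigma>2) / 2 = - (t\<^sup>2) / 2" using \<sigma> by simp
    with Lim_transform_eventually[OF lim ev] show ?thesis by (simp only:)
  qed
  have "(\<lambda>n. ch n - of_real (exp (- V n * (s n)\<^sup>2 / 2))) \<longlonglongrightarrow> 0"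
  proof (rule Lim_null_comparison)
    let ?b = "\<lambda>n. \<bar>s n\<bar> * (2 * C) + (\<bar>t\<bar> ^ 3 / (\<sigma>2 * sqrt \<sigma>2) + t\<^sup>2 / \<sigma>2 * sqrt 8) * r n"
    have "?b \<longlonglongrightarrow> \<bar>0\<bar> * (2 * C) + (\<bar>t\<bar> ^ 3 / (\<sigma>2 * sqrt \<sigma>2) + t\<^sup>2 / \<sigma>2 * sqrt 8) * 0"
      by (intro tendsto_add tendsto_mult tendsto_const tendsto_rabs s0 r0)
    then show "?b \<longlonglongrightarrow> 0" by simp
    show "\<forall>\<^sub>F n in sequentially. norm (ch n - of_real (exp (- V n * (s n)\<^sup>2 / 2))) \<le> ?b n"
      using eventually_gt_at_top[of 0]
    proof eventually_elim
      case (elim n)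
      have "ch n - of_real (exp (- V n * (s n)\<^sup>2 / 2)) = (ch n - cl n) + (cl n - of_real (exp (- V n * (s n)\<^sup>2 / 2)))" by simp
      also have "norm \<dots> \<le> norm (ch n - cl n) + norm (cl n - of_real (exp (- V n * (s n)\<^sup>2 / 2)))" by (rule norm_triangle_ineq)
      finally show ?case using e1[OF elim] e2[OF elim] by linarith
    qed
  qed
  then have "(\<lambda>n. (ch n - of_real (exp (- V n * (s n)\<^sup>2 / 2))) + of_real (exp (- V n * (s n)\<^sup>2 / 2))) \<longlonglongrightarrow> 0 + of_real (exp (- (t\<^sup>2) / 2))"
    by (intro tendsto_add tendsto_of_real lim3)
  then have "ch \<longlonglongrightarrow> of_real (exp (- (t\<^sup>2) / 2))" by simp
  moreover have "char (distr law borel (\<lambda>x :: 'd clocks. box_sum n x / sqrt (real n ^ CARD('d) * limit_variance TYPE('d)))) t = ch n" for n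
    unfolding char_def ch_def s_def N_def L_def \<sigma>2_def
    by (subst integral_distr) (simp_all add: mult.commute divide_inverse mult_ac)
  ultimately show "(\<lambda>n. char (distr law borel (\<lambda>x :: 'd clocks. box_sum n x / sqrt (real n ^ CARD('d) * limit_variance TYPE('d)))) t)
      \<longlonglongrightarrow> char std_normal_distribution t"
    by (simp add: char_std_normal_distribution)
qed

section \<open>From the placement process to the greedy rule\<close>

lemma dimer_mono:
  assumes "dimer_placement \<tau> E" "0 \<le> s" "s \<le> t" "t \<le> 1"
  shows "E s \<subseteq> E t"
proof (cases "s = t")
  case False
  with assms have "s \<in> {0..<t}" by auto
  then have "E s \<subseteq> before E t" unfolding before_def by blast
  moreover have "before E t \<subseteq> E t" using assms unfolding dimer_placement_def by auto
  ultimately show ?thesis by blast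
qed simp

text \<open>
  By right-continuity, the infimum of the times at which an edge is present is itself such a
  time. The edge was not present before, so the recursion added it there; this forces the
  infimum to be its clock.
\<close>

lemma dimer_first_time:
  assumes dp: "dimer_placement \<tau> E" and t: "0 \<le> t" "t \<le> 1" and e: "e \<in> E t"
  shows "e \<in> lattice_edges \<and> 0 \<le> \<tau> e \<and> \<tau> e \<le> t \<and> (\<forall>f\<in>before E (\<tau> e). e \<inter> f = {})"
proof -
  define R where "R = {s \<in> {0..t}. e \<in> E s}"
  define s where "s = Inf R"
  have R: "t \<in> R" "bdd_below R" unfolding R_def using t e by (auto intro!: bdd_belowI[of _ 0])
  have s: "0 \<le> s" "s \<le> t" unfolding s_def
    using R by (auto intro!: cInf_greatest cInf_lower simp: R_def)
  have above: "e \<in> E r" if "s < r" "r \<le> 1" for r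
  proof -
    have "\<exists>s'\<in>R. s' < r"
      by (rule cInf_lessD) (use R(1) that(1) in \<open>auto simp: s_def\<close>)
    then obtain s' where "s' \<in> R" "s' < r" by blast
    then show ?thesis using dimer_mono[OF dp, of s' r] that(2) unfolding R_def by auto
  qed
  have es: "e \<in> E s"
  proof (cases "s < 1")
    case True
    moreover have "\<forall>t\<in>{0..<1}. E t = (\<Inter>r\<in>{t<..1}. E r)" using dp unfolding dimer_placement_def by blast
    ultimately have "E s = (\<Inter>r\<in>{s<..1}. E r)" using s by simp
    then show ?thesis using above by auto
  next
    case False
    then have "s = t" using s t by simp
    then show ?thesis using e by simp
  qed
  have "e \<notin> before E s"
  proof
    assume "e \<in> before E s"
    then obtain r where "0 \<le> r" "r < s" "e \<in> E r" unfolding before_def by auto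
    then have "r \<in> R" unfolding R_def using s by auto
    then have "s \<le> r" unfolding s_def using R(2) by (rule cInf_lower)
    with \<open>r < s\<close> show False by simp
  qed
  moreover have "\<forall>t\<in>{0..1}. E t = before E t \<union> {e \<in> lattice_edges. \<tau> e = t \<and> (\<forall>f\<in>before E t. e \<inter> f = {})}"
    using dp unfolding dimer_placement_def by blast
  then have "E s = before E s \<union> {e \<in> lattice_edges. \<tau> e = s \<and> (\<forall>f\<in>before E s. e \<inter> f = {})}"
    using s t by simp
  ultimately have "e \<in> lattice_edges" "\<tau> e = s" "\<forall>f\<in>before E s. e \<inter> f = {}" using es by blast+
  then show ?thesis using s by auto
qed

text \<open>
  The edges present before time \<open>t\<close> are those of the final set whose clocks ring before \<open>t\<close>.
  This eliminates the time parameter from the recursion and leaves the greedy rule.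
\<close>

lemma dimer_greedy:
  fixes \<tau> :: "(int ^ 'd) set \<Rightarrow> real"
  assumes dp: "dimer_placement \<tau> E" and range: "\<And>e. e \<in> lattice_edges \<Longrightarrow> 0 \<le> \<tau> e \<and> \<tau> e \<le> 1"
  shows "greedy conflicts lattice_edges \<tau> (E 1)" "E 1 \<subseteq> lattice_edges"
proof -
  note first = dimer_first_time[OF dp, of 1, simplified]
  show sub: "E 1 \<subseteq> lattice_edges" using first by blast
  have enter: "e \<in> E (\<tau> e)" if "e \<in> lattice_edges" "\<forall>f\<in>before E (\<tau> e). e \<inter> f = {}" for e
  proof -
    have "E (\<tau> e) = before E (\<tau> e) \<union> {e' \<in> lattice_edges. \<tau> e' = \<tau> e \<and> (\<forall>f\<in>before E (\<tau> e). e' \<inter> f = {})}"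
      using dp range[OF that(1)] unfolding dimer_placement_def by simp
    then show ?thesis using that by blast
  qed
  have before: "f \<in> before E t \<longleftrightarrow> f \<in> E 1 \<and> \<tau> f < t" if t: "t \<le> 1" for f t
  proof
    assume "f \<in> before E t"
    then obtain r where r: "0 \<le> r" "r < t" "f \<in> E r" unfolding before_def by auto
    then show "f \<in> E 1 \<and> \<tau> f < t"
      using dimer_first_time[OF dp, of r f] dimer_mono[OF dp, of r 1] t by auto
  next
    assume f: "f \<in> E 1 \<and> \<tau> f < t"
    then have "f \<in> E (\<tau> f)" "0 \<le> \<tau> f" using first[of f] enter[of f] by auto
    then show "f \<in> before E t" using f unfolding before_def by auto
  qed
  show "greedy conflicts lattice_edges \<tau> (E 1)"
    unfolding greedy_def
  proof
    fix e :: "(int ^ 'd) set" assume e: "e \<in> lattice_edges"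
    have \<tau>e: "0 \<le> \<tau> e" "\<tau> e \<le> 1" using range[OF e] by auto
    have "e \<in> E 1 \<longleftrightarrow> (\<forall>f\<in>before E (\<tau> e). e \<inter> f = {})"
      using first[of e] enter[OF e] dimer_mono[OF dp \<tau>e(1) \<tau>e(2)] by auto
    also have "\<dots> \<longleftrightarrow> (\<forall>f\<in>conflicts e. \<tau> f < \<tau> e \<longrightarrow> f \<notin> E 1)"
    proof
      assume *: "\<forall>f\<in>before E (\<tau> e). e \<inter> f = {}"
      show "\<forall>f\<in>conflicts e. \<tau> f < \<tau> e \<longrightarrow> f \<notin> E 1"
      proof (intro ballI impI notI)
        fix f assume f: "f \<in> conflicts e" "\<tau> f < \<tau> e" "f \<in> E 1"
        then have "f \<in> before E (\<tau> e)" using before[OF \<tau>e(2)] by simp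
        with * have "e \<inter> f = {}" by blast
        with f(1) show False unfolding conflicts_def by (simp add: Int_commute)
      qed
    next
      assume *: "\<forall>f\<in>conflicts e. \<tau> f < \<tau> e \<longrightarrow> f \<notin> E 1"
      show "\<forall>f\<in>before E (\<tau> e). e \<inter> f = {}"
      proof (rule ballI, rule ccontr)
        fix f assume "f \<in> before E (\<tau> e)" and meet: "e \<inter> f \<noteq> {}"
        then have f: "f \<in> E 1" "\<tau> f < \<tau> e" using before[OF \<tau>e(2)] by simp_all
        then have "f \<in> conflicts e" using sub meet unfolding conflicts_def by (auto simp: Int_commute)
        with * f show False by blast
      qed
    qed
    finally show "e \<in> E 1 \<longleftrightarrow> (\<forall>f\<in>conflicts e. \<tau> f < \<tau> e \<longrightarrow> f \<notin> E 1)" .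
  qed
qed

lemma clocks_distr:
  assumes "prob_space M" "iid_uniform_times M \<tau>"
  defines "X \<equiv> (\<lambda>\<omega>. \<lambda>e\<in>lattice_edges. \<tau> e \<omega>)"
  shows "X \<in> measurable M law" "distr M law X = law"
proof -
  interpret prob_space M by fact
  have ind: "indep_vars (\<lambda>_. borel) \<tau> lattice_edges" and U: "\<And>e. e \<in> lattice_edges \<Longrightarrow> distr M borel (\<tau> e) = U01"
    using assms(2) unfolding iid_uniform_times_def by auto
  have rv: "random_variable borel (\<tau> e)" if "e \<in> lattice_edges" for e
    using ind that unfolding indep_vars_def by auto
  have sets: "sets (PiM lattice_edges (\<lambda>_. borel :: real measure)) = sets law"
    by (rule sets_PiM_cong) auto
  have X: "X \<in> measurable M (PiM lattice_edges (\<lambda>_. borel))"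
    unfolding X_def using rv by (rule measurable_restrict)
  then show "X \<in> measurable M law" by (simp add: measurable_cong_sets[OF refl sets])
  have "distr M law X = distr M (PiM lattice_edges (\<lambda>_. borel)) X"
    by (rule distr_cong) (simp_all add: sets)
  also have "\<dots> = PiM lattice_edges (\<lambda>e. distr M borel (\<tau> e))"
    using indep_vars_iff_distr_eq_PiM'[where I = lattice_edges and M' = "\<lambda>_. borel" and X = \<tau>, OF lattice_edges_nonempty rv] ind unfolding X_def by blast
  also have "\<dots> = law" by (rule PiM_cong) (auto simp: U)
  finally show "distr M law X = law" .
qed

lemma countable_lattice_edges: "countable (lattice_edges :: (int ^ 'd) set set)"
proof -
  have "lattice_edges = (\<Union>v\<in>(UNIV :: (int ^ 'd) set). edges_at v)"
    unfolding edges_at_def by (auto elim: lattice_edgeE)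
  moreover have "countable (\<Union>v\<in>(UNIV :: (int ^ 'd) set). edges_at v)"
    by (rule countable_UN[OF countable_lattice]) (simp add: countable_finite)
  ultimately show ?thesis by simp
qed

text \<open>
  Almost surely all descents are finite, so the final set of the process is the only solution
  of the greedy rule and is a function of the clocks.
\<close>

lemma uncovered_AE:
  fixes E :: "real \<Rightarrow> 'w \<Rightarrow> (int ^ 'd) set set"
  assumes "prob_space M" and iid: "iid_uniform_times M \<tau>" and dpp: "dimer_placement_process M \<tau> E"
  defines "X \<equiv> (\<lambda>\<omega>. \<lambda>e\<in>lattice_edges. \<tau> e \<omega>)"
  shows "AE \<omega> in M. \<forall>v. uncovered E v \<omega> = free v (X \<omega>)"
proof -
  interpret prob_space M by fact
  note X = clocks_distr[OF assms(1) iid, folded X_def]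
  have "AE \<omega> in M. 0 \<le> \<tau> e \<omega> \<and> \<tau> e \<omega> \<le> 1" if e: "e \<in> lattice_edges" for e
  proof -
    have rv: "random_variable borel (\<tau> e)" and d: "distr M borel (\<tau> e) = U01"
      using iid e unfolding iid_uniform_times_def indep_vars_def by auto
    show ?thesis by (rule AE_distrD[OF rv]) (simp only: d U01_AE)
  qed
  then have range: "AE \<omega> in M. \<forall>e\<in>lattice_edges. 0 \<le> \<tau> e \<omega> \<and> \<tau> e \<omega> \<le> 1"
    by (subst AE_ball_countable[OF countable_lattice_edges]) auto
  have wf: "AE \<omega> in M. well_founded_clocks (X \<omega>)"
    by (rule AE_distrD[OF X(1)]) (simp only: X(2) AE_well_founded)
  have dp: "AE \<omega> in M. dimer_placement (\<lambda>e. \<tau> e \<omega>) (\<lambda>t. E t \<omega>)"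
    using dpp unfolding dimer_placement_process_def by blast
  from range wf dp show ?thesis
  proof eventually_elim
    case (elim \<omega>)
    let ?A = "E 1 \<omega>"
    have g: "greedy conflicts lattice_edges (\<lambda>e. \<tau> e \<omega>) ?A" and sub: "?A \<subseteq> lattice_edges"
      using dimer_greedy[OF elim(3)] elim(1) by auto
    have "greedy conflicts lattice_edges (X \<omega>) ?A"
      unfolding greedy_def
    proof
      have Xe: "X \<omega> e = \<tau> e \<omega>" if "e \<in> lattice_edges" for e :: "(int ^ 'd) set" using that unfolding X_def by simp
      fix e :: "(int ^ 'd) set" assume e: "e \<in> lattice_edges"
      have "(\<forall>f\<in>conflicts e. X \<omega> f < X \<omega> e \<longrightarrow> f \<notin> ?A) \<longleftrightarrow> (\<forall>f\<in>conflicts e. \<tau> f \<omega> < \<tau> e \<omega> \<longrightarrow> f \<notin> ?A)"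
      proof (rule ball_cong[OF refl])
        fix f assume "f \<in> conflicts e"
        then have "f \<in> lattice_edges" using conflicts_subset by blast
        then show "(X \<omega> f < X \<omega> e \<longrightarrow> f \<notin> ?A) \<longleftrightarrow> (\<tau> f \<omega> < \<tau> e \<omega> \<longrightarrow> f \<notin> ?A)"
          by (simp only: Xe e)
      qed
      with g e show "e \<in> ?A \<longleftrightarrow> (\<forall>f\<in>conflicts e. X \<omega> f < X \<omega> e \<longrightarrow> f \<notin> ?A)"
        unfolding greedy_def by blast
    qed
    then have "e \<in> ?A \<longleftrightarrow> e \<in> greedy_set conflicts (X \<omega>)" if "e \<in> lattice_edges" for e
      using elim(2) that by (intro greedy_unique[where E = lattice_edges] conflicts_subset) (auto simp: well_founded_clocks_def)
    then show ?case
      using sub unfolding uncovered_def free_def edges_at_def by (auto simp: of_bool_eq_iff)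
  qed
qed

lemma uncovered_measurable:
  assumes "dimer_placement_process M \<tau> E"
  shows "uncovered E v \<in> borel_measurable M"
proof -
  have E: "random_edge_set M (E 1)" using assms unfolding dimer_placement_process_def by auto
  have "Measurable.pred M (\<lambda>\<omega>. \<forall>e\<in>edges_at v. e \<notin> E 1 \<omega>)"
  proof (rule pred_intros_finite(3))
    fix e assume "e \<in> edges_at v"
    then have "Measurable.pred M (\<lambda>\<omega>. e \<in> E 1 \<omega>)"
      using E edges_at_lattice unfolding random_edge_set_def pred_def by blast
    then show "Measurable.pred M (\<lambda>\<omega>. e \<notin> E 1 \<omega>)" by measurable
  qed simp
  then have "(\<lambda>\<omega>. of_bool (\<forall>e\<in>edges_at v. e \<notin> E 1 \<omega>) :: real) \<in> borel_measurable M" by measurable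
  moreover have "uncovered E v \<omega> = of_bool (\<forall>e\<in>edges_at v. e \<notin> E 1 \<omega>)" if "\<omega> \<in> space M" for \<omega>
  proof -
    have "E 1 \<omega> \<subseteq> lattice_edges" using E that unfolding random_edge_set_def by blast
    then show ?thesis unfolding uncovered_def edges_at_def by (auto simp: of_bool_eq_iff)
  qed
  ultimately show ?thesis by (simp cong: measurable_cong)
qed

theorem mainTheorem1:
  fixes M :: "'w measure"
    and \<tau> :: "(int ^ 'd) set \<Rightarrow> 'w \<Rightarrow> real"
    and E :: "real \<Rightarrow> 'w \<Rightarrow> (int ^ 'd) set set"
    and \<sigma>2 :: real
  assumes "prob_space M"
    and "iid_uniform_times M \<tau>"
    and "dimer_placement_process M \<tau> E"
  defines "\<sigma>2 \<equiv> (\<Sum>\<^sub>\<infinity>\<rho>\<in>UNIV. covariance M (uncovered E 0) (uncovered E \<rho>))"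
  shows "(\<lambda>\<rho>. \<bar>covariance M (uncovered E 0) (uncovered E \<rho>)\<bar>) summable_on UNIV
    \<and> \<sigma>2 > 0
    \<and> weak_conv_m
           (\<lambda>n. distr M borel (\<lambda>\<omega>. sqrt (real (card (lattice_box n :: (int ^ 'd) set)))
                                  * centred_average M E n \<omega> / sqrt \<sigma>2))
           std_normal_distribution"
proof -
  interpret prob_space M by fact
  define X where "X = (\<lambda>\<omega>. \<lambda>e\<in>lattice_edges. \<tau> e \<omega>)"
  note X = clocks_distr[OF assms(1,2), folded X_def]
  note [measurable] = X(1) uncovered_measurable[OF assms(3)]
  have AE: "AE \<omega> in M. \<forall>v. uncovered E v \<omega> = free v (X \<omega>)"
    using uncovered_AE[OF assms(1-3)] unfolding X_def .
  have mean: "integral\<^sup>L M (uncovered E v) = integral\<^sup>L law (free v)" for v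
  proof -
    have "integral\<^sup>L M (uncovered E v) = (\<integral>\<omega>. free v (X \<omega>) \<partial>M)"
      by (rule integral_cong_AE) (measurable, use AE in \<open>auto elim: eventually_mono\<close>)
    also have "\<dots> = integral\<^sup>L (distr M law X) (free v)"
      by (rule integral_distr[symmetric]) measurable
    finally show ?thesis unfolding X(2) .
  qed
  have cov: "covariance M (uncovered E 0) (uncovered E \<rho>) = cov \<rho>" for \<rho>
  proof -
    let ?g = "\<lambda>x. (free 0 x - integral\<^sup>L law (free (0 :: int ^ 'd))) * (free \<rho> x - integral\<^sup>L law (free \<rho>))"
    have "covariance M (uncovered E 0) (uncovered E \<rho>) = (\<integral>\<omega>. ?g (X \<omega>) \<partial>M)"
      unfolding covariance_def mean
      by (rule integral_cong_AE) (measurable, use AE in \<open>auto elim: eventually_mono\<close>)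
    also have "\<dots> = integral\<^sup>L (distr M law X) ?g"
      by (rule integral_distr[symmetric]) measurable
    finally show ?thesis unfolding X(2) cov_def covariance_def .
  qed
  have \<sigma>: "\<sigma>2 = limit_variance TYPE('d)"
    unfolding \<sigma>2_def cov limit_variance_def ..
  have "distr M borel (\<lambda>\<omega>. sqrt (real (card (lattice_box n :: (int ^ 'd) set))) * centred_average M E n \<omega> / sqrt \<sigma>2)
     = distr law borel (\<lambda>x :: 'd clocks. box_sum n x / sqrt (real n ^ CARD('d) * limit_variance TYPE('d)))" for n
  proof -
    let ?N = "real (card (lattice_box n :: (int ^ 'd) set))"
    have N: "?N = real n ^ CARD('d)" using lattice_box_card[of n, where 'd = 'd] by simp
    have fin: "finite (lattice_box n :: (int ^ 'd) set)" using lattice_box_card by blast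
    have scale: "sqrt ?N * (1 / ?N * y) / sqrt \<sigma>2 = y / sqrt (?N * \<sigma>2)" if "?N = 0 \<longrightarrow> y = 0" for y
    proof (cases "?N = 0")
      case False
      have "sqrt ?N * (1 / ?N * y) / sqrt \<sigma>2 = (sqrt ?N / ?N) * y / sqrt \<sigma>2" by simp
      also have "\<dots> = inverse (sqrt ?N) * y / sqrt \<sigma>2"
        by (subst sqrt_divide_self_eq) simp_all
      also have "\<dots> = y / sqrt (?N * \<sigma>2)" by (simp add: real_sqrt_mult divide_simps)
      finally show ?thesis .
    qed (use that in simp)
    have "distr M borel (\<lambda>\<omega>. sqrt ?N * centred_average M E n \<omega> / sqrt \<sigma>2)
       = distr M borel (\<lambda>\<omega>. box_sum n (X \<omega>) / sqrt (?N * \<sigma>2))"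
    proof (rule distr_cong_AE)
      show "AE \<omega> in M. sqrt ?N * centred_average M E n \<omega> / sqrt \<sigma>2 = box_sum n (X \<omega>) / sqrt (?N * \<sigma>2)"
        using AE
      proof eventually_elim
        case (elim \<omega>)
        have "centred_average M E n \<omega> = 1 / ?N * box_sum n (X \<omega>)"
          unfolding centred_average_def box_sum_def mean using elim by simp
        moreover have "?N = 0 \<longrightarrow> box_sum n (X \<omega>) = 0" unfolding box_sum_def using fin by simp
        ultimately show ?case using scale by simp
      qed
    qed (simp_all add: centred_average_def)
    also have "\<dots> = distr (distr M law X) borel (\<lambda>x. box_sum n x / sqrt (?N * \<sigma>2))"
      by (subst distr_distr) (simp_all add: comp_def X(1))
    finally show ?thesis unfolding X(2) N \<sigma> .
  qed
  then show ?thesis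
    unfolding cov \<sigma> using cov_summable limit_variance_pos box_sum_clt by simp
qed

end
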